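(* Consider the lattice differential equation $\dot X = LX + G(X)$ on $\mathcal X=\ell^\infty(\mathbb Z,\mathbb R^n)$, and let $\phi^\pm$ be traveling waves with speeds $c_\pm$ and limits $\phi^\pm(-\infty)=\alpha_\pm$, $\phi^\pm(+\infty)=\omega_\pm$. Suppose $c_-<c_+$, $\omega_-=\alpha_+$, and that the hypotheses (H0), (H1), (H2) written out in the context hold. Then there exists a positive constant $a$ such that for each $\varepsilon>0$ there exist positive constants $C$, $\delta_0$ and $\tau^*$ such that if $$\|X_{init}-\phi^+(\cdot-\tau_+)-\phi^-(\cdot-\tau_-)\|\le\delta<\delta_0 \qquad\text{with}\qquad \tau_+-\tau_-\ge\tau^*,$$ then there are real constants $\gamma^+_*$ and $\gamma^-_*$ in $(-\varepsilon,\varepsilon)$ such that the solution $X$ of $\dot X=LX+G(X)$ with initial condition $X_{init}$ satisfies $$e^{at}\,\|X(t)-\phi^+(\cdot-c_+t-\tau_+-\gamma^+_* )-\phi^-(\cdot-c_-t-\tau_--\gamma^-_* )\|\le C\left(e^{-a\tau^*}+\sqrt{\delta}\right)$$ for all $t\ge0$.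
   Context: Setting. $\mathcal X:=\ell^\infty(\mathbb Z,\mathbb R^n)$ with its norm $\|\cdot\|$. $S$ denotes the shift, $(Sx)_j=x_{j-1}$. For a function $\phi$ on $\mathbb R$ and $\tau\in\mathbb R$, $\phi(\cdot-\tau)$ denotes the sequence $j\mapsto\phi(j-\tau)$, $j\in\mathbb Z$; when $\phi$ itself is said to belong to a sequence space, this refers to the sequence $(\phi(j))_{j\in\mathbb Z}$. For $\beta\in\mathbb R$, $$\mathcal X_\beta:=\{X\in\ell^\infty(\mathbb Z,\mathbb R^n):\ \|X\|_\beta:=\sup_{j\in\mathbb Z}|(1+e^{\beta j})X_j|<\infty\}.$$ $\mathcal L(E)$ denotes the bounded linear operators on a Banach space $E$. Equation. $\dot X=LX+G(X)$, where $L\in\mathcal L(\mathcal X)$ annihilates constant sequences and $G:\mathcal X\to\mathcal X$ contains the nonlinear terms, which may be nonlocal. A traveling wave is a solution of the form $X_j(t)=\phi(j-ct)$ for some continuous function $\phi$ with finite limits $\phi(-\infty)=\alpha$ and $\phi(+\infty)=\omega$; it is a pulse if $\alpha=\omega$ and a front if $\alpha\neq\omega$, and each of $\phi^-$, $\phi^+$ may be either. The common value $\omega_-=\alpha_+$ is taken to be $0$, without loss of generality because $L$ annihilates constants. Hypotheses (with one common $b>0$): (H0) $G$ has the form $G(X)_k=g\big((N_1X)_k,\dots,(N_JX)_k\big)$, $k\in\mathbb Z$, where $g\in C^{1,1}_{loc}(\mathbb R^{nJ},\mathbb R^n)$ with $g(0)=0$, and each $N_i$ satisfies $N_i\in\mathcal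 L(\mathcal X_\beta)$ for all $\beta\in[-b,b]$ and commutes with the shift $S$. (H1) There is a $b>0$ such that the equation admits traveling wave solutions $\phi^-\in\mathcal X_b$ and $\phi^+\in\mathcal X_{-b}$ with speeds $c_-\ne c_+$ and $\omega_-=\alpha_+$. Moreover the derivatives satisfy $\phi'_-\in\mathcal X_b$ and $\phi'_+\in\mathcal X_{-b}$ (where $\phi'_\pm$ is the derivative of $\phi^\pm$). (H2) Let $\Phi^\pm(t,t_0)$ denote the solution map from time $t_0$ to time $t$ of the linear equation $\dot Y=(L+G'(\phi^\pm))Y$, the linearization about the traveling wave solution $\phi^\pm(\cdot-c_\pm t)$, and let $A^\pm:=S^{-1}\Phi^\pm(1/c_\pm,0)$ (so $c_\pm\ne0$). Then $1$ is a simple eigenvalue of $A^\pm$, with eigenfunction $\phi'_\pm$, and $\sigma(A^\pm)\setminus\{1\}$ is contained in the open unit disc. Here the spectrum is computed regarding $A^-$ as an operator on $\mathcal X_b$ and $A^+$ as an operator on $\mathcal X_{-b}$.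
   Formalization: L is also assumed to commute with S and to lie in L(X_β) for β in [-b,b]; and for c_±<0 the operator A^± is taken as SΦ^±(1/|c_±|,0), forward in time, not S^{-1}Φ^±(1/c_±,0). Without these the claim is false or (H2) is not meaningful. *)

theory Defs
  imports "HOL-Analysis.Analysis"
begin

text \<open>
  Every function on \<open>int\<close> is continuous, so \<^typ>\<open>int \<Rightarrow>\<^sub>C real ^ 'n\<close> is the Banach
  space of bounded two-sided sequences in \<open>real ^ 'n\<close> with the supremum norm.
\<close>

type_synonym 'n bseq = "int \<Rightarrow>\<^sub>C (real, 'n) vec"

lemma int_bcontfun_iff: "f \<in> bcontfun \<longleftrightarrow> bounded (range f)"
  for f :: "int \<Rightarrow> 'a::metric_space"
  by (simp add: bcontfun_def continuous_on_discrete)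


subsection \<open>Shifts and translates\<close>

text \<open>\<open>shift k\<close> is the \<open>k\<close>-th power of the shift \<open>S\<close>, \<open>(S x) j = x (j - 1)\<close>.\<close>

definition shift :: "int \<Rightarrow> 'n::finite bseq \<Rightarrow> 'n bseq"
  where "shift k X = Bcontfun (\<lambda>j. X (j - k))"

lemma shift_apply: "shift k X j = X (j - k)"
  unfolding shift_def
  by (subst Bcontfun_inverse)
    (auto simp: int_bcontfun_iff intro: bounded_subset[OF bounded_apply_bcontfun[of X]])

text \<open>\<open>translate \<phi> \<tau>\<close> is the sequence \<open>\<phi>(\<cdot> - \<tau>)\<close>; it is used only for bounded \<open>\<phi>\<close>.\<close>

definition translate :: "(real \<Rightarrow> real ^ 'n) \<Rightarrow> real \<Rightarrow> 'n::finite bseq"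
  where "translate \<phi> \<tau> = Bcontfun (\<lambda>j. \<phi> (of_int j - \<tau>))"

lemma translate_apply: "bounded (range \<phi>) \<Longrightarrow> translate \<phi> \<tau> j = \<phi> (of_int j - \<tau>)"
  unfolding translate_def
  by (subst Bcontfun_inverse) (auto simp: int_bcontfun_iff intro: bounded_subset)


subsection \<open>The weighted spaces \<open>X\<^sub>\<beta>\<close>\<close>

definition weighted :: "real \<Rightarrow> 'n::finite bseq \<Rightarrow> int \<Rightarrow> real"
  where "weighted \<beta> X j = norm ((1 + exp (\<beta> * of_int j)) *\<^sub>R X j)"

definition wspace :: "real \<Rightarrow> 'n::finite bseq set"
  where "wspace \<beta> = {X. bdd_above (range (weighted \<beta> X))}"

definition wnorm :: "real \<Rightarrow> 'n::finite bseq \<Rightarrow> real"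
  where "wnorm \<beta> X = (SUP j. weighted \<beta> X j)"

text \<open>A function on the reals belongs to \<open>X\<^sub>\<beta>\<close> if its sequence of values at the integers does.\<close>

definition sampled_in_wspace :: "(real \<Rightarrow> real ^ 'n::finite) \<Rightarrow> real \<Rightarrow> bool"
  where "sampled_in_wspace \<phi> \<beta> \<longleftrightarrow> (\<exists>X \<in> wspace \<beta>. \<forall>j. X j = \<phi> (of_int j))"

text \<open>A bounded operator on all bounded sequences that restricts to a bounded operator on \<open>X\<^sub>\<beta>\<close>.\<close>

definition bounded_on_wspace :: "real \<Rightarrow> ('n::finite bseq \<Rightarrow>\<^sub>L 'n bseq) \<Rightarrow> bool"
  where "bounded_on_wspace \<beta> T \<longleftrightarrow>
    (\<forall>X \<in> wspace \<beta>. T X \<in> wspace \<beta>) \<and> (\<exists>K. \<forall>X \<in> wspace \<beta>. wnorm \<beta> (T X) \<le> K * wnorm \<beta> X)"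

text \<open>
  The theorem requires both properties not only of the operators \<open>N\<^sub>i\<close> but also of \<open>L\<close>:
  the equation is invariant under lattice translations, and its linearization is posed
  on \<open>X\<^sub>b\<close> and on \<open>X\<^sub>-\<^sub>b\<close>.
\<close>

definition shift_invariant :: "('n::finite bseq \<Rightarrow>\<^sub>L 'n bseq) \<Rightarrow> bool"
  where "shift_invariant T \<longleftrightarrow> (\<forall>X. T (shift 1 X) = shift 1 (T X))"


subsection \<open>The nonlinearity\<close>

definition C11_loc :: "('a::real_normed_vector \<Rightarrow> 'b::real_normed_vector) \<Rightarrow> bool"
  where "C11_loc g \<longleftrightarrow> (\<exists>g' :: 'a \<Rightarrow> 'a \<Rightarrow>\<^sub>L 'b.
    (\<forall>x. (g has_derivative blinfun_apply (g' x)) (at x)) \<and>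
    (\<forall>x. \<exists>r > 0. \<exists>K. K-lipschitz_on (ball x r) g'))"

text \<open>The points of \<open>R\<^sup>n\<^sup>J\<close> are \<open>J\<close>-tuples of vectors of \<open>R\<^sup>n\<close>.\<close>

definition nonlinearity ::
    "(real ^ 'n ^ 'm \<Rightarrow> real ^ 'n) \<Rightarrow> ('m::finite \<Rightarrow> 'n bseq \<Rightarrow>\<^sub>L 'n bseq) \<Rightarrow> 'n::finite bseq \<Rightarrow> 'n bseq"
  where "nonlinearity g N X = Bcontfun (\<lambda>k. g (\<chi> i. N i X k))"

lemma nonlinearity_apply:
  assumes "continuous_on UNIV g"
  shows "nonlinearity g N X k = g (\<chi> i. N i X k)"
proof -
  let ?h = "\<lambda>k. \<chi> i. N i X k"
  have "bounded (range ?h)"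
  proof (rule boundedI)
    fix y assume "y \<in> range ?h"
    then obtain k where k: "y = ?h k" by auto
    have "norm y \<le> (\<Sum>i\<in>UNIV. norm (y $ i))"
      by (simp add: norm_vec_def L2_set_le_sum)
    also have "\<dots> \<le> (\<Sum>i\<in>UNIV. norm (N i X))"
      unfolding k by (intro sum_mono) (simp add: norm_bounded)
    finally show "norm y \<le> (\<Sum>i\<in>UNIV. norm (N i X))" .
  qed
  then have "compact (g ` closure (range ?h))"
    using assms by (intro compact_continuous_image) (auto intro: continuous_on_subset)
  then have "bounded (range (\<lambda>k. g (?h k)))"
    by (rule bounded_subset[OF compact_imp_bounded]) (use closure_subset in fastforce)
  then show ?thesis
    unfolding nonlinearity_def by (subst Bcontfun_inverse) (auto simp: int_bcontfun_iff)
qed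


subsection \<open>Solutions and traveling waves\<close>

text \<open>Derivatives in time are taken in the supremum norm.\<close>

definition solves :: "(real \<Rightarrow> 'a::real_normed_vector \<Rightarrow> 'a) \<Rightarrow> real set \<Rightarrow> (real \<Rightarrow> 'a) \<Rightarrow> bool"
  where "solves F I X \<longleftrightarrow> (\<forall>t \<in> I. (X has_vector_derivative F t (X t)) (at t within I))"

definition solution_map :: "(real \<Rightarrow> 'a::real_normed_vector \<Rightarrow> 'a) \<Rightarrow> real \<Rightarrow> real \<Rightarrow> 'a \<Rightarrow> 'a"
  where "solution_map F t t0 Y0 = (THE Y1. \<exists>Y. solves F UNIV Y \<and> Y t0 = Y0 \<and> Y t = Y1)"

definition traveling_wave ::
    "('n::finite bseq \<Rightarrow> 'n bseq) \<Rightarrow> (real \<Rightarrow> real ^ 'n) \<Rightarrow> real \<Rightarrow> real ^ 'n \<Rightarrow> real ^ 'n \<Rightarrow> bool"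
  where "traveling_wave F \<phi> c \<alpha> \<omega> \<longleftrightarrow>
    continuous_on UNIV \<phi> \<and> (\<phi> \<longlongrightarrow> \<alpha>) at_bot \<and> (\<phi> \<longlongrightarrow> \<omega>) at_top \<and>
    solves (\<lambda>_. F) UNIV (\<lambda>t. translate \<phi> (c * t))"


subsection \<open>Spectral stability\<close>

text \<open>
  The operator \<open>z - A\<close> on the complexification: a pair \<open>(U, V)\<close> stands for \<open>U + \<i>V\<close>.
\<close>

definition complex_shifted :: "('n::finite bseq \<Rightarrow> 'n bseq) \<Rightarrow> complex \<Rightarrow> 'n bseq \<times> 'n bseq \<Rightarrow> 'n bseq \<times> 'n bseq"
  where "complex_shifted A z = (\<lambda>(U, V).
    (Re z *\<^sub>R U - Im z *\<^sub>R V - A U, Im z *\<^sub>R U + Re z *\<^sub>R V - A V))"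

definition wnorm_pair :: "real \<Rightarrow> 'n::finite bseq \<times> 'n bseq \<Rightarrow> real"
  where "wnorm_pair \<beta> = (\<lambda>(U, V). wnorm \<beta> U + wnorm \<beta> V)"

text \<open>
  The spectrum of a real linear operator \<open>A\<close> on \<open>X\<^sub>\<beta>\<close>, that is, of its complexification:
  \<open>z\<close> is in the resolvent set iff \<open>z - A\<close> is a bijection of the complexified space
  whose inverse is bounded.
\<close>

definition resolvent_set :: "real \<Rightarrow> ('n::finite bseq \<Rightarrow> 'n bseq) \<Rightarrow> complex set"
  where "resolvent_set \<beta> A = {z.
    bij_betw (complex_shifted A z) (wspace \<beta> \<times> wspace \<beta>) (wspace \<beta> \<times> wspace \<beta>) \<and>
    (\<exists>K. \<forall>Z \<in> wspace \<beta> \<times> wspace \<beta>. wnorm_pair \<beta> Z \<le> K * wnorm_pair \<beta> (complex_shifted A z Z))}"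

definition spectrum :: "real \<Rightarrow> ('n::finite bseq \<Rightarrow> 'n bseq) \<Rightarrow> complex set"
  where "spectrum \<beta> A = - resolvent_set \<beta> A"

text \<open>
  A real number \<open>\<mu>\<close> is a simple eigenvalue of \<open>A\<close> on \<open>X\<^sub>\<beta>\<close> with eigenvector \<open>v\<close> if the kernel
  of \<open>A - \<mu>\<close> is spanned by \<open>v \<noteq> 0\<close> and its range has codimension one and does not contain
  \<open>v\<close>. For a bounded operator this is algebraic multiplicity one in the usual sense:
  \<open>\<mu>\<close> is isolated in the spectrum and its spectral projection has rank one. In infinite
  dimensions this is more than a one-dimensional generalized eigenspace, which alone
  would allow the rest of the spectrum to accumulate at \<open>\<mu>\<close>.
\<close>

definition simple_eigenvalue :: "real \<Rightarrow> ('n::finite bseq \<Rightarrow> 'n bseq) \<Rightarrow> real \<Rightarrow> 'n bseq \<Rightarrow> bool"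
  where "simple_eigenvalue \<beta> A \<mu> v \<longleftrightarrow>
    (let R = (\<lambda>Y. A Y - \<mu> *\<^sub>R Y) ` wspace \<beta> in
      v \<noteq> 0 \<and> {Y \<in> wspace \<beta>. A Y = \<mu> *\<^sub>R Y} = span {v} \<and>
      v \<notin> R \<and> wspace \<beta> = {s *\<^sub>R v + Z |s Z. Z \<in> R})"

definition linearization ::
    "('n::finite bseq \<Rightarrow>\<^sub>L 'n bseq) \<Rightarrow> ('n bseq \<Rightarrow> 'n bseq) \<Rightarrow> (real \<Rightarrow> real ^ 'n) \<Rightarrow> real \<Rightarrow> real \<Rightarrow> 'n bseq \<Rightarrow> 'n bseq"
  where "linearization L G \<phi> c t Y = L Y + frechet_derivative G (at (translate \<phi> (c * t))) Y"

text \<open>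
  The linearized evolution over one period of the wave (the time \<open>1 / \<bar>c\<bar>\<close> in which it moves
  by one site), followed by the shift back to the original position. For \<open>c > 0\<close> this is
  \<open>S\<^sup>-\<^sup>1 \<Phi>(1/c, 0)\<close>. For \<open>c < 0\<close> the wave moves to the left and the operator is
  \<open>S \<Phi>(1/\<bar>c\<bar>, 0)\<close>. There the expression \<open>S\<^sup>-\<^sup>1 \<Phi>(1/c, 0)\<close>, read literally, runs the evolution
  backwards in time: for a shift invariant equation it is the inverse of the operator
  below, with the same eigenvector for the eigenvalue 1, and requiring the rest of its
  spectrum to lie in the unit disc would say that the wave is unstable.
\<close>

definition period_map ::
    "('n::finite bseq \<Rightarrow>\<^sub>L 'n bseq) \<Rightarrow> ('n bseq \<Rightarrow> 'n bseq) \<Rightarrow> (real \<Rightarrow> real ^ 'n) \<Rightarrow> real \<Rightarrow> 'n bseq \<Rightarrow> 'n bseq"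
  where "period_map L G \<phi> c Y =
    shift (if c > 0 then - 1 else 1) (solution_map (linearization L G \<phi> c) (1 / \<bar>c\<bar>) 0 Y)"

end

(*
The constant C may depend on the separation threshold, so the claim amounts to exponential
convergence to a sum of two translated waves whose phases move by less than epsilon.

Single wave: the spectral assumption gives decay in the weighted space, up to the translation mode.
Operators that are bounded on X_b and X_-b propagate information at finite speed up to exponentially
small errors. Hence, far ahead of a wave, the decay is inherited by the linearization at the zero
state that lies between the waves: exponentially weighted for both signs of the weight, in frames
moving with the two speeds. Since the rear wave is slower, the two weighted estimates interpolate
to decay in the unweighted norm. Cutting a bounded perturbation repeatedly ahead of the wave
then turns the weighted decay into decay in the supremum norm, again up to the translation mode.

Two waves: over a fixed time, cut the perturbation halfway between the waves and let each part
evolve under the linearization about its own wave. The errors are quadratic or exponentially small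
in the separation, and the translation modes are absorbed into the phases. So the deviation is
halved in each such step up to an exponentially small term, while the separation grows linearly;
iterating the step makes the phases converge.
*)

theory Submission
  imports Defs
begin

section \<open>Ordinary differential equations in Banach spaces\<close>

text \<open>The spectral hypotheses concern \<open>X_b\<close> and \<open>X_-b\<close>, while the
  initial deviation is merely bounded, and the cut-offs of a bounded sequence need not converge to
  it in the supremum norm. So density does not carry decay from the weighted spaces to bounded
  sequences, and decay at the zero state needs its own source. It is a translation argument: data
  moved far ahead of the wave and rescaled by the weight stay bounded in the weighted norm, their
  evolution approaches that at zero, and the coefficient of the translation mode tends to zero along
  them, because disjoint translates with arbitrary signs have bounded sums. Weighted decay itself is
  obtained for real operators, by subtracting the projection onto the translation mode and turning
  the resolvent bounds of the rest into a small power. The interactions rest on a single inequality: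
  a weight of exponent \<open>s\<close> centred at \<open>y\<close> times one of exponent
  \<open>- s\<close> centred at \<open>y'\<close> is at least \<open>exp (s * (y' - y))\<close>. The
  step time is fixed, so the exponential growth in the crude bounds enters the constants
  only.\<close>

lemma gronwall:
  fixes Y :: "real \<Rightarrow> 'a::real_normed_vector"
  assumes T: "T \<ge> 0" and K: "K \<ge> 0" and f: "f \<ge> 0"
    and der: "\<And>t. t \<in> {0..T} \<Longrightarrow> (Y has_vector_derivative Y' t) (at t within {0..T})"
    and bnd: "\<And>t. t \<in> {0..T} \<Longrightarrow> norm (Y' t) \<le> K * norm (Y t) + f"
  shows "norm (Y T) \<le> (norm (Y 0) + f * T) * exp (K * T)"
proof (rule field_le_epsilon)
  fix e :: real assume e: "e > 0"
  \<comment> \<open>The slack \<eta> makes \<open>u\<close> exceed the norm of \<open>Y\<close>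
    strictly at time 0, so a violation has a first time. The denominator makes its total
    contribution at time \<open>T\<close> equal to \<open>e\<close>.\<close>
  define \<eta> where "\<eta> = e / ((1 + T) * exp (K * T))"
  have \<eta>: "\<eta> > 0" using e T by (simp add: \<eta>_def)
  define u where "u t = (norm (Y 0) + \<eta> + (f + \<eta>) * t) * exp (K * t)" for t
  define u' where "u' t = (f + \<eta>) * exp (K * t) + K * u t" for t
  have du: "(u has_vector_derivative u' t) (at t)" for t
    unfolding u_def u'_def has_real_derivative_iff_has_vector_derivative[symmetric]
    by (auto intro!: derivative_eq_intros simp: algebra_simps)
  have contY: "continuous_on {0..T} Y"
    using der by (meson continuous_on_eq_continuous_within has_vector_derivative_continuous)
  have contu: "continuous_on A u" for A
    unfolding u_def by (intro continuous_intros)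
  have "norm (Y t) < u t" if t: "t \<in> {0..T}" for t
  proof (rule ccontr)
    assume neg: "\<not> norm (Y t) < u t"
    define S where "S = {s \<in> {0..T}. u s \<le> norm (Y s)}"
    have "closed S" unfolding S_def
      by (intro continuous_closed_preimage_constant continuous_on_closed_Collect_le contu
          continuous_on_norm contY closed_atLeastAtMost)
    moreover have "S \<noteq> {}" "bdd_below S" using t neg by (auto simp: S_def not_less)
    ultimately have inS: "Inf S \<in> S" by (rule closed_contains_Inf[rotated 2])
    define s where "s = Inf S"
    have s: "s \<in> {0..T}" "u s \<le> norm (Y s)" using inS by (auto simp: S_def s_def)
    have less: "norm (Y r) < u r" if "0 \<le> r" "r < s" for r
    proof (rule ccontr)
      assume "\<not> ?thesis"
      then have "r \<in> S" using that s by (auto simp: S_def)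
      then have "s \<le> r" unfolding s_def using \<open>bdd_below S\<close> by (rule cInf_lower)
      then show False using that by simp
    qed
    have "s \<noteq> 0" using s \<eta> by (auto simp: u_def)
    then have "0 < s" using s by auto
    \<comment> \<open>The norm of \<open>Y\<close> need not be differentiable; the mean value
      inequality compares \<open>Y\<close> itself with \<open>u\<close> and leaves the gap \<eta> at
      the contact time.\<close>
    have "norm (Y s - Y 0) \<le> u s - u 0"
    proof (rule differentiable_bound_general[OF \<open>0 < s\<close>])
      show "continuous_on {0..s} Y" by (rule continuous_on_subset[OF contY]) (use s in auto)
      show "continuous_on {0..s} u" by (rule contu)
      fix x assume x: "0 < x" "x < s"
      then have "x \<in> interior {0..T}" using s by auto
      then have "at x within {0..T} = at x" by (rule at_within_interior)
      then show "(Y has_vector_derivative Y' x) (at x)"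
        using der[of x] x s by (metis atLeastAtMost_iff less_le_trans less_imp_le order_trans)
      show "(u has_vector_derivative u' x) (at x)" by (rule du)
      have "norm (Y' x) \<le> K * norm (Y x) + f" using bnd[of x] x s by auto
      also have "\<dots> \<le> K * u x + (f + \<eta>) * 1"
        using less[of x] x K \<eta> by (intro add_mono mult_left_mono) auto
      also have "\<dots> \<le> u' x" unfolding u'_def using K x f \<eta>
        by (auto intro!: mult_left_mono)
      finally show "norm (Y' x) \<le> u' x" .
    qed
    moreover have "norm (Y s) \<le> norm (Y s - Y 0) + norm (Y 0)"
      using norm_triangle_sub[of "Y s" "Y 0"] by simp
    moreover have "u 0 = norm (Y 0) + \<eta>" by (simp add: u_def)
    ultimately show False using s \<eta> by simp
  qed
  then have "norm (Y T) \<le> u T" using T by (meson atLeastAtMost_iff less_imp_le order_refl)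
  also have "u T = (norm (Y 0) + f * T) * exp (K * T) + \<eta> * ((1 + T) * exp (K * T))"
    by (simp add: u_def algebra_simps)
  also have "\<eta> * ((1 + T) * exp (K * T)) = e" using T by (simp add: \<eta>_def)
  finally show "norm (Y T) \<le> (norm (Y 0) + f * T) * exp (K * T) + e" .
qed

text \<open>The Lipschitz bound is required only between the two given solutions, so locally
  Lipschitz fields are covered as well.\<close>

lemma ode_unique:
  fixes Y Z :: "real \<Rightarrow> 'a::real_normed_vector"
  assumes T: "T \<ge> 0" and K: "K \<ge> 0"
    and Y: "\<And>t. t \<in> {0..T} \<Longrightarrow> (Y has_vector_derivative F t (Y t)) (at t within {0..T})"
    and Z: "\<And>t. t \<in> {0..T} \<Longrightarrow> (Z has_vector_derivative F t (Z t)) (at t within {0..T})"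
    and lip: "\<And>t. t \<in> {0..T} \<Longrightarrow> norm (F t (Y t) - F t (Z t)) \<le> K * norm (Y t - Z t)"
    and eq: "Y 0 = Z 0"
  shows "Y T = Z T"
proof -
  have "norm (Y T - Z T) \<le> (norm (Y 0 - Z 0) + 0 * T) * exp (K * T)"
    by (rule gronwall[where Y' = "\<lambda>t. F t (Y t) - F t (Z t)"])
      (use assms in \<open>auto intro!: derivative_intros\<close>)
  then show ?thesis using eq by simp
qed

text \<open>The oriented integral from 0 to \<open>t\<close>: integrals over reversed intervals
  vanish, so at most one term is nonzero. Negative times matter because \<open>solution_map\<close>
  asks for solutions on the whole line.\<close>

definition primitive :: "(real \<Rightarrow> 'a::banach) \<Rightarrow> real \<Rightarrow> 'a" where
  "primitive h t = integral {0..t} h - integral {t..0} h"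

lemma primitive_nonneg: "t \<ge> 0 \<Longrightarrow> primitive h t = integral {0..t} h"
  by (cases "t = 0") (auto simp: primitive_def)

lemma primitive_0 [simp]: "primitive h 0 = 0"
  by (simp add: primitive_def)

lemma has_vector_derivative_primitive:
  fixes h :: "real \<Rightarrow> 'a::banach"
  assumes "continuous_on UNIV h"
  shows "(primitive h has_vector_derivative h t) (at t)"
proof -
  define n where "n = \<bar>t\<bar> + 1"
  have n: "n > 0" "t \<in> {-n<..<n}" by (auto simp: n_def)
  have cont: "continuous_on A h" for A using assms continuous_on_subset by blast
  then have int: "h integrable_on {a..c}" for a c by (rule integrable_continuous_real)
  have eq: "integral {-n..u} h - integral {-n..0} h = primitive h u" if "u \<in> {-n..n}" for u
  proof (cases "u \<ge> 0")
    case True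
    then show ?thesis using Henstock_Kurzweil_Integration.integral_combine[where a = "-n" and c = 0 and b = u and f = h] int n
      by (simp add: primitive_nonneg eq_diff_eq diff_eq_eq add.commute)
  next
    case False
    then show ?thesis using Henstock_Kurzweil_Integration.integral_combine[where a = "-n" and c = u and b = 0 and f = h] int that
      by (auto simp: primitive_def algebra_simps)
  qed
  have "((\<lambda>u. integral {-n..u} h - integral {-n..0} h) has_vector_derivative h t)
      (at t within {-n..n})"
    using n has_vector_derivative_diff_const[of "\<lambda>u. integral {-n..u} h"]
    by (simp add: integral_has_vector_derivative cont)
  then have "(primitive h has_vector_derivative h t) (at t within {-n..n})"
    by (rule has_vector_derivative_transform[rotated 2]) (use n eq in auto)
  moreover have "t \<in> interior {-n..n}" using n by auto
  ultimately show ?thesis by (metis at_within_interior)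
qed

text \<open>The division by \<open>l\<close> is what makes the integral operator a contraction in
  the norm with weight \<open>exp (- l * \<bar>t\<bar>)\<close>. Negative times are reflected to
  positive ones.\<close>

lemma norm_primitive_le:
  fixes h :: "real \<Rightarrow> 'a::banach"
  assumes cont: "continuous_on UNIV h" and l: "l > 0" and C: "C \<ge> 0"
    and bnd: "\<And>s. norm (h s) \<le> C * exp (l * \<bar>s\<bar>)"
  shows "norm (primitive h t) \<le> C / l * exp (l * \<bar>t\<bar>)"
proof -
  have *: "norm (P t) \<le> C / l * exp (l * t)"
    if t: "t > 0" and P: "\<And>s. (P has_vector_derivative k s) (at s)" "P 0 = 0"
      and k: "\<And>s. norm (k s) \<le> C * exp (l * \<bar>s\<bar>)" for P k :: "real \<Rightarrow> 'a" and t
  proof -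
    have "norm (P t - P 0) \<le> C / l * exp (l * t) - C / l * exp (l * 0)"
    proof (rule differentiable_bound_general[OF t])
      show "continuous_on {0..t} P"
        using P(1) by (meson continuous_at_imp_continuous_on has_vector_derivative_continuous)
      show "continuous_on {0..t} (\<lambda>s. C / l * exp (l * s))" by (intro continuous_intros)
      fix x assume x: "0 < x" "x < t"
      show "(P has_vector_derivative k x) (at x)" by (rule P)
      show "((\<lambda>s. C / l * exp (l * s)) has_vector_derivative C * exp (l * x)) (at x)"
        unfolding has_real_derivative_iff_has_vector_derivative[symmetric]
        using l by (auto intro!: derivative_eq_intros)
      show "norm (k x) \<le> C * exp (l * x)" using k[of x] x by simp
    qed
    also have "\<dots> \<le> C / l * exp (l * t)" using C l by simp
    finally show ?thesis using P by simp
  qed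
  consider "t > 0" | "t = 0" | "t < 0" by linarith
  then show ?thesis
  proof cases
    case 1
    then show ?thesis using *[of t "primitive h" h] bnd has_vector_derivative_primitive[OF cont] by simp
  next
    case 2
    then show ?thesis using C l by simp
  next
    case 3
    have "((\<lambda>s. primitive h (- s)) has_vector_derivative - h (- s)) (at s)" for s
      using vector_diff_chain_at[of uminus "-1" s "primitive h" "h (- s)", OF _
          has_vector_derivative_primitive[OF cont]]
        has_vector_derivative_minus[OF has_vector_derivative_id[of "at s"]]
      by (simp add: o_def)
    then show ?thesis using *[of "- t" "\<lambda>s. primitive h (- s)" "\<lambda>s. - h (- s)"] 3
        bnd[of "- _"] by simp
  qed
qed

lemma closed_apply_bcontfun:
  fixes C :: "'b::real_normed_vector set" and c :: real and t :: "'a::topological_space"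
  assumes "closed C"
  shows "closed {z :: 'a \<Rightarrow>\<^sub>C 'b. c *\<^sub>R z t \<in> C}"
proof -
  have "bounded_linear (\<lambda>z :: 'a \<Rightarrow>\<^sub>C 'b. z t)"
    by (rule bounded_linear_intro[where K = 1]) (auto simp: norm_bounded)
  then have "continuous_on UNIV (\<lambda>z :: 'a \<Rightarrow>\<^sub>C 'b. c *\<^sub>R z t)"
    by (intro continuous_on_scaleR continuous_on_const linear_continuous_on)
  then show ?thesis using assms closed_vimage[of C "\<lambda>z :: 'a \<Rightarrow>\<^sub>C 'b. c *\<^sub>R z t"] by (simp add: vimage_def)
qed

text \<open>
  The fixed point is sought in the space of functions of growth \<open>exp (l \<bar>t\<bar>)\<close>, where \<open>l\<close> is large
  enough for the integral operator to be a contraction; restricting it to a closed subset of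
  functions yields the invariance of the sets \<open>C t\<close>.
\<close>

theorem picard:
  fixes F :: "real \<Rightarrow> 'a::banach \<Rightarrow> 'a"
  assumes lip: "\<And>t x y. norm (F t x - F t y) \<le> K * norm (x - y)"
    and zero: "\<And>t. F t 0 = 0"
    and cont: "\<And>y. continuous_on UNIV y \<Longrightarrow> continuous_on UNIV (\<lambda>t. F t (y t))"
    and closed: "\<And>t. t \<ge> 0 \<Longrightarrow> closed (C t)" and zero_in: "\<And>t. t \<ge> 0 \<Longrightarrow> 0 \<in> C t"
    and step: "\<And>y t. continuous_on UNIV y \<Longrightarrow> t \<ge> 0 \<Longrightarrow> (\<And>s. s \<ge> 0 \<Longrightarrow> y s \<in> C s) \<Longrightarrow>
      V + integral {0..t} (\<lambda>s. F s (y s)) \<in> C t"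
  shows "\<exists>Y. (\<forall>t. (Y has_vector_derivative F t (Y t)) (at t)) \<and> Y 0 = V \<and> (\<forall>t\<ge>0. Y t \<in> C t)"
proof -
  \<comment> \<open>With this choice the contraction constant \<open>\<bar>K\<bar> / l\<close> is at
    most 1/2.\<close>
  define l where "l = 2 * \<bar>K\<bar> + 1"
  have l: "l > 0" by (simp add: l_def)
  have lip': "norm (F t x - F t y) \<le> \<bar>K\<bar> * norm (x - y)" for t x y
    using lip[of t x y] by (meson abs_ge_self mult_right_mono norm_ge_zero order_trans)
  define lift where "lift z s = exp (l * \<bar>s\<bar>) *\<^sub>R apply_bcontfun z s" for z :: "real \<Rightarrow>\<^sub>C 'a" and s
  define P where "P z t = V + primitive (\<lambda>s. F s (lift z s)) t" for z t
  define \<Gamma> where "\<Gamma> z t = exp (- l * \<bar>t\<bar>) *\<^sub>R P z t" for z t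
  have lift_cont: "continuous_on UNIV (lift z)" for z
    unfolding lift_def by (intro continuous_intros) simp
  have F_cont: "continuous_on UNIV (\<lambda>s. F s (lift z s))" for z by (intro cont lift_cont)
  have F_diff: "norm (F s (lift z s) - F s (lift z' s)) \<le> (\<bar>K\<bar> * dist z z') * exp (l * \<bar>s\<bar>)" for z z' s
  proof -
    have "norm (F s (lift z s) - F s (lift z' s)) \<le> \<bar>K\<bar> * norm (lift z s - lift z' s)" by (rule lip')
    also have "norm (lift z s - lift z' s) = exp (l * \<bar>s\<bar>) * dist (z s) (z' s)"
      by (simp add: lift_def dist_norm scaleR_diff_right[symmetric])
    also have "\<bar>K\<bar> * (exp (l * \<bar>s\<bar>) * dist (z s) (z' s)) \<le> \<bar>K\<bar> * (exp (l * \<bar>s\<bar>) * dist z z')"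
      by (intro mult_left_mono dist_bounded) auto
    finally show ?thesis by (simp add: mult_ac)
  qed
  have prim_diff: "primitive (\<lambda>s. F s (lift z s)) t - primitive (\<lambda>s. F s (lift z' s)) t =
      primitive (\<lambda>s. F s (lift z s) - F s (lift z' s)) t" for z z' t
  proof -
    have "(\<lambda>s. F s (lift z s)) integrable_on {a..c}" for z a c
      by (rule integrable_continuous_real) (rule continuous_on_subset[OF F_cont], simp)
    then show ?thesis unfolding primitive_def by (simp add: integral_diff)
  qed
  have P_diff: "norm (P z t - P z' t) \<le> 1 / 2 * dist z z' * exp (l * \<bar>t\<bar>)" for z z' t
  proof -
    have "norm (P z t - P z' t) \<le> (\<bar>K\<bar> * dist z z') / l * exp (l * \<bar>t\<bar>)"
      unfolding P_def add_diff_cancel_left prim_diff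
      by (rule norm_primitive_le) (use F_diff F_cont l in \<open>auto intro!: continuous_intros\<close>)
    also have "\<bar>K\<bar> * dist z z' / l = \<bar>K\<bar> / l * dist z z'" by simp
    also have "\<bar>K\<bar> / l * dist z z' * exp (l * \<bar>t\<bar>) \<le> 1 / 2 * dist z z' * exp (l * \<bar>t\<bar>)"
      using l by (intro mult_right_mono) (auto simp: l_def field_simps)
    finally show ?thesis .
  qed
  have P_deriv: "(P z has_vector_derivative F t (lift z t)) (at t)" for z t
    unfolding P_def using has_vector_derivative_primitive[OF F_cont]
    by (auto intro!: derivative_eq_intros)
  \<comment> \<open>Since \<open>F t 0 = 0\<close>, the zero function is mapped to the constant
    \<open>V\<close>; with \<open>P_diff\<close> this bounds every image.\<close>
  have P0: "P 0 t = V" for t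
    by (simp add: P_def lift_def zero primitive_def)
  have \<Gamma>_bcont: "\<Gamma> z \<in> bcontfun" for z
  proof (rule bcontfun_normI)
    show "continuous_on UNIV (\<Gamma> z)" unfolding \<Gamma>_def
      by (intro continuous_intros) (meson P_deriv continuous_at_imp_continuous_on has_vector_derivative_continuous)
    fix t
    have "norm (P z t) \<le> norm (P z t - P 0 t) + norm V" using P0[of t] norm_triangle_sub[of "P z t" V] by simp
    also have "\<dots> \<le> 1 / 2 * dist z 0 * exp (l * \<bar>t\<bar>) + norm V * exp (l * \<bar>t\<bar>)"
      using P_diff[of z t 0] l by (intro add_mono) (auto simp: mult_le_cancel_left1)
    finally show "norm (\<Gamma> z t) \<le> 1 / 2 * dist z 0 + norm V"
      by (simp add: \<Gamma>_def exp_minus field_simps)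
  qed
  define \<Delta> where "\<Delta> z = Bcontfun (\<Gamma> z)" for z
  have \<Delta>: "\<Delta> z t = \<Gamma> z t" for z t by (simp add: \<Delta>_def Bcontfun_inverse[OF \<Gamma>_bcont])
  have lift_\<Delta>: "lift (\<Delta> z) t = P z t" for z t
    by (simp add: lift_def \<Delta> \<Gamma>_def exp_minus)
  define S where "S = {z. \<forall>t\<ge>0. exp (l * \<bar>t\<bar>) *\<^sub>R apply_bcontfun z t \<in> C t}"
  have "S = (\<Inter>t\<in>{0..}. {z. exp (l * \<bar>t\<bar>) *\<^sub>R apply_bcontfun z t \<in> C t})"
    by (auto simp: S_def)
  then have "closed S" by (auto intro!: closed_INT closed_apply_bcontfun closed)
  have S_lift: "z \<in> S \<longleftrightarrow> (\<forall>t\<ge>0. lift z t \<in> C t)" for z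
    by (simp add: S_def lift_def)
  have "\<exists>!z\<in>S. \<Delta> z = z"
  proof (rule Banach_fix[where c = "1/2"])
    show "complete S" using \<open>closed S\<close> by (simp add: complete_eq_closed)
    show "S \<noteq> {}" using zero_in by (auto simp: S_def intro!: exI[of _ 0])
    show "\<Delta> ` S \<subseteq> S"
    proof (rule image_subsetI)
      fix z assume "z \<in> S"
      then have z: "lift z t \<in> C t" if "t \<ge> 0" for t using that by (auto simp: S_lift)
      have "P z t \<in> C t" if t: "t \<ge> 0" for t
        unfolding P_def primitive_nonneg[OF t] by (rule step[OF lift_cont t z])
      then show "\<Delta> z \<in> S" by (simp add: S_lift lift_\<Delta>)
    qed
    show "dist (\<Delta> x) (\<Delta> y) \<le> 1 / 2 * dist x y" for x y
    proof (rule dist_bound)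
      fix t
      have "dist (\<Delta> x t) (\<Delta> y t) = exp (- l * \<bar>t\<bar>) * norm (P x t - P y t)"
        by (simp add: \<Delta> \<Gamma>_def dist_norm scaleR_diff_right[symmetric])
      also have "\<dots> \<le> exp (- l * \<bar>t\<bar>) * (1 / 2 * dist x y * exp (l * \<bar>t\<bar>))"
        by (intro mult_left_mono P_diff) auto
      finally show "dist (\<Delta> x t) (\<Delta> y t) \<le> 1 / 2 * dist x y"
        by (simp add: exp_minus field_simps)
    qed
  qed auto
  then obtain z where z: "z \<in> S" "\<Delta> z = z" by auto
  have "P z = lift z" using lift_\<Delta>[of z] z by auto
  have "P z 0 = V" by (simp add: P_def)
  moreover have "lift z t \<in> C t" if "t \<ge> 0" for t using z(1) that by (simp add: S_lift)
  ultimately show ?thesis using P_deriv[of z] \<open>P z = lift z\<close> by (intro exI[of _ "lift z"]) simp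
qed

section \<open>Open mappings and resolvents\<close>

text \<open>The open mapping theorem. By Baire, the closure of the image of some ball contains a
  ball; differences of its points solve \<open>f x = y\<close> approximately for small
  \<open>y\<close>, and by scaling with an error of at most half of \<open>norm y\<close>. Iterating
  on the error gives a convergent series of corrections.\<close>

theorem bounded_linear_surj_norm_bound:
  fixes f :: "'a::banach \<Rightarrow> 'b::banach"
  assumes f: "bounded_linear f" and surj: "surj f"
  shows "\<exists>C. \<forall>y. \<exists>x. f x = y \<and> norm x \<le> C * norm y"
proof -
  interpret f: bounded_linear f by (rule f)
  define F where "F n = closure (f ` cball 0 (real n))" for n :: nat
  have "\<exists>n. interior (F n) \<noteq> {}"
  proof (rule ccontr)
    assume "\<not> ?thesis"
    then have empty: "euclidean interior_of T = {}" if "T \<in> range F" for T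
      using that by (auto simp: interior_of_def interior_def)
    have "euclidean interior_of (\<Union>(range F)) = {}"
      by (rule Met_TC.metric_Baire_category_alt[unfolded mtopology_is_euclidean])
        (use empty in \<open>auto simp: F_def mcomplete_iff_complete complete_UNIV\<close>)
    moreover have "\<Union>(range F) = UNIV"
    proof -
      have "y \<in> \<Union>(range F)" for y
      proof -
        obtain x where x: "f x = y" using surj by (metis surjD)
        obtain n :: nat where "norm x \<le> real n" using real_arch_simple by blast
        then have "y \<in> f ` cball 0 (real n)" using x by (intro image_eqI[of _ _ x]) auto
        then have "y \<in> F n" unfolding F_def by (rule subsetD[OF closure_subset])
        then show ?thesis by (rule UN_I[OF UNIV_I])
      qed
      then show ?thesis by auto
    qed
    ultimately show False by simp
  qed
  then obtain n y0 where "y0 \<in> interior (F n)" by blast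
  then obtain r where r: "r > 0" "ball y0 r \<subseteq> F n" unfolding mem_interior by blast
  have approx: "\<exists>x. norm x \<le> 2 * real n \<and> norm (y - f x) < e" if "norm y < r" "e > 0" for y e
  proof -
    have "y0 \<in> F n" "y0 + y \<in> F n" using r that by (auto simp: subset_eq dist_norm)
    moreover have "\<exists>x. norm x \<le> real n \<and> dist (f x) u < e / 2" if "u \<in> F n" for u
      using that \<open>e > 0\<close> unfolding F_def closure_approachable
      by (auto dest!: spec[of _ "e / 2"])
    ultimately obtain x1 x2 where x: "norm x1 \<le> real n" "dist (f x1) y0 < e / 2"
        "norm x2 \<le> real n" "dist (f x2) (y0 + y) < e / 2"
      by meson
    have "norm (x2 - x1) \<le> 2 * real n" using x norm_triangle_ineq4[of x2 x1] by linarith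
    moreover have eq: "y - f (x2 - x1) = (f x1 - y0) - (f x2 - (y0 + y))" by (simp add: f.diff)
    have "norm (y - f (x2 - x1)) < e"
      unfolding eq using x norm_triangle_ineq4[of "f x1 - y0" "f x2 - (y0 + y)"]
      unfolding dist_norm by linarith
    ultimately show ?thesis by blast
  qed
  define K where "K = 4 * real n / r"
  have half: "\<exists>x. norm x \<le> K * norm y \<and> norm (y - f x) \<le> norm y / 2" for y
  proof (cases "y = 0")
    case True
    then show ?thesis by (intro exI[of _ 0]) (simp add: f.zero)
  next
    case False
    define t where "t = r / (2 * norm y)"
    have t: "t > 0" using False r by (simp add: t_def)
    have "norm (t *\<^sub>R y) < r" using False r by (simp add: t_def)
    then obtain x where x: "norm x \<le> 2 * real n" "norm (t *\<^sub>R y - f x) < r / 4"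
      using approx[of "t *\<^sub>R y" "r / 4"] r by auto
    have "norm (x /\<^sub>R t) \<le> K * norm y"
      using x(1) t r False by (simp add: K_def t_def field_simps)
    moreover have "t *\<^sub>R (y - f (x /\<^sub>R t)) = t *\<^sub>R y - f x"
      using t by (simp add: f.scaleR scaleR_diff_right)
    then have "t * norm (y - f (x /\<^sub>R t)) < r / 4" using x(2) t by (metis abs_of_pos norm_scaleR)
    then have "norm (y - f (x /\<^sub>R t)) \<le> norm y / 2"
      using t r False by (simp add: t_def field_simps)
    ultimately show ?thesis by blast
  qed
  then obtain h where h: "\<And>y. norm (h y) \<le> K * norm y" "\<And>y. norm (y - f (h y)) \<le> norm y / 2"
    by metis
  have K: "K \<ge> 0" using r by (simp add: K_def)
  have "\<exists>x. f x = y \<and> norm x \<le> 2 * K * norm y" for y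
  proof -
    define Y where "Y k = ((\<lambda>y. y - f (h y)) ^^ k) y" for k
    have Y0: "Y 0 = y" and YS: "Y (Suc k) = Y k - f (h (Y k))" for k by (auto simp: Y_def)
    have nY: "norm (Y k) \<le> (1 / 2) ^ k * norm y" for k
    proof (induction k)
      case (Suc k)
      have "norm (Y (Suc k)) \<le> norm (Y k) / 2" using h(2) YS by simp
      then show ?case using Suc by simp
    qed (simp add: Y0)
    have nh: "norm (h (Y k)) \<le> (1 / 2) ^ k * (K * norm y)" for k
      using mult_left_mono[OF nY K, of k] h(1)[of "Y k"] by (simp add: mult_ac)
    have geo: "(\<lambda>k. (1 / 2) ^ k * (K * norm y)) sums (2 * (K * norm y))"
      using sums_mult2[OF geometric_sums[of "1/2 :: real"]] by simp
    have sum_h: "summable (\<lambda>k. norm (h (Y k)))"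
      by (rule summable_comparison_test'[OF sums_summable[OF geo]]) (use nh in auto)
    have "norm (\<Sum>k. h (Y k)) \<le> (\<Sum>k. norm (h (Y k)))" by (rule summable_norm[OF sum_h])
    also have "\<dots> \<le> 2 * (K * norm y)"
      unfolding sums_unique[OF geo] by (rule suminf_le[OF nh sum_h sums_summable[OF geo]])
    finally have "norm (\<Sum>k. h (Y k)) \<le> 2 * K * norm y" by simp
    moreover have "f (\<Sum>k. h (Y k)) = y"
    proof -
      have "(\<lambda>k. f (h (Y k))) sums f (\<Sum>k. h (Y k))"
        by (intro f.sums summable_sums summable_norm_cancel[OF sum_h])
      moreover have "(\<lambda>k. f (h (Y k))) sums (Y 0 - 0)"
      proof -
        have "Y \<longlonglongrightarrow> 0"
        proof (rule Lim_null_comparison[OF always_eventually])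
          show "\<forall>k. norm (Y k) \<le> (1 / 2) ^ k * norm y" using nY by blast
          show "(\<lambda>k. (1 / 2) ^ k * norm y) \<longlonglongrightarrow> 0"
            by (rule tendsto_mult_left_zero) (simp add: LIMSEQ_realpow_zero)
        qed
        from telescope_sums'[OF this] show ?thesis by (simp add: YS)
      qed
      ultimately show ?thesis using sums_unique2 Y0 by fastforce
    qed
    ultimately show ?thesis by blast
  qed
  then show ?thesis by blast
qed

text \<open>The summands are the powers of a single root of unity \<open>w \<noteq> 1\<close>, so
  this is a geometric sum with \<open>w ^ n = 1\<close>.\<close>

lemma sum_cis_eq_0:
  assumes "0 < k" "k < n"
  shows "(\<Sum>j<n. cis (2 * pi * real j / real n) ^ k) = 0"
proof -
  define w where "w = cis (2 * pi * real k / real n)"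
  have "w ^ n = cis (real n * (2 * pi * real k / real n))" unfolding w_def by (rule Complex.DeMoivre)
  also have "real n * (2 * pi * real k / real n) = 2 * pi * real k" using assms by simp
  finally have wn: "w ^ n = 1" by (metis cis_multiple_2pi Ints_of_nat)
  have "w = exp (2 * of_real pi * \<i> * of_nat k / of_nat n)"
    by (simp add: w_def cis_conv_exp mult_ac)
  then have "w \<noteq> 1" using complex_root_unity_eq_1[of n k] assms by (auto dest: dvd_imp_le)
  moreover have "(w - 1) * (\<Sum>j<n. w ^ j) = w ^ n - 1" by (simp add: power_diff_1_eq)
  ultimately have "(\<Sum>j<n. w ^ j) = 0" using wn by simp
  moreover have "cis (2 * pi * real j / real n) ^ k = w ^ j" for j
    by (simp add: w_def Complex.DeMoivre mult_ac)
  ultimately show ?thesis by simp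
qed

lemma geometric_sum_ring:
  fixes u :: "'r::ring_1"
  shows "(1 - u) * (\<Sum>k<n. u ^ k) = 1 - u ^ n"
proof (induction n)
  case (Suc n)
  then show ?case by (simp add: distrib_left) (simp add: left_diff_distrib)
qed simp

text \<open>
  A form of the spectral radius formula without complex function theory: averaging the resolvent
  over the \<open>n\<close>-th roots of unity gives \<open>(1 - (s x)\<^sup>n)\<^sup>-\<^sup>1\<close>, which depends on \<open>s\<close> in a
  Lipschitz way uniformly in \<open>n\<close>. So smallness of a power of \<open>s x\<close> propagates
  from \<open>s = 0\<close> to \<open>s = 1\<close> in finitely many steps.
\<close>

theorem power_small_if_resolvent:
  fixes x :: "'r::{real_algebra_1, real_normed_algebra}" and c R :: "complex \<Rightarrow> 'r"
  assumes c_add: "\<And>z w. c (z + w) = c z + c w" and c_mult: "\<And>z w. c (z * w) = c z * c w"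
    and c_1: "c 1 = 1" and c_comm: "\<And>z. c z * x = x * c z"
    and c_norm: "\<And>z. norm (c z) \<le> k * norm z"
    and R1: "\<And>z. norm z \<le> 1 \<Longrightarrow> R z * (1 - c z * x) = 1"
    and R2: "\<And>z. norm z \<le> 1 \<Longrightarrow> (1 - c z * x) * R z = 1"
  shows "\<exists>N\<ge>1. norm (x ^ N) \<le> 1 / 2"
proof -
  have c_0: "c 0 = 0" using c_add[of 0 0] by simp
  have c_diff: "c (z - w) = c z - c w" for z w using c_add[of "z - w" w] by simp
  have c_power: "c (z ^ n) = c z ^ n" for z n by (induction n) (auto simp: c_1 c_mult)
  have c_sum: "c (sum f A) = (\<Sum>i\<in>A. c (f i))" for f and A :: "nat set"
    by (induction A rule: infinite_finite_induct) (auto simp: c_0 c_add)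
  have c_nat: "c (of_nat n) = of_nat n" for n by (induction n) (auto simp: c_0 c_1 c_add)
  have k: "k \<ge> 0" using c_norm[of 1] by (metis norm_ge_zero norm_one mult.right_neutral order_trans)
  have R_diff: "R z - R w = R z * (c (z - w) * x) * R w" if "norm z \<le> 1" "norm w \<le> 1" for z w
  proof -
    have "R z * (c (z - w) * x) * R w = R z * ((1 - c w * x) - (1 - c z * x)) * R w"
      by (simp add: c_diff algebra_simps)
    also have "\<dots> = R z * ((1 - c w * x) * R w) - (R z * (1 - c z * x)) * R w"
      by (simp add: algebra_simps)
    finally show ?thesis using that R1 R2 by simp
  qed
  have R_diff_norm: "norm (R z - R w) \<le> norm (R z) * norm (R w) * (k * norm x) * norm (z - w)"
    if "norm z \<le> 1" "norm w \<le> 1" for z w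
  proof -
    have "norm (R z - R w) \<le> norm (R z) * norm (c (z - w) * x) * norm (R w)"
      unfolding R_diff[OF that] by (meson norm_mult_ineq mult_right_mono norm_ge_zero order_trans)
    also have "\<dots> \<le> norm (R z) * (k * norm (z - w) * norm x) * norm (R w)"
      by (intro mult_right_mono mult_left_mono order_trans[OF norm_mult_ineq]) (auto simp: c_norm)
    finally show ?thesis by (simp add: mult_ac)
  qed
  have "continuous_on (cball 0 1) R"
    unfolding continuous_on_iff
  proof (intro ballI allI impI)
    fix w :: complex and e :: real assume w: "w \<in> cball 0 1" and e: "0 < e"
    define m where "m = norm (R w) * (k * norm x) + 1"
    have m: "m > 0" using k by (auto simp: m_def intro!: add_nonneg_pos)
    \<comment> \<open>The resolvent identity bounds the difference only in terms of the unknown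
      \<open>norm (R z)\<close>. The first entry of the minimum makes \<open>q\<close> at most 1/2,
      so that this norm can be absorbed and is at most twice \<open>norm (R w)\<close>.\<close>
    define d where "d = min (1 / (2 * m)) (e / (2 * m * (norm (R w) + 1)))"
    have d: "d > 0" using m e by (simp add: d_def add_nonneg_pos)
    show "\<exists>d>0. \<forall>z\<in>cball 0 1. dist z w < d \<longrightarrow> dist (R z) (R w) < e"
    proof (intro exI[of _ d] conjI d ballI impI)
      fix z assume z: "z \<in> cball 0 1" "dist z w < d"
      define q where "q = m * norm (z - w)"
      have "norm (z - w) \<le> 1 / (2 * m)" using z by (simp add: d_def dist_norm)
      then have q: "q \<le> 1 / 2" "q \<ge> 0" using m by (auto simp: q_def field_simps)
      have "norm (R z - R w) \<le> norm (R z) * ((norm (R w) * (k * norm x)) * norm (z - w))"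
        using R_diff_norm[of z w] z w by (simp add: mult_ac)
      also have "\<dots> \<le> norm (R z) * q" unfolding q_def m_def
        by (intro mult_left_mono mult_right_mono) auto
      finally have le: "norm (R z - R w) \<le> norm (R z) * q" .
      then have "norm (R z) \<le> norm (R w) + norm (R z) * q"
        using norm_triangle_sub[of "R z" "R w"] by linarith
      also have "norm (R z) * q \<le> norm (R z) * (1 / 2)" by (intro mult_left_mono q) auto
      finally have "norm (R z) \<le> 2 * norm (R w)" by simp
      then have "norm (R z - R w) \<le> 2 * norm (R w) * q"
        using le q by (meson mult_right_mono order_trans)
      also have "\<dots> \<le> 2 * (norm (R w) + 1) * m * norm (z - w)"
        unfolding q_def mult.assoc using m by (intro mult_left_mono mult_right_mono) auto
      also have "\<dots> < e"
      proof -
        have "norm (z - w) < e / (2 * m * (norm (R w) + 1))" using z by (simp add: d_def dist_norm)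
        moreover have "2 * m * (norm (R w) + 1) > 0" using m by (simp add: add_nonneg_pos)
        ultimately show ?thesis by (simp add: pos_less_divide_eq mult_ac)
      qed
      finally show "dist (R z) (R w) < e" by (simp add: dist_norm)
    qed
  qed
  then have "bounded (R ` cball 0 1)"
    by (intro compact_imp_bounded compact_continuous_image) auto
  then obtain M where M: "M > 0" "\<And>z. norm z \<le> 1 \<Longrightarrow> norm (R z) \<le> M"
    unfolding bounded_pos by auto
  define \<Lambda> where "\<Lambda> = M * M * (k * norm x)"
  have \<Lambda>: "\<Lambda> \<ge> 0" using M k by (simp add: \<Lambda>_def)
  have R_lip: "norm (R z - R w) \<le> \<Lambda> * norm (z - w)" if "norm z \<le> 1" "norm w \<le> 1" for z w
  proof -
    have "norm (R z) * norm (R w) * (k * norm x) * norm (z - w) \<le> \<Lambda> * norm (z - w)"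
      unfolding \<Lambda>_def using M that k by (intro mult_right_mono mult_mono) auto
    then show ?thesis using R_diff_norm[OF that] by simp
  qed
  define w where "w n j = cis (2 * pi * real j / real n)" for n j :: nat
  define Q where "Q n s = (1 / real n) *\<^sub>R (\<Sum>j<n. R (w n j * of_real s))" for n s
  define y where "y s = c (of_real s) * x" for s :: real
  have nw: "norm (w n j * of_real s) = \<bar>s\<bar>" for n j s by (simp add: w_def norm_mult)
  have Q_norm: "norm (Q n s) \<le> M" if "n \<ge> 1" "s \<in> {0..1}" for n s
  proof -
    have "norm (\<Sum>j<n. R (w n j * of_real s)) \<le> (\<Sum>j<n. M)"
      by (intro sum_norm_le M) (use that nw in auto)
    then show ?thesis using that by (simp add: Q_def field_simps)
  qed
  have Q_lip: "norm (Q n s - Q n s') \<le> \<Lambda> * \<bar>s - s'\<bar>"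
    if "n \<ge> 1" "s \<in> {0..1}" "s' \<in> {0..1}" for n s s'
  proof -
    have eq: "Q n s - Q n s' = (1 / real n) *\<^sub>R (\<Sum>j<n. R (w n j * of_real s) - R (w n j * of_real s'))"
      by (simp add: Q_def sum_subtractf scaleR_diff_right)
    have "norm (\<Sum>j<n. R (w n j * of_real s) - R (w n j * of_real s')) \<le> (\<Sum>j<n. \<Lambda> * \<bar>s - s'\<bar>)"
    proof (intro sum_norm_le order_trans[OF R_lip])
      fix j
      have "norm (w n j * of_real s - w n j * of_real s') = \<bar>s - s'\<bar>"
        using nw[of n j "s - s'"] by (simp add: algebra_simps)
      then show "\<Lambda> * norm (w n j * of_real s - w n j * of_real s') \<le> \<Lambda> * \<bar>s - s'\<bar>" by simp
    qed (use that nw in auto)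
    then show ?thesis using that by (simp add: eq field_simps)
  qed
  have y_comm: "c z * y s = y s * c z" for z s
    unfolding y_def by (metis c_comm c_mult mult.assoc mult.commute)
  have Q_inv: "Q n s * (1 - y s ^ n) = 1" if n: "n \<ge> 1" and s: "s \<in> {0..1}" for n s
  proof -
    have pow: "(c z * y s) ^ m = c (z ^ m) * y s ^ m" for z m
    proof (induction m)
      case (Suc m)
      have "(c z * y s) ^ Suc m = c z * y s * (c (z ^ m) * y s ^ m)" by (simp add: Suc)
      also have "\<dots> = c z * (y s * c (z ^ m)) * y s ^ m" by (simp add: mult.assoc)
      also have "\<dots> = c z * (c (z ^ m) * y s) * y s ^ m" by (simp add: y_comm)
      finally show ?case by (simp add: c_mult mult.assoc)
    qed (simp add: c_1)
    have R_eq: "R (w n j * of_real s) * (1 - y s ^ n) = (\<Sum>m<n. c (w n j ^ m) * y s ^ m)" for j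
    proof -
      define u where "u = c (w n j) * y s"
      have u: "u = c (w n j * of_real s) * x" by (simp add: u_def y_def c_mult mult.assoc)
      have "w n j ^ n = cis (real n * (2 * pi * real j / real n))" unfolding w_def by (rule Complex.DeMoivre)
      also have "real n * (2 * pi * real j / real n) = 2 * pi * real j" using n by simp
      finally have "w n j ^ n = 1" by (metis cis_multiple_2pi Ints_of_nat)
      then have "u ^ n = y s ^ n" by (simp add: u_def pow c_1)
      then have "R (w n j * of_real s) * (1 - y s ^ n) =
          R (w n j * of_real s) * (1 - u) * (\<Sum>m<n. u ^ m)"
        by (simp add: geometric_sum_ring mult.assoc)
      also have "R (w n j * of_real s) * (1 - u) = 1"
        unfolding u using R1[of "w n j * of_real s"] nw s by simp
      finally show ?thesis by (simp add: u_def pow)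
    qed
    have "(\<Sum>j<n. R (w n j * of_real s)) * (1 - y s ^ n) = (\<Sum>j<n. \<Sum>m<n. c (w n j ^ m) * y s ^ m)"
      by (simp add: sum_distrib_right R_eq)
    also have "\<dots> = (\<Sum>m<n. c (\<Sum>j<n. w n j ^ m) * y s ^ m)"
      by (subst sum.swap) (simp add: c_sum sum_distrib_right)
    also have "\<dots> = (\<Sum>m<n. if m = 0 then of_nat n else 0)"
    proof (intro sum.cong refl)
      fix m assume "m \<in> {..<n}"
      then have "(\<Sum>j<n. w n j ^ m) = 0" if "m \<noteq> 0" using that sum_cis_eq_0[of m n] by (simp add: w_def)
      then show "c (\<Sum>j<n. w n j ^ m) * y s ^ m = (if m = 0 then of_nat n else 0)"
        by (auto simp: c_0 c_nat)
    qed
    also have "\<dots> = of_nat n" using n by (simp add: sum.delta)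
    finally have "Q n s * (1 - y s ^ n) = (1 / real n) *\<^sub>R of_nat n" by (simp add: Q_def)
    also have "of_nat n = real n *\<^sub>R (1 :: 'r)" by (metis of_real_def of_real_of_nat_eq)
    finally show ?thesis using n by simp
  qed
  \<comment> \<open>A high power of \<open>y s ^ N\<close> brings \<open>Q n s\<close> within 1/16
    of 1. Moving to \<open>s'\<close> costs 1/4, and an error of 5/16 in \<open>Q n s'\<close> gives
    a norm of at most 5/11 for \<open>y s' ^ n\<close>.\<close>
  have step: "\<exists>N\<ge>1. norm (y s' ^ N) \<le> 1 / 2"
    if ex: "\<exists>N\<ge>1. norm (y s ^ N) \<le> 1 / 2" and s: "s \<in> {0..1}" "s' \<in> {0..1}" and l: "\<Lambda> * \<bar>s' - s\<bar> \<le> 1 / 4" for s s'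
  proof -
    obtain N where N: "N \<ge> 1" "norm (y s ^ N) \<le> 1 / 2" using ex by blast
    obtain q where q: "(1 / 2) ^ q < 1 / (16 * M)" using real_arch_pow_inv[of "1 / (16 * M)" "1/2"] M by auto
    define n where "n = N * Suc q"
    have n: "n \<ge> 1" using N by (simp add: n_def)
    have "norm ((y s ^ N) ^ Suc i) \<le> (1 / 2) ^ Suc i" for i
    proof (induction i)
      case (Suc i)
      have "norm ((y s ^ N) ^ Suc (Suc i)) \<le> norm (y s ^ N) * norm ((y s ^ N) ^ Suc i)"
        by (metis norm_mult_ineq power_Suc)
      also have "\<dots> \<le> (1 / 2) * (1 / 2) ^ Suc i" by (intro mult_mono N Suc) auto
      finally show ?case by simp
    qed (use N in simp)
    then have yn: "norm (y s ^ n) \<le> (1 / 2) ^ Suc q" by (simp only: n_def power_mult)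
    have "Q n s - 1 = Q n s * y s ^ n" using Q_inv[OF n s(1)] by (simp add: algebra_simps)
    then have "norm (Q n s - 1) \<le> M * (1 / 2) ^ Suc q"
      using norm_mult_ineq[of "Q n s" "y s ^ n"] mult_mono[OF Q_norm[OF n s(1)] yn] M by simp
    also have "\<dots> \<le> 1 / 16" using q M by (simp add: field_simps)
    finally have "norm (Q n s' - 1) \<le> 5 / 16"
      using Q_lip[OF n s(2) s(1)] l norm_triangle_ineq[of "Q n s' - Q n s" "Q n s - 1"] by simp
    moreover have eq: "(Q n s' - 1) - (Q n s' - 1) * y s' ^ n = y s' ^ n"
      using Q_inv[OF n s(2)] by (simp add: algebra_simps)
    have "norm ((Q n s' - 1) - (Q n s' - 1) * y s' ^ n)
        \<le> norm (Q n s' - 1) + norm (Q n s' - 1) * norm (y s' ^ n)"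
      using norm_triangle_ineq4[of "Q n s' - 1" "(Q n s' - 1) * y s' ^ n"]
        norm_mult_ineq[of "Q n s' - 1" "y s' ^ n"] by linarith
    then have "norm (y s' ^ n) \<le> norm (Q n s' - 1) + norm (Q n s' - 1) * norm (y s' ^ n)"
      unfolding eq .
    ultimately have "norm (y s' ^ n) \<le> 5 / 16 + 5 / 16 * norm (y s' ^ n)"
      by (meson add_mono mult_right_mono norm_ge_zero order_trans)
    then show ?thesis using n by (intro exI[of _ n]) auto
  qed
  obtain m :: nat where m: "4 * \<Lambda> < real m" using reals_Archimedean2 by blast
  then have m0: "m > 0" using \<Lambda> by (cases m) auto
  have "\<exists>N\<ge>1. norm (y (real i / real m) ^ N) \<le> 1 / 2" if "i \<le> m" for i
    using that
  proof (induction i)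
    case 0
    then show ?case by (intro exI[of _ 1]) (simp add: y_def c_0)
  next
    case (Suc i)
    have "\<Lambda> * \<bar>real (Suc i) / real m - real i / real m\<bar> \<le> 1 / 4"
    proof -
      have "real (Suc i) / real m - real i / real m = 1 / real m"
        by (simp add: diff_divide_distrib[symmetric])
      then show ?thesis using m m0 by (simp add: field_simps)
    qed
    moreover have "real i / real m \<in> {0..1}" "real (Suc i) / real m \<in> {0..1}"
      using Suc.prems m0 by (auto simp: divide_le_eq)
    moreover have "\<exists>N\<ge>1. norm (y (real i / real m) ^ N) \<le> 1 / 2" using Suc by simp
    ultimately show ?case using step by blast
  qed
  from this[of m] have "\<exists>N\<ge>1. norm (y 1 ^ N) \<le> 1 / 2" using m0 by simp
  moreover have "y 1 = x" by (simp add: y_def c_1)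
  ultimately show ?thesis by simp
qed

section \<open>Decay of iterates from spectral assumptions\<close>

instance bcontfun :: (topological_space, "{real_normed_vector, perfect_space}") perfect_space
proof
  fix f :: "'a \<Rightarrow>\<^sub>C 'b"
  show "\<not> open {f}"
  proof
    assume "open {f}"
    then obtain e where e: "e > 0" "ball f e \<subseteq> {f}" by (auto simp: open_contains_ball)
    obtain u :: 'b where u: "u \<noteq> 0" "dist u 0 < e" using perfect_choose_dist[OF e(1), of 0] by blast
    have "norm (const_bcontfun u :: 'a \<Rightarrow>\<^sub>C 'b) \<le> norm u" by (rule norm_bound) simp
    then have "f + const_bcontfun u \<in> ball f e" using u by (simp add: dist_norm)
    then have "f + const_bcontfun u = f" using e by blast
    then have "u = 0" by (metis add_cancel_left_right const_bcontfun.rep_eq zero_bcontfun.rep_eq)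
    then show False using u by simp
  qed
qed

instance prod :: (perfect_space, perfect_space) perfect_space
proof
  fix x :: "'a \<times> 'b"
  show "\<not> open {x}"
  proof
    assume "open {x}"
    then have "open (fst ` {x})" by (rule open_image_fst)
    then show False by (simp add: not_open_singleton)
  qed
qed

text \<open>A separate type with one parameter, so that composition can serve as the multiplication
  of an algebra with unit.\<close>

typedef (overloaded) 'a endo = "UNIV :: ('a::real_normed_vector \<Rightarrow>\<^sub>L 'a) set"
  morphisms endo_op Endo ..

setup_lifting type_definition_endo

instantiation endo :: (real_normed_vector) real_normed_vector
begin

lift_definition zero_endo :: "'a endo" is 0 .
lift_definition plus_endo :: "'a endo \<Rightarrow> 'a endo \<Rightarrow> 'a endo" is "(+)" .
lift_definition minus_endo :: "'a endo \<Rightarrow> 'a endo \<Rightarrow> 'a endo" is "(-)" .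
lift_definition uminus_endo :: "'a endo \<Rightarrow> 'a endo" is uminus .
lift_definition scaleR_endo :: "real \<Rightarrow> 'a endo \<Rightarrow> 'a endo" is scaleR .
lift_definition norm_endo :: "'a endo \<Rightarrow> real" is norm .

definition dist_endo :: "'a endo \<Rightarrow> 'a endo \<Rightarrow> real"
  where "dist_endo a b = norm (a - b)"

definition uniformity_endo :: "('a endo \<times> 'a endo) filter"
  where "uniformity_endo = (INF e\<in>{0 <..}. principal {(x, y). dist x y < e})"

definition open_endo :: "'a endo set \<Rightarrow> bool"
  where "open_endo S = (\<forall>x\<in>S. \<forall>\<^sub>F (x', y) in uniformity. x' = x \<longrightarrow> y \<in> S)"

definition sgn_endo :: "'a endo \<Rightarrow> 'a endo"
  where "sgn_endo x = scaleR (inverse (norm x)) x"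

instance
proof
  fix a b c :: "'a endo" and r s :: real
  show "a + b + c = a + (b + c)" "a + b = b + a" "0 + a = a" "- a + a = 0" "a - b = a + - b"
    by (transfer; simp)+
  show "r *\<^sub>R (a + b) = r *\<^sub>R a + r *\<^sub>R b" "(r + s) *\<^sub>R a = r *\<^sub>R a + s *\<^sub>R a"
    by (transfer; simp add: algebra_simps)+
  show "r *\<^sub>R s *\<^sub>R a = (r * s) *\<^sub>R a" "1 *\<^sub>R a = a" "(norm a = 0) = (a = 0)"
    "norm (r *\<^sub>R a) = \<bar>r\<bar> * norm a"
    by (transfer; simp)+
  show "norm (a + b) \<le> norm a + norm b" by transfer (rule norm_triangle_ineq)
qed (rule dist_endo_def uniformity_endo_def open_endo_def sgn_endo_def)+

end

text \<open>The sort \<open>perfect_space\<close> supplies a nonzero vector, without which 0 and 1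
  would coincide in the algebra. This is the purpose of the instances for \<open>bcontfun\<close>
  and for products.\<close>

instantiation endo :: ("{real_normed_vector, perfect_space}") real_algebra_1
begin

lift_definition times_endo :: "'a endo \<Rightarrow> 'a endo \<Rightarrow> 'a endo" is "(o\<^sub>L)" .
lift_definition one_endo :: "'a endo" is id_blinfun .

instance
proof
  fix a b c :: "'a endo" and r :: real
  show "a * b * c = a * (b * c)" "1 * a = a" "a * 1 = a"
    by (transfer; simp add: blinfun_eqI)+
  show "(a + b) * c = a * c + b * c" "a * (b + c) = a * b + a * c"
    "r *\<^sub>R a * b = r *\<^sub>R (a * b)" "a * r *\<^sub>R b = r *\<^sub>R (a * b)"
    by (transfer; simp add: blinfun_eqI blinfun.bilinear_simps)+
  show "(0 :: 'a endo) \<noteq> 1"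
  proof
    assume "(0 :: 'a endo) = 1"
    then have "(0 :: 'a \<Rightarrow>\<^sub>L 'a) = id_blinfun" by transfer
    then have "blinfun_apply (0 :: 'a \<Rightarrow>\<^sub>L 'a) x = blinfun_apply id_blinfun x" for x by (rule arg_cong)
    then have "x = 0" for x :: 'a by simp
    then show False using UNIV_not_singleton[of "0 :: 'a"] by blast
  qed
qed

end

instance endo :: ("{real_normed_vector, perfect_space}") real_normed_algebra
  by standard (transfer, rule norm_blinfun_compose)

lemma endo_apply_simps [simp]:
  "endo_op (a * b) x = endo_op a (endo_op b x)" "endo_op 1 x = x"
  "endo_op (a - b) x = endo_op a x - endo_op b x" "endo_op (a + b) x = endo_op a x + endo_op b x"
  by (transfer; simp add: blinfun.bilinear_simps)+

lemma endo_eqI: "(\<And>x. endo_op a x = endo_op b x) \<Longrightarrow> a = b"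
  by transfer (rule blinfun_eqI)

lemma endo_op_Endo: "bounded_linear f \<Longrightarrow> endo_op (Endo (Blinfun f)) x = f x"
  by (simp add: Endo_inverse bounded_linear_Blinfun_apply)

lemma norm_Endo_le:
  assumes "bounded_linear f" "K \<ge> 0" "\<And>x. norm (f x) \<le> K * norm x"
  shows "norm (Endo (Blinfun f)) \<le> K"
  using assms by (simp add: norm_endo.rep_eq Endo_inverse norm_blinfun_bound bounded_linear_Blinfun_apply)

text \<open>Multiplication by \<open>z\<close> on the complexification, where \<open>(U, V)\<close>
  stands for \<open>U + i V\<close>. Subtracting \<open>map_prod T T\<close> gives the operator
  \<open>z - T\<close>.\<close>

definition complex_scale :: "complex \<Rightarrow> 'a::real_vector \<times> 'a \<Rightarrow> 'a \<times> 'a" where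
  "complex_scale z = (\<lambda>(U, V). (Re z *\<^sub>R U - Im z *\<^sub>R V, Im z *\<^sub>R U + Re z *\<^sub>R V))"

lemma complex_scale_add: "complex_scale z (p + q) = complex_scale z p + complex_scale z q"
  by (cases p; cases q) (simp add: complex_scale_def algebra_simps)

lemma complex_scale_diff: "complex_scale z (p - q) = complex_scale z p - complex_scale z q"
  by (cases p; cases q) (simp add: complex_scale_def algebra_simps)

lemma complex_scale_scaleR: "complex_scale z (r *\<^sub>R p) = r *\<^sub>R complex_scale z p"
  by (cases p) (simp add: complex_scale_def algebra_simps)

lemma complex_scale_add_left: "complex_scale (z + w) p = complex_scale z p + complex_scale w p"
  by (cases p) (simp add: complex_scale_def algebra_simps)

lemma complex_scale_mult: "complex_scale (z * w) p = complex_scale z (complex_scale w p)"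
  by (cases p) (simp add: complex_scale_def algebra_simps)

lemma complex_scale_simps [simp]: "complex_scale 1 p = p" "complex_scale 0 p = 0" "complex_scale z 0 = 0"
  by (cases p; simp add: complex_scale_def zero_prod_def)+

lemma norm_complex_scale: "norm (complex_scale z p) \<le> 4 * norm z * norm p"
  for p :: "'a::real_normed_vector \<times> 'a"
proof (cases p)
  case (Pair U V)
  have 1: "norm U \<le> norm p" "norm V \<le> norm p"
    using norm_fst_le[of U V] norm_snd_le[of V U] by (auto simp: Pair)
  have 2: "\<bar>Re z\<bar> \<le> norm z" "\<bar>Im z\<bar> \<le> norm z" by (auto simp: abs_Re_le_cmod abs_Im_le_cmod)
  have 3: "norm (r *\<^sub>R U) \<le> norm z * norm p" "norm (r *\<^sub>R V) \<le> norm z * norm p" if "\<bar>r\<bar> \<le> norm z" for r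
    using 1 that by (auto intro!: mult_mono)
  have "norm (complex_scale z p) \<le> norm (Re z *\<^sub>R U - Im z *\<^sub>R V) + norm (Im z *\<^sub>R U + Re z *\<^sub>R V)"
    unfolding complex_scale_def Pair prod.case by (rule norm_Pair_le)
  also have "\<dots> \<le> (norm (Re z *\<^sub>R U) + norm (Im z *\<^sub>R V)) + (norm (Im z *\<^sub>R U) + norm (Re z *\<^sub>R V))"
    by (intro add_mono norm_triangle_ineq4 norm_triangle_ineq)
  also have "\<dots> \<le> 4 * norm z * norm p"
    using 3[of "Re z"] 3[of "Im z"] 2 by linarith
  finally show ?thesis .
qed

lemma bounded_linear_complex_scale: "bounded_linear (complex_scale z)"
  for z :: complex
  by (rule bounded_linear_intro[where K = "4 * norm z"])
    (use norm_complex_scale in \<open>auto simp: complex_scale_add complex_scale_scaleR mult.commute\<close>)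

lemma bounded_linear_map_prod:
  assumes "bounded_linear f" "bounded_linear g"
  shows "bounded_linear (map_prod f g)"
proof -
  have "bounded_linear (\<lambda>p. (f (fst p), g (snd p)))"
    using assms by (intro bounded_linear_Pair bounded_linear_compose[OF assms(1)]
        bounded_linear_compose[OF assms(2)] bounded_linear_fst bounded_linear_snd)
  then show ?thesis by (simp add: map_prod_def case_prod_unfold)
qed

lemma complex_scale_map_prod:
  assumes "linear f"
  shows "complex_scale z (map_prod f f p) = map_prod f f (complex_scale z p)"
  by (cases p) (simp add: complex_scale_def linear_diff[OF assms] linear_add[OF assms] linear_scale[OF assms])

lemma bounded_linear_inverse_ex:
  fixes f :: "'a::real_normed_vector \<Rightarrow> 'b::real_normed_vector"
  assumes f: "bounded_linear f" and inj: "\<And>x. f x = 0 \<Longrightarrow> x = 0"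
    and sol: "\<And>y. \<exists>x. f x = y \<and> norm x \<le> K * norm y"
  shows "\<exists>g. bounded_linear g \<and> (\<forall>x. g (f x) = x) \<and> (\<forall>y. f (g y) = y)"
proof -
  interpret f: bounded_linear f by (rule f)
  obtain g where g: "\<And>y. f (g y) = y" "\<And>y. norm (g y) \<le> K * norm y" using sol by metis
  have eqI: "x = x'" if "f x = f x'" for x x' using inj[of "x - x'"] that by (simp add: f.diff)
  have "bounded_linear g"
    by (rule bounded_linear_intro[where K = K]) (auto intro: eqI simp: f.add f.scaleR g mult.commute)
  then show ?thesis using g eqI by blast
qed

text \<open>Let \<open>P\<close> be the projection onto \<open>span {v}\<close> along the range of
  \<open>T - 1\<close>. The operator \<open>B = T - P\<close> has lost the eigenvalue 1, so
  \<open>1 - z B\<close> is invertible for all \<open>z\<close> in the closed unit disc and some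
  power of \<open>B\<close> has norm at most 1/2. On the kernel of \<open>P\<close> the iterates of
  \<open>T\<close> are those of \<open>B\<close>.\<close>

theorem spectral_decay:
  fixes T :: "'a::{banach, perfect_space} \<Rightarrow> 'a"
  assumes T: "bounded_linear T" and v: "v \<noteq> 0" and ker: "{Y. T Y = Y} = span {v}"
    and v_notin: "v \<notin> range (\<lambda>Z. T Z - Z)" and dec: "\<And>X. \<exists>s Z. X = s *\<^sub>R v + (T Z - Z)"
    and res: "\<And>z. norm z \<ge> 1 \<Longrightarrow> z \<noteq> 1 \<Longrightarrow> surj (\<lambda>p. complex_scale z p - map_prod T T p) \<and>
      (\<exists>K. \<forall>p. norm p \<le> K * norm (complex_scale z p - map_prod T T p))"
  shows "\<exists>N\<ge>1. \<exists>l C. bounded_linear l \<and>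
    (\<forall>k V. norm ((T ^^ (N * k)) V - l V *\<^sub>R v) \<le> C * (1 / 2) ^ k * norm V)"
proof -
  interpret T: bounded_linear T by (rule T)
  have Tv: "T v = v" using ker span_base[of v "{v}"] by auto
  \<comment> \<open>The assumption \<open>dec\<close> makes \<open>f\<close> onto, and the open
    mapping theorem then selects \<open>Z\<close> and \<open>s\<close> with norms controlled by
    \<open>X\<close>. So the coefficient of \<open>v\<close> is a bounded functional, without
    assuming that the range of \<open>T - 1\<close> is closed.\<close>
  define f where "f = (\<lambda>(Z, s :: real). T Z - Z + s *\<^sub>R v)"
  have "bounded_linear f" unfolding f_def case_prod_unfold
    by (intro bounded_linear_add bounded_linear_sub bounded_linear_compose[OF T]
        bounded_linear_fst bounded_linear_scaleR_const[OF bounded_linear_snd])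
  moreover have "surj f"
  proof -
    have "\<exists>p. X = f p" for X
    proof -
      obtain s Z where "X = s *\<^sub>R v + (T Z - Z)" using dec by blast
      then have "f (Z, s) = X" by (simp add: f_def)
      then show ?thesis by metis
    qed
    then show ?thesis by (auto simp: surj_def)
  qed
  ultimately obtain C0 where C0: "\<And>y. \<exists>x. f x = y \<and> norm x \<le> C0 * norm y"
    using bounded_linear_surj_norm_bound by blast
  define C where "C = \<bar>C0\<bar>"
  have sol: "\<exists>Z s. Y = T Z - Z + s *\<^sub>R v \<and> norm Z \<le> C * norm Y \<and> \<bar>s\<bar> \<le> C * norm Y" for Y
  proof -
    obtain Z s where Zs: "f (Z, s) = Y" "norm (Z, s) \<le> C0 * norm Y" using C0[of Y] by auto
    moreover have "C0 * norm Y \<le> C * norm Y" by (simp add: C_def mult_right_mono)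
    ultimately have "norm (Z, s) \<le> C * norm Y" by linarith
    then show ?thesis using Zs(1) norm_fst_le[of Z s] norm_snd_le[of s Z]
      by (intro exI[of _ Z] exI[of _ s]) (auto simp: f_def)
  qed
  define l where "l Y = (SOME s. \<exists>Z. Y = T Z - Z + s *\<^sub>R v)" for Y
  have unique: "s = s'" if "T Z - Z + s *\<^sub>R v = T Z' - Z' + s' *\<^sub>R v" for Z Z' s s'
  proof (rule ccontr)
    assume ne: "s \<noteq> s'"
    define W where "W = (Z' - Z) /\<^sub>R (s - s')"
    have "(s - s') *\<^sub>R v = T (Z' - Z) - (Z' - Z)"
      using that by (simp add: T.diff algebra_simps)
    then have "((s - s') *\<^sub>R v) /\<^sub>R (s - s') = (T (Z' - Z) - (Z' - Z)) /\<^sub>R (s - s')" by simp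
    then have "v = T W - W" unfolding W_def T.scaleR using ne by (simp add: scaleR_diff_right)
    then show False using v_notin by blast
  qed
  have l_eq: "l (T Z - Z + s *\<^sub>R v) = s" for Z s
    unfolding l_def by (rule some_equality) (use unique in blast)+
  have l_bl: "bounded_linear l"
  proof (rule bounded_linear_intro)
    fix X Y r
    obtain Z s where X: "X = T Z - Z + s *\<^sub>R v" and s: "\<bar>s\<bar> \<le> C * norm X" using sol[of X] by blast
    obtain Z' s' where Y: "Y = T Z' - Z' + s' *\<^sub>R v" using sol[of Y] by blast
    have "X + Y = T (Z + Z') - (Z + Z') + (s + s') *\<^sub>R v"
      by (simp add: X Y T.add algebra_simps)
    then show "l (X + Y) = l X + l Y" by (simp only: l_eq) (simp add: X Y l_eq)
    have "r *\<^sub>R X = T (r *\<^sub>R Z) - r *\<^sub>R Z + (r * s) *\<^sub>R v"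
      by (simp add: X T.scaleR algebra_simps)
    then show "l (r *\<^sub>R X) = r *\<^sub>R l X" by (simp only: l_eq) (simp add: X l_eq)
    show "norm (l X) \<le> norm X * C" using s by (simp add: X l_eq mult.commute)
  qed
  interpret l: bounded_linear l by (rule l_bl)
  have lv: "l v = 1" using l_eq[of 0 1] by (simp add: T.zero)
  have lT: "l (T Y) = l Y" for Y using l_eq[of Y 0] by (simp add: l.diff)
  define P where "P Y = l Y *\<^sub>R v" for Y
  define B where "B Y = T Y - P Y" for Y
  have P_bl: "bounded_linear P" unfolding P_def by (rule bounded_linear_scaleR_const[OF l_bl])
  have B_bl: "bounded_linear B" unfolding B_def by (rule bounded_linear_sub[OF T P_bl])
  interpret P: bounded_linear P by (rule P_bl)
  interpret B: bounded_linear B by (rule B_bl)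
  have BP: "B (P Y) = 0" and PB: "P (B Y) = 0" and PT: "P (T Y) = P Y" and PP: "P (P Y) = P Y" for Y
    by (simp_all add: B_def P_def T.scaleR Tv l.scaleR lv l.diff lT)
  define T2 where "T2 = map_prod T T"
  define B2 where "B2 = map_prod B B"
  define P2 where "P2 = map_prod P P"
  have bl2: "bounded_linear T2" "bounded_linear B2" "bounded_linear P2"
    unfolding T2_def B2_def P2_def by (intro bounded_linear_map_prod T B_bl P_bl)+
  interpret T2: bounded_linear T2 by (rule bl2)
  interpret B2: bounded_linear B2 by (rule bl2)
  interpret P2: bounded_linear P2 by (rule bl2)
  have cs: "complex_scale z (T2 p) = T2 (complex_scale z p)" "complex_scale z (B2 p) = B2 (complex_scale z p)"
    "complex_scale z (P2 p) = P2 (complex_scale z p)" for z p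
    unfolding T2_def B2_def P2_def
    by (intro complex_scale_map_prod T.linear B.linear P.linear)+
  have B2_eq: "B2 p = T2 p - P2 p" for p by (cases p) (simp add: B2_def T2_def P2_def B_def)
  have B2P2: "B2 (P2 p) = 0" and P2B2: "P2 (B2 p) = 0" and P2T2: "P2 (T2 p) = P2 p" and P2P2: "P2 (P2 p) = P2 p" for p
    by (cases p; simp add: B2_def T2_def P2_def BP PB PT PP zero_prod_def)+
  define D where "D z p = p - complex_scale z (B2 p)" for z p
  have D_bl: "bounded_linear (D z)" for z
    unfolding D_def by (intro bounded_linear_sub bounded_linear_ident
        bounded_linear_compose[OF bounded_linear_complex_scale bl2(2)])
  have D_inv: "\<exists>g. bounded_linear g \<and> (\<forall>x. g (D z x) = x) \<and> (\<forall>y. D z (g y) = y)" if z: "norm z \<le> 1" for z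
  proof -
    have P2_0: "P2 p = 0" if "D z p = 0" for p
    proof -
      have "P2 p = P2 (complex_scale z (B2 p))" using that by (simp add: D_def)
      then show ?thesis by (simp add: cs(3)[symmetric] P2B2)
    qed
    \<comment> \<open>At \<open>z = 1\<close> the inverse of \<open>1 - B\<close> comes from the
      decomposition of the space; otherwise \<open>w = 1 / z\<close> lies in the region where
      \<open>T\<close> has a resolvent.\<close>
    consider "z = 0" | "z = 1" | "z \<noteq> 0" "z \<noteq> 1" by blast
    then show ?thesis
    proof cases
      case 1
      then show ?thesis by (intro exI[of _ "\<lambda>x. x"]) (simp add: D_def bounded_linear_ident)
    next
      case 2
      have "\<exists>Z. Z - B Z = Y \<and> norm Z \<le> (C + (C + onorm l * C) * norm v) * norm Y" for Y
      proof -
        obtain Z s where Z: "Y = T Z - Z + s *\<^sub>R v" "norm Z \<le> C * norm Y" "\<bar>s\<bar> \<le> C * norm Y"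
          using sol by blast
        \<comment> \<open>As \<open>B\<close> annihilates \<open>v\<close>, \<open>W - B W\<close>
          equals \<open>B Z - Z + (s + l Z) v\<close>, and the summand \<open>l Z\<close> undoes the
          projection contained in \<open>B Z\<close>.\<close>
        define W where "W = (s + l Z) *\<^sub>R v - Z"
        have "W - B W = Y"
          by (simp add: W_def B_def P_def T.diff T.add T.scaleR l.add Tv l.diff l.scaleR lv Z(1) algebra_simps)
        moreover have "norm W \<le> norm Z + \<bar>s + l Z\<bar> * norm v"
          unfolding W_def by (metis norm_triangle_ineq4 norm_scaleR add.commute)
        moreover have "\<bar>s + l Z\<bar> \<le> C * norm Y + onorm l * (C * norm Y)"
        proof -
          have "\<bar>l Z\<bar> \<le> onorm l * norm Z" using onorm[OF l_bl, of Z] by simp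
          also have "\<dots> \<le> onorm l * (C * norm Y)"
            by (intro mult_left_mono Z onorm_pos_le[OF l_bl])
          finally show ?thesis using Z(3) by linarith
        qed
        then have "\<bar>s + l Z\<bar> * norm v \<le> (C * norm Y + onorm l * (C * norm Y)) * norm v"
          by (intro mult_right_mono) auto
        ultimately show ?thesis using Z(2) by (intro exI[of _ W]) (auto simp: algebra_simps)
      qed
      then obtain K where K: "\<And>Y. \<exists>Z. Z - B Z = Y \<and> norm Z \<le> K * norm Y" by blast
      show ?thesis
      proof (rule bounded_linear_inverse_ex[OF D_bl])
        show "x = 0" if "D z x = 0" for x
        proof -
          have "P2 x = 0" "x = B2 x" using P2_0[OF that] that 2 by (auto simp: D_def)
          then have "T2 x = x" by (simp add: B2_eq)
          obtain U V where x: "x = (U, V)" by (cases x)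
          have "U = 0" if "T U = U" "P U = 0" for U
          proof -
            have "U \<in> span {v}" using that(1) ker by blast
            then obtain m where "U = m *\<^sub>R v" by (auto simp: span_singleton)
            then show ?thesis using that(2) v by (auto simp: P_def l.scaleR lv)
          qed
          then show ?thesis using \<open>P2 x = 0\<close> \<open>T2 x = x\<close> x by (auto simp: P2_def T2_def zero_prod_def)
        qed
        fix y :: "'a \<times> 'a"
        obtain U V where y: "y = (U, V)" by (cases y)
        obtain U' V' where U': "U' - B U' = U" "norm U' \<le> K * norm U" and V': "V' - B V' = V" "norm V' \<le> K * norm V"
          using K by meson
        have "norm (U', V') \<le> norm U' + norm V'" by (rule norm_Pair_le)
        also have "\<dots> \<le> \<bar>K\<bar> * norm U + \<bar>K\<bar> * norm V"
          using U'(2) V'(2) abs_ge_self[of K] by (meson add_mono mult_right_mono norm_ge_zero order_trans)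
        also have "\<dots> \<le> \<bar>K\<bar> * norm y + \<bar>K\<bar> * norm y" unfolding y
          by (intro add_mono mult_left_mono norm_fst_le norm_snd_le) auto
        finally have "norm (U', V') \<le> 2 * \<bar>K\<bar> * norm y" by simp
        moreover have "D z (U', V') = y" using U' V' 2 by (simp add: D_def B2_def y)
        ultimately show "\<exists>x. D z x = y \<and> norm x \<le> 2 * \<bar>K\<bar> * norm y" by blast
      qed
    next
      case 3
      define w where "w = 1 / z"
      have w: "norm w \<ge> 1" "w \<noteq> 1" "w \<noteq> 0" "z * w = 1" "w * z = 1" using z 3
        by (auto simp: w_def norm_divide divide_simps)
      obtain K where K: "\<And>p. norm p \<le> K * norm (complex_scale w p - T2 p)"
        and surj: "surj (\<lambda>p. complex_scale w p - T2 p)"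
        using res[OF w(1,2)] unfolding T2_def by blast
      have K0: "norm p \<le> \<bar>K\<bar> * norm (complex_scale w p - T2 p)" for p
        using K[of p] abs_ge_self[of K] by (meson mult_right_mono norm_ge_zero order_trans)
      define K' where "K' = \<bar>K\<bar> * (1 + onorm P2) * (4 * norm w) + 4 * norm z * onorm P2 * (4 * norm w)"
      show ?thesis
      proof (rule bounded_linear_inverse_ex[OF D_bl])
        show "x = 0" if "D z x = 0" for x
        proof -
          have "x = complex_scale z (B2 x)" using that by (simp add: D_def)
          then have "complex_scale w x = complex_scale (w * z) (B2 x)" by (metis complex_scale_mult)
          then have "complex_scale w x = B2 x" using w by simp
          then have "complex_scale w x - T2 x = 0" using P2_0[OF that] by (simp add: B2_eq)
          then show ?thesis using K0[of x] by simp
        qed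
        fix y :: "'a \<times> 'a"
        define y' where "y' = complex_scale w y"
        \<comment> \<open>The resolvent of \<open>T\<close> treats the part in the kernel of
          \<open>P2\<close>. As \<open>w \<noteq> 1\<close>, its solution stays in that kernel,
          where \<open>T2\<close> and \<open>B2\<close> agree. On the range of \<open>P2\<close> the
          operator \<open>B2\<close> vanishes, and dividing by \<open>w\<close> suffices.\<close>
        obtain x' where "y' - P2 y' = complex_scale w x' - T2 x'" by (rule surjE[OF surj])
        then have x': "complex_scale w x' - T2 x' = y' - P2 y'" by simp
        have "P2 (complex_scale w x' - T2 x') = 0" by (simp add: x' P2.diff P2P2)
        then have "complex_scale w (P2 x') - P2 x' = 0" by (simp add: P2.diff P2T2 cs)
        then have "complex_scale (w - 1) (P2 x') = 0"
          using complex_scale_add_left[of "w - 1" 1 "P2 x'"] by simp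
        then have "complex_scale ((1 / (w - 1)) * (w - 1)) (P2 x') = 0" by (simp only: complex_scale_mult) simp
        then have P2x': "P2 x' = 0" using w by simp
        define x where "x = x' + complex_scale z (P2 y')"
        have "B2 (complex_scale z (P2 y')) = complex_scale z (B2 (P2 y'))" by (rule cs(2)[symmetric])
        then have "B2 x = T2 x'" by (simp add: x_def B2.add B2P2 B2_eq[of x'] P2x')
        moreover have "complex_scale w (complex_scale z (P2 y')) = P2 y'"
          using w(5) by (simp flip: complex_scale_mult)
        ultimately have "complex_scale w x - B2 x = complex_scale w x' - T2 x' + P2 y'"
          by (simp add: x_def complex_scale_add)
        then have eq: "complex_scale w x - B2 x = y'" by (simp add: x')
        have "D z x = complex_scale z (complex_scale w x - B2 x)"
          using w by (simp add: D_def complex_scale_diff flip: complex_scale_mult)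
        also have "\<dots> = y" unfolding eq y'_def using w by (simp flip: complex_scale_mult)
        finally have "D z x = y" .
        moreover have "norm x \<le> K' * norm y"
        proof -
          have Py: "norm (P2 y') \<le> onorm P2 * norm y'" by (rule onorm[OF bl2(3)])
          have y': "norm y' \<le> 4 * norm w * norm y" unfolding y'_def by (rule norm_complex_scale)
          have "norm (y' - P2 y') \<le> (1 + onorm P2) * norm y'"
            using Py norm_triangle_ineq4[of y' "P2 y'"] by (simp add: algebra_simps)
          then have "norm x' \<le> \<bar>K\<bar> * ((1 + onorm P2) * norm y')"
            using K0[of x'] unfolding x' by (meson abs_ge_zero mult_left_mono order_trans)
          moreover have "norm (complex_scale z (P2 y')) \<le> 4 * norm z * (onorm P2 * norm y')"
            by (rule order_trans[OF norm_complex_scale]) (intro mult_left_mono Py, simp)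
          ultimately have "norm x \<le> \<bar>K\<bar> * ((1 + onorm P2) * norm y') + 4 * norm z * (onorm P2 * norm y')"
            unfolding x_def by (meson norm_triangle_ineq add_mono order_trans)
          also have "\<dots> = (\<bar>K\<bar> * (1 + onorm P2) + 4 * norm z * onorm P2) * norm y'" by (simp add: algebra_simps)
          also have "\<dots> \<le> (\<bar>K\<bar> * (1 + onorm P2) + 4 * norm z * onorm P2) * (4 * norm w * norm y)"
            by (intro mult_left_mono y' add_nonneg_nonneg mult_nonneg_nonneg onorm_pos_le[OF bl2(3)]) auto
          also have "\<dots> = K' * norm y" by (simp add: K'_def algebra_simps)
          finally show ?thesis .
        qed
        ultimately show "\<exists>x. D z x = y \<and> norm x \<le> K' * norm y" by blast
      qed
    qed
  qed
  define c where "c z = Endo (Blinfun (complex_scale z :: 'a \<times> 'a \<Rightarrow> _))" for z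
  define x where "x = Endo (Blinfun B2)"
  have c_op: "endo_op (c z) p = complex_scale z p" for z p
    by (simp add: c_def endo_op_Endo bounded_linear_complex_scale)
  have x_op: "endo_op x p = B2 p" for p by (simp add: x_def endo_op_Endo bl2)
  obtain g where g: "\<And>z. norm z \<le> 1 \<Longrightarrow> bounded_linear (g z) \<and> (\<forall>x. g z (D z x) = x) \<and> (\<forall>y. D z (g z y) = y)"
    using D_inv by metis
  have "\<exists>N\<ge>1. norm (x ^ N) \<le> 1 / 2"
  proof (rule power_small_if_resolvent)
    show "c (z + w) = c z + c w" for z w by (rule endo_eqI) (simp add: c_op complex_scale_add_left)
    show "c (z * w) = c z * c w" for z w by (rule endo_eqI) (simp add: c_op complex_scale_mult)
    show "c 1 = 1" by (rule endo_eqI) (simp add: c_op)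
    show "c z * x = x * c z" for z by (rule endo_eqI) (simp add: c_op x_op cs)
    show "norm (c z) \<le> 4 * norm z" for z
      unfolding c_def by (rule norm_Endo_le) (auto simp: bounded_linear_complex_scale norm_complex_scale)
    show "Endo (Blinfun (g z)) * (1 - c z * x) = 1" "(1 - c z * x) * Endo (Blinfun (g z)) = 1" if "norm z \<le> 1" for z
      using g[OF that] by (auto intro!: endo_eqI simp: endo_op_Endo c_op x_op D_def)
  qed
  then obtain N where N: "N \<ge> 1" "norm (x ^ N) \<le> 1 / 2" by blast
  \<comment> \<open>Back from the complexification: real vectors are the pairs
    \<open>(U, 0)\<close>, with the same norm.\<close>
  have x_pow: "endo_op (x ^ n) (U, 0) = ((B ^^ n) U, 0)" for n U
    by (induction n) (simp_all add: x_op B2_def B.zero)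
  have BN: "norm ((B ^^ N) U) \<le> 1 / 2 * norm U" for U
  proof -
    have "norm ((B ^^ N) U) = norm (endo_op (x ^ N) (U, 0))" by (simp add: x_pow norm_Pair)
    also have "\<dots> \<le> norm (x ^ N) * norm (U, 0 :: 'a)" unfolding norm_endo.rep_eq by (rule norm_blinfun)
    also have "\<dots> \<le> 1 / 2 * norm (U, 0 :: 'a)" by (intro mult_right_mono N) auto
    finally show ?thesis by (simp add: norm_Pair)
  qed
  have BNk: "norm ((B ^^ (N * k)) U) \<le> (1 / 2) ^ k * norm U" for k U
  proof (induction k)
    case (Suc k)
    have "(B ^^ (N * Suc k)) U = (B ^^ N) ((B ^^ (N * k)) U)" by (simp add: funpow_add)
    then show ?case using BN[of "(B ^^ (N * k)) U"] Suc by simp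
  qed simp
  have T_pow: "(T ^^ n) V - l V *\<^sub>R v = (B ^^ n) (V - P V) \<and> P ((B ^^ n) (V - P V)) = 0" for n V
  proof (induction n)
    case 0
    then show ?case by (simp add: P_def l.diff l.scaleR lv)
  next
    case (Suc n)
    define W where "W = (B ^^ n) (V - P V)"
    have "(T ^^ n) V = W + l V *\<^sub>R v" "P W = 0" using Suc by (auto simp: W_def algebra_simps)
    then have "T ((T ^^ n) V) - l V *\<^sub>R v = B W" by (simp add: T.add T.scaleR Tv B_def)
    then show ?case by (simp add: W_def PB)
  qed
  have "norm ((T ^^ (N * k)) V - l V *\<^sub>R v) \<le> (1 + onorm P) * (1 / 2) ^ k * norm V" for k V
  proof -
    have "norm ((T ^^ (N * k)) V - l V *\<^sub>R v) \<le> (1 / 2) ^ k * norm (V - P V)"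
      using T_pow[of "N * k" V] BNk by simp
    also have "norm (V - P V) \<le> (1 + onorm P) * norm V"
      using onorm[OF P_bl, of V] norm_triangle_ineq4[of V "P V"] by (simp add: algebra_simps)
    finally show ?thesis by (simp add: mult_ac)
  qed
  then show ?thesis using N(1) l_bl by blast
qed

section \<open>Weighted bounds for sequences\<close>

text \<open>
  The library shows completeness of the space of bounded continuous functions only for functions
  on a metric space, hence the metric on the integers.
\<close>

instantiation int :: metric_space
begin

definition dist_int :: "int \<Rightarrow> int \<Rightarrow> real"
  where "dist_int x y = \<bar>of_int x - of_int y\<bar>"

definition uniformity_int :: "(int \<times> int) filter"
  where "uniformity_int = (INF e\<in>{0 <..}. principal {(x, y). dist x y < e})"

instance
proof
  fix U :: "int set"
  have "\<forall>\<^sub>F (x', y) in uniformity. x' = x \<longrightarrow> y \<in> U" if "x \<in> U" for x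
    unfolding uniformity_int_def
    by (rule eventually_INF1[of 1]) (use that in \<open>auto simp: eventually_principal dist_int_def simp flip: of_int_diff of_int_abs\<close>)
  then show "open U = (\<forall>x\<in>U. \<forall>\<^sub>F (x', y) in uniformity. x' = x \<longrightarrow> y \<in> U)"
    by (simp add: open_discrete)
qed (auto simp: uniformity_int_def dist_int_def)

end

instance bcontfun :: (metric_space, banach) banach ..

text \<open>A bound instead of a norm: it carries finiteness with it, while \<open>wnorm\<close> is
  a supremum without meaning off the weighted space.\<close>

definition wbd :: "(int \<Rightarrow> real) \<Rightarrow> real \<Rightarrow> 'n::finite bseq \<Rightarrow> bool" where
  "wbd w c V \<longleftrightarrow> (\<forall>j. w j * norm (V j) \<le> c)"

text \<open>The weight of \<open>X_s\<close> recentred at a real point \<open>y\<close>, so that it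
  can follow a wave; \<open>y = 0\<close> is the weight in \<open>weighted\<close>.\<close>

definition wt :: "real \<Rightarrow> real \<Rightarrow> int \<Rightarrow> real" where
  "wt s y j = 1 + exp (s * (of_int j - y))"

lemma wt_ge_1: "wt s y j \<ge> 1" by (simp add: wt_def)
lemma wt_pos: "wt s y j > 0" by (simp add: wt_def add_pos_pos)
lemma wt_nonneg: "wt s y j \<ge> 0" using wt_pos[of s y j] by simp
lemma exp_le_wt: "exp (s * (of_int j - y)) \<le> wt s y j" by (simp add: wt_def)

lemma wt_shift: "wt s (y + of_int k) j = wt s y (j - k)"
  by (simp add: wt_def algebra_simps)

lemma wt_change: "wt s y' j \<le> exp (\<bar>s\<bar> * \<bar>y - y'\<bar>) * wt s y j"
proof -
  have "s * (y - y') \<le> \<bar>s\<bar> * \<bar>y - y'\<bar>" by (metis abs_ge_self abs_mult)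
  then have "exp (s * (of_int j - y')) \<le> exp (\<bar>s\<bar> * \<bar>y - y'\<bar>) * exp (s * (of_int j - y))"
    unfolding exp_add[symmetric] by (simp add: algebra_simps)
  then show ?thesis by (simp add: wt_def algebra_simps add_mono)
qed

text \<open>The source of the interaction estimates: the growing parts of the two weights already
  multiply to the left-hand side, whatever the site \<open>j\<close>. Two quantities bounded in
  opposite weights thus have an exponentially small product.\<close>

lemma wt_product: "exp (s * (y' - y)) \<le> wt s y j * wt (- s) y' j"
proof -
  have "exp (s * (y' - y)) = exp (s * (of_int j - y)) * exp (- s * (of_int j - y'))"
    unfolding exp_add[symmetric] by (simp add: algebra_simps)
  also have "\<dots> \<le> wt s y j * wt (- s) y' j" by (intro mult_mono exp_le_wt wt_nonneg) auto
  finally show ?thesis .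
qed

lemma mult_le_if_weights:
  assumes "wt s y j * p \<le> c" "wt (- s) y' j * q \<le> d" "p \<ge> 0" "q \<ge> 0"
  shows "p * q \<le> c * d * exp (- s * (y' - y))"
proof -
  have "exp (s * (y' - y)) * (p * q) \<le> wt s y j * wt (- s) y' j * (p * q)"
    by (intro mult_right_mono wt_product) (use assms in auto)
  also have "\<dots> = (wt s y j * p) * (wt (- s) y' j * q)" by (simp add: mult_ac)
  also have "\<dots> \<le> c * d"
    using assms wt_nonneg[of s y j] wt_nonneg[of "- s" y' j]
    by (intro mult_mono) (auto intro: order_trans[OF mult_nonneg_nonneg])
  finally have "exp (s * (y' - y)) * (p * q) * exp (- s * (y' - y)) \<le> c * d * exp (- s * (y' - y))"
    by (intro mult_right_mono) auto
  moreover have "exp (s * (y' - y)) * exp (- s * (y' - y)) = 1"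
    unfolding exp_add[symmetric] by (simp add: algebra_simps)
  then have "exp (s * (y' - y)) * (p * q) * exp (- s * (y' - y)) = p * q"
    by (metis mult.commute mult.left_commute mult.right_neutral)
  ultimately show ?thesis by (simp only:)
qed

lemma wbd_D: "wbd w c V \<Longrightarrow> w j * norm (V j) \<le> c"
  by (simp add: wbd_def)

lemma wbd_mono: "wbd w c V \<Longrightarrow> c \<le> d \<Longrightarrow> wbd w d V"
  unfolding wbd_def by (meson order_trans)

lemma wbd_change: "wbd (wt s y) c V \<Longrightarrow> wbd (wt s y') (exp (\<bar>s\<bar> * \<bar>y - y'\<bar>) * c) V"
  unfolding wbd_def
proof
  fix j assume a: "\<forall>j. wt s y j * norm (V j) \<le> c"
  have "wt s y' j * norm (V j) \<le> exp (\<bar>s\<bar> * \<bar>y - y'\<bar>) * wt s y j * norm (V j)"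
    by (intro mult_right_mono wt_change) auto
  also have "\<dots> \<le> exp (\<bar>s\<bar> * \<bar>y - y'\<bar>) * c" using a by (simp add: mult.assoc)
  finally show "wt s y' j * norm (V j) \<le> exp (\<bar>s\<bar> * \<bar>y - y'\<bar>) * c" .
qed

lemma wbd_shift: "wbd (wt s (y + of_int k)) c (shift k V) \<longleftrightarrow> wbd (wt s y) c V"
  unfolding wbd_def shift_apply wt_shift
  by (metis add_diff_cancel_right')

lemma wbd_zero: "c \<ge> 0 \<Longrightarrow> wbd w c 0"
  by (simp add: wbd_def)

lemma wbd_add:
  assumes w: "\<And>j. w j \<ge> 0" and "wbd w c U" "wbd w d V" shows "wbd w (c + d) (U + V)"
  unfolding wbd_def
proof
  fix j
  have "w j * norm ((U + V) j) \<le> w j * (norm (U j) + norm (V j))"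
    by (intro mult_left_mono) (auto simp: norm_triangle_ineq w)
  also have "\<dots> \<le> c + d" unfolding distrib_left using assms by (intro add_mono wbd_D)
  finally show "w j * norm ((U + V) j) \<le> c + d" .
qed

lemma norm_le_if_wbd: "wbd (wt s y) c V \<Longrightarrow> norm (V j) \<le> c"
  using wbd_D[of "wt s y" c V j] wt_ge_1[of s y j] mult_right_mono[of 1 "wt s y j" "norm (V j)"]
  by simp

lemma wbd_nonneg: "(\<And>j. w j \<ge> 0) \<Longrightarrow> wbd w c V \<Longrightarrow> c \<ge> 0"
  using wbd_D[of w c V 0] by (meson mult_nonneg_nonneg norm_ge_zero order_trans)

lemma bounded_linear_bcontfun_apply: "bounded_linear (\<lambda>z :: 'a::topological_space \<Rightarrow>\<^sub>C 'b::real_normed_vector. z t)"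
  by (rule bounded_linear_intro[where K = 1]) (auto simp: norm_bounded)

lemma closed_wbd: "closed {V :: 'n::finite bseq. wbd w c V}"
proof -
  have "{V. wbd w c V} = (\<Inter>j. {V :: 'n bseq. w j * norm (V j) \<le> c})" by (auto simp: wbd_def)
  moreover have "closed {V :: 'n bseq. w j * norm (V j) \<le> c}" for j
    by (intro closed_Collect_le continuous_intros linear_continuous_on bounded_linear_bcontfun_apply)
  ultimately show ?thesis by auto
qed

lemma wbd_integral:
  fixes h :: "real \<Rightarrow> 'n::finite bseq"
  assumes w: "\<And>j. w j \<ge> 0" and h: "continuous_on {0..t} h" and c: "c integrable_on {0..t}"
    and bnd: "\<And>s. s \<in> {0..t} \<Longrightarrow> wbd w (c s) (h s)"
  shows "wbd w (integral {0..t} c) (integral {0..t} h)"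
  unfolding wbd_def
proof
  fix j
  have int: "h integrable_on {0..t}" using h by (rule integrable_continuous_real)
  have bl: "bounded_linear (\<lambda>z :: 'n bseq. w j *\<^sub>R z j)"
    by (rule bounded_linear_compose[OF bounded_linear_scaleR_right bounded_linear_bcontfun_apply])
  have "w j * norm (integral {0..t} h j) = norm (w j *\<^sub>R integral {0..t} h j)" using w by simp
  also have "w j *\<^sub>R integral {0..t} h j = integral {0..t} (\<lambda>s. w j *\<^sub>R h s j)"
    using integral_linear[OF int bl] unfolding o_def by (rule sym)
  also have "norm \<dots> \<le> integral {0..t} c"
  proof (rule integral_norm_bound_integral)
    show "(\<lambda>s. w j *\<^sub>R h s j) integrable_on {0..t}"
      using integrable_linear[OF int bl] by (simp add: o_def)
    show "norm (w j *\<^sub>R h s j) \<le> c s" if "s \<in> {0..t}" for s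
      using wbd_D[OF bnd[OF that], of j] w by simp
  qed (rule c)
  finally show "w j * norm (integral {0..t} h j) \<le> integral {0..t} c" .
qed

text \<open>The solution is differentiable in the supremum norm only, so Gronwall does not apply to
  its weighted norm. Instead, the closed sets given by the growing bound
  \<open>c * exp (K' * t)\<close> are invariant under the Picard operator, and uniqueness identifies
  the fixed point with \<open>Y\<close>.\<close>

lemma solution_wbd:
  fixes F :: "real \<Rightarrow> 'n::finite bseq \<Rightarrow> 'n bseq"
  assumes K: "K \<ge> 0" and T: "T \<ge> 0"
    and lip: "\<And>t x y. norm (F t x - F t y) \<le> K * norm (x - y)"
    and zero: "\<And>t. F t 0 = 0"
    and cont: "\<And>y. continuous_on UNIV y \<Longrightarrow> continuous_on UNIV (\<lambda>t. F t (y t))"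
    and w: "\<And>j. w j \<ge> 0" and F_w: "\<And>t Z c. wbd w c Z \<Longrightarrow> wbd w (K' * c) (F t Z)"
    and der: "\<And>t. t \<in> {0..T} \<Longrightarrow> (Y has_vector_derivative F t (Y t)) (at t within {0..T})"
    and init: "wbd w c (Y 0)"
  shows "wbd w (c * exp (K' * T)) (Y T)"
proof -
  have c: "c \<ge> 0" using wbd_nonneg[OF w init] .
  have "\<exists>Z. (\<forall>t. (Z has_vector_derivative F t (Z t)) (at t)) \<and> Z 0 = Y 0 \<and>
      (\<forall>t\<ge>0. Z t \<in> {V. wbd w (c * exp (K' * t)) V})"
  proof (rule picard[OF lip zero cont closed_wbd])
    show "0 \<in> {V. wbd w (c * exp (K' * t)) V}" for t using c by (simp add: wbd_zero)
    fix y :: "real \<Rightarrow> 'n bseq" and t :: real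
    assume y: "continuous_on UNIV y" and t: "t \<ge> 0"
      and in_C: "\<And>s. s \<ge> 0 \<Longrightarrow> y s \<in> {V. wbd w (c * exp (K' * s)) V}"
    have int: "((\<lambda>s. K' * (c * exp (K' * s))) has_integral c * exp (K' * t) - c * exp (K' * 0)) {0..t}"
      using t by (intro fundamental_theorem_of_calculus)
        (auto intro!: derivative_eq_intros simp flip: has_real_derivative_iff_has_vector_derivative)
    have "wbd w (integral {0..t} (\<lambda>s. K' * (c * exp (K' * s)))) (integral {0..t} (\<lambda>s. F s (y s)))"
      by (rule wbd_integral[OF w]) (use in_C F_w int continuous_on_subset[OF cont[OF y]] in \<open>auto simp: has_integral_integrable\<close>)
    then have "wbd w (c + (c * exp (K' * t) - c)) (Y 0 + integral {0..t} (\<lambda>s. F s (y s)))"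
      using integral_unique[OF int] by (intro wbd_add w init) simp
    then show "Y 0 + integral {0..t} (\<lambda>s. F s (y s)) \<in> {V. wbd w (c * exp (K' * t)) V}" by simp
  qed
  then obtain Z where Z: "\<And>t. (Z has_vector_derivative F t (Z t)) (at t)" "Z 0 = Y 0"
    "wbd w (c * exp (K' * T)) (Z T)" using T by auto
  have "Y T = Z T"
    by (rule ode_unique[OF T K, where F = F]) (auto simp: Z lip der has_vector_derivative_at_within)
  then show ?thesis using Z by simp
qed

section \<open>Shifts and cut-offs of sequences\<close>

lemma shift_shift: "shift j (shift k V) = shift (j + k) V"
  by (rule bcontfun_eqI) (simp add: shift_apply algebra_simps)

lemma shift_0 [simp]: "shift 0 V = V"
  by (rule bcontfun_eqI) (simp add: shift_apply)

lemma norm_shift [simp]: "norm (shift k V) = norm V"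
proof -
  have le: "norm (shift k V) \<le> norm V" for k and V :: "'n::finite bseq"
    by (rule norm_bound) (simp add: shift_apply norm_bounded)
  from le[of k V] le[of "- k" "shift k V"] show ?thesis by (simp add: shift_shift)
qed

lemma shift_linear: "shift k (U + V) = shift k U + shift k V" "shift k (U - V) = shift k U - shift k V"
  "shift k (r *\<^sub>R V) = r *\<^sub>R shift k V" "shift k 0 = 0"
  by (auto intro!: bcontfun_eqI simp: shift_apply)

lemma bounded_linear_shift: "bounded_linear (shift k)"
  by (rule bounded_linear_intro[where K = 1]) (auto simp: shift_linear)

lemma shift_invariant_shift:
  assumes "shift_invariant T"
  shows "T (shift k X) = shift k (T X)"
proof -
  have 1: "T (shift 1 X) = shift 1 (T X)" for X using assms by (simp add: shift_invariant_def)
  have pos: "T (shift (int n) X) = shift (int n) (T X)" for n X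
  proof (induction n)
    case (Suc n)
    have "shift (int (Suc n)) Y = shift 1 (shift (int n) Y)" for Y :: "'a bseq"
      by (simp add: shift_shift)
    then show ?case by (simp only: 1 Suc)
  qed simp
  show ?thesis
  proof (cases "k \<ge> 0")
    case True
    then show ?thesis using pos[of "nat k"] by simp
  next
    case False
    then have "T (shift (- k) (shift k X)) = shift (- k) (T (shift k X))" using pos[of "nat (- k)"] by simp
    then show ?thesis by (metis shift_shift add.right_inverse shift_0 add.left_inverse)
  qed
qed

definition restrict_seq :: "int set \<Rightarrow> 'n::finite bseq \<Rightarrow> 'n bseq" where
  "restrict_seq S V = Bcontfun (\<lambda>j. if j \<in> S then V j else 0)"

lemma restrict_seq_apply: "restrict_seq S V j = (if j \<in> S then V j else 0)"
  unfolding restrict_seq_def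
  by (subst Bcontfun_inverse)
    (auto simp: int_bcontfun_iff intro!: boundedI[of _ "norm V"] norm_bounded)

lemma norm_restrict_seq: "norm (restrict_seq S V) \<le> norm V"
  by (rule norm_bound) (auto simp: restrict_seq_apply norm_bounded)

lemma restrict_seq_split: "V = restrict_seq S V + restrict_seq (- S) V"
  by (rule bcontfun_eqI) (simp add: restrict_seq_apply)

lemma wbd_if_support:
  fixes V :: "'n::finite bseq"
  assumes "\<And>j. V j \<noteq> 0 \<Longrightarrow> s * (of_int j - y) \<le> a"
  shows "wbd (wt s y) ((1 + exp a) * norm V) V"
  unfolding wbd_def
proof
  fix j
  show "wt s y j * norm (V j) \<le> (1 + exp a) * norm V"
  proof (cases "V j = 0")
    case False
    then have "wt s y j \<le> 1 + exp a" using assms by (simp add: wt_def)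
    then show ?thesis by (intro mult_mono norm_bounded) auto
  qed (simp add: add_nonneg_nonneg)
qed

lemma closest_point_cball_lipschitz:
  fixes x y :: "'a::euclidean_space"
  assumes "r \<ge> 0"
  shows "norm (closest_point (cball 0 r) x - closest_point (cball 0 r) y) \<le> norm (x - y)"
  using closest_point_lipschitz[of "cball 0 r" x y] assms by (simp add: dist_norm)

section \<open>The nonlinearity and its linearization\<close>

lemma blinfun_bound_segment:
  fixes f :: "'a::real_normed_vector \<Rightarrow> 'b::real_normed_vector"
  assumes "\<And>u. u \<in> closed_segment x y \<Longrightarrow> (f has_derivative blinfun_apply (f' u)) (at u)"
    and "\<And>u. u \<in> closed_segment x y \<Longrightarrow> norm (f' u) \<le> B"
  shows "norm (f y - f x) \<le> B * norm (y - x)"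
  by (rule differentiable_bound[where S = "closed_segment x y" and f' = "\<lambda>u. blinfun_apply (f' u)"])
    (use assms in \<open>auto simp: has_derivative_at_withinI norm_blinfun.rep_eq\<close>)

lemma segment_norm_le: "u \<in> closed_segment x y \<Longrightarrow> norm (u - x) \<le> norm (y - x)"
  using segment_bound1[of u x y] by (simp add: norm_minus_commute)

lemma locally_lipschitz_cball:
  fixes h :: "'a::euclidean_space \<Rightarrow> 'b::metric_space"
  assumes "\<And>x. \<exists>r>0. \<exists>K. K-lipschitz_on (ball x r) h"
  shows "\<exists>K. K-lipschitz_on (cball 0 \<rho>) h"
proof -
  have "local_lipschitz {0 :: real} (cball 0 \<rho>) (\<lambda>_. h)"
    unfolding local_lipschitz_def
  proof (intro ballI)
    fix x :: 'a and t :: real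
    obtain r K where "r > 0" "K-lipschitz_on (ball x r) h" using assms by blast
    then have "K-lipschitz_on (cball x (r / 2) \<inter> cball 0 \<rho>) h"
      by (elim lipschitz_on_subset) auto
    then show "\<exists>u>0. \<exists>L. \<forall>t\<in>cball t u \<inter> {0}. L-lipschitz_on (cball x u \<inter> cball 0 \<rho>) h"
      using \<open>r > 0\<close> by (intro exI[of _ "r / 2"]) auto
  qed
  then obtain K where "\<And>t. t \<in> {0 :: real} \<Longrightarrow> K-lipschitz_on (cball 0 \<rho>) h"
    by (rule local_lipschitz_compact_implies_lipschitz) auto
  then show ?thesis by blast
qed

lemma wspace_iff: "X \<in> wspace s \<longleftrightarrow> (\<exists>c. wbd (wt s 0) c X)"
  by (auto simp: wspace_def bdd_above_def wbd_def weighted_def wt_def)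

lemma wnorm_le_iff:
  assumes "X \<in> wspace s"
  shows "wnorm s X \<le> c \<longleftrightarrow> wbd (wt s 0) c X"
  using assms cSUP_le_iff[of UNIV "weighted s X" c]
  by (simp add: wspace_def wnorm_def wbd_def weighted_def wt_def)

text \<open>Shift invariance moves the weight to any integer centre. Passing between a real centre
  and its integer part costs a factor \<open>exp \<bar>s\<bar>\<close> each way, so the constant
  does not depend on \<open>y\<close>.\<close>

lemma bounded_on_wspace_wbd:
  fixes T :: "'n::finite bseq \<Rightarrow>\<^sub>L 'n bseq"
  assumes T: "shift_invariant T" "bounded_on_wspace s T"
  shows "\<exists>K\<ge>0. \<forall>y c V. wbd (wt s y) c V \<longrightarrow> wbd (wt s y) (K * c) (T V)"
proof -
  obtain K where K: "\<And>X. X \<in> wspace s \<Longrightarrow> T X \<in> wspace s \<and> wnorm s (T X) \<le> K * wnorm s X"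
    using T by (auto simp: bounded_on_wspace_def)
  define K' where "K' = exp \<bar>s\<bar> * (\<bar>K\<bar> * exp \<bar>s\<bar>)"
  have "wbd (wt s y) (K' * c) (T V)" if V: "wbd (wt s y) c V" for y c V
  proof -
    define k where "k = \<lfloor>y\<rfloor>"
    have c: "c \<ge> 0" using wbd_nonneg[OF wt_nonneg V] .
    have yk: "\<bar>y - of_int k\<bar> \<le> 1" unfolding k_def by linarith
    then have e: "exp (\<bar>s\<bar> * \<bar>y - of_int k\<bar>) \<le> exp \<bar>s\<bar>" "exp (\<bar>s\<bar> * \<bar>of_int k - y\<bar>) \<le> exp \<bar>s\<bar>"
      by (auto simp: mult_left_le abs_minus_commute)
    have "wbd (wt s (of_int k)) (exp \<bar>s\<bar> * c) V"
      using wbd_change[OF V, of "of_int k"] by (rule wbd_mono) (use e c in \<open>auto intro: mult_right_mono\<close>)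
    then have Z: "wbd (wt s 0) (exp \<bar>s\<bar> * c) (shift (- k) V)"
      using wbd_shift[of s "of_int k" "- k" _ V] by simp
    define Z where "Z = shift (- k) V"
    have "Z \<in> wspace s" "wnorm s Z \<le> exp \<bar>s\<bar> * c" using Z wnorm_le_iff wspace_iff unfolding Z_def by blast+
    moreover have "wbd (wt s 0) (wnorm s Z) Z"
      using wnorm_le_iff[OF \<open>Z \<in> wspace s\<close>, of "wnorm s Z"] by simp
    then have "wnorm s Z \<ge> 0" by (rule wbd_nonneg[OF wt_nonneg])
    ultimately have "T Z \<in> wspace s" "wnorm s (T Z) \<le> \<bar>K\<bar> * (exp \<bar>s\<bar> * c)"
      using K[of Z] abs_ge_self[of K] by (auto intro: order_trans[OF _ mult_mono])
    then have "wbd (wt s 0) (\<bar>K\<bar> * (exp \<bar>s\<bar> * c)) (T Z)" using wnorm_le_iff by blast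
    then have "wbd (wt s (of_int k)) (\<bar>K\<bar> * (exp \<bar>s\<bar> * c)) (T V)"
      using wbd_shift[of s "of_int k" "- k" _ "T V"] by (simp add: Z_def shift_invariant_shift[OF T(1)])
    from wbd_change[OF this, of y] show ?thesis
      by (rule wbd_mono) (use e c in \<open>auto simp: K'_def mult.assoc intro!: mult_right_mono\<close>)
  qed
  then show ?thesis by (intro exI[of _ K']) (auto simp: K'_def)
qed

locale lattice_eq =
  fixes L :: "'n::finite bseq \<Rightarrow>\<^sub>L 'n bseq"
    and N :: "'m::finite \<Rightarrow> 'n bseq \<Rightarrow>\<^sub>L 'n bseq"
    and g :: "real ^ 'n ^ 'm \<Rightarrow> real ^ 'n"
    and g' :: "real ^ 'n ^ 'm \<Rightarrow> ((real ^ 'n ^ 'm) \<Rightarrow>\<^sub>L (real ^ 'n))"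
    and b R :: real
  assumes b_pos: "b > 0" and R_pos: "R > 0"
    and L_shift: "shift_invariant L" and L_weighted: "\<And>\<beta>. \<beta> \<in> {- b..b} \<Longrightarrow> bounded_on_wspace \<beta> L"
    and N_shift: "\<And>i. shift_invariant (N i)"
    and N_weighted: "\<And>i \<beta>. \<beta> \<in> {- b..b} \<Longrightarrow> bounded_on_wspace \<beta> (N i)"
    and g_deriv: "\<And>x. (g has_derivative blinfun_apply (g' x)) (at x)"
    and g'_lipschitz: "\<And>x. \<exists>r>0. \<exists>K. K-lipschitz_on (ball x r) g'"
    and g_0: "g 0 = 0"
begin

definition nv :: "'n bseq \<Rightarrow> int \<Rightarrow> real ^ 'n ^ 'm" where
  "nv X k = (\<chi> i. N i X k)"

lemma nv_linear: "nv (X + Y) k = nv X k + nv Y k" "nv (X - Y) k = nv X k - nv Y k"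
  "nv (r *\<^sub>R X) k = r *\<^sub>R nv X k" "nv 0 k = 0"
  by (simp_all add: nv_def vec_eq_iff blinfun.bilinear_simps)

lemma nv_shift: "nv (shift q X) k = nv X (k - q)"
  by (simp add: nv_def shift_invariant_shift[OF N_shift] shift_apply)

lemma norm_nv_le: "norm (nv X k) \<le> (\<Sum>i\<in>UNIV. norm (N i X k))"
  unfolding nv_def norm_vec_def by (rule order_trans[OF L2_set_le_sum]) auto

text \<open>One constant for the plain norm, both signs of the weight and every centre; uniformity
  in the centre is what lets the weights travel with the waves.\<close>

lemma KN_ex: "\<exists>K\<ge>1. (\<forall>X k. norm (nv X k) \<le> K * norm X) \<and> (\<forall>X. norm (L X) \<le> K * norm X) \<and>
  (\<forall>s\<in>{b, - b}. \<forall>y c X. wbd (wt s y) c X \<longrightarrow>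
    (\<forall>k. wt s y k * norm (nv X k) \<le> K * c) \<and> wbd (wt s y) (K * c) (L X))"
proof -
  have both: "\<exists>K\<ge>0. \<forall>s\<in>{b, - b}. \<forall>y c V. wbd (wt s y) c V \<longrightarrow> wbd (wt s y) (K * c) (T V)"
    if T: "shift_invariant T" "\<And>\<beta>. \<beta> \<in> {- b..b} \<Longrightarrow> bounded_on_wspace \<beta> T" for T :: "'n bseq \<Rightarrow>\<^sub>L 'n bseq"
  proof -
    obtain K1 where K1: "K1 \<ge> 0" "\<And>y c V. wbd (wt b y) c V \<Longrightarrow> wbd (wt b y) (K1 * c) (T V)"
      using bounded_on_wspace_wbd[OF T(1) T(2)[of b]] b_pos by auto
    obtain K2 where K2: "K2 \<ge> 0" "\<And>y c V. wbd (wt (- b) y) c V \<Longrightarrow> wbd (wt (- b) y) (K2 * c) (T V)"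
      using bounded_on_wspace_wbd[OF T(1) T(2)[of "- b"]] b_pos by auto
    have "wbd (wt s y) ((K1 + K2) * c) (T V)" if "s \<in> {b, - b}" "wbd (wt s y) c V" for s y c V
    proof -
      have "c \<ge> 0" using wbd_nonneg[OF wt_nonneg that(2)] .
      then have "K1 * c \<le> (K1 + K2) * c" "K2 * c \<le> (K1 + K2) * c" using K1 K2 by (simp_all add: mult_right_mono)
      then show ?thesis using that K1(2)[of y c V] K2(2)[of y c V] by (auto intro: wbd_mono)
    qed
    then show ?thesis using K1 K2 by (intro exI[of _ "K1 + K2"]) auto
  qed
  obtain KL where KL: "KL \<ge> 0" "\<And>s y c V. s \<in> {b, - b} \<Longrightarrow> wbd (wt s y) c V \<Longrightarrow> wbd (wt s y) (KL * c) (L V)"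
    using both[OF L_shift L_weighted] by blast
  have "\<forall>i. \<exists>K\<ge>0. \<forall>s\<in>{b, - b}. \<forall>y c V. wbd (wt s y) c V \<longrightarrow> wbd (wt s y) (K * c) (N i V)"
    using both[OF N_shift N_weighted] by blast
  then obtain KI where KI: "\<And>i. KI i \<ge> 0"
    "\<And>i s y c V. s \<in> {b, - b} \<Longrightarrow> wbd (wt s y) c V \<Longrightarrow> wbd (wt s y) (KI i * c) (N i V)"
    by metis
  define K where "K = 1 + KL + norm L + (\<Sum>i\<in>UNIV. KI i) + (\<Sum>i\<in>UNIV. norm (N i))"
  have K: "K \<ge> 1" "KL \<le> K" "norm L \<le> K" "(\<Sum>i\<in>UNIV. KI i) \<le> K" "(\<Sum>i\<in>UNIV. norm (N i)) \<le> K"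
    using KL(1) KI(1) sum_nonneg[of UNIV KI] sum_nonneg[of UNIV "\<lambda>i. norm (N i)"] by (auto simp: K_def)
  have 1: "norm (nv X k) \<le> K * norm X" for X k
  proof -
    have "norm (nv X k) \<le> (\<Sum>i\<in>UNIV. norm (N i X k))" by (rule norm_nv_le)
    also have "\<dots> \<le> (\<Sum>i\<in>UNIV. norm (N i) * norm X)"
      by (intro sum_mono) (meson norm_blinfun norm_bounded order_trans)
    also have "\<dots> \<le> K * norm X" unfolding sum_distrib_right[symmetric] using K by (intro mult_right_mono) auto
    finally show ?thesis .
  qed
  have 2: "norm (L X) \<le> K * norm X" for X
    using norm_blinfun[of L X] mult_right_mono[OF K(3), of "norm X"] by simp
  have 3: "wt s y k * norm (nv X k) \<le> K * c" "wbd (wt s y) (K * c) (L X)" if s: "s \<in> {b, - b}" and X: "wbd (wt s y) c X" for s y c X k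
  proof -
    have c: "c \<ge> 0" using wbd_nonneg[OF wt_nonneg X] .
    have "wt s y k * norm (nv X k) \<le> wt s y k * (\<Sum>i\<in>UNIV. norm (N i X k))"
      by (intro mult_left_mono norm_nv_le wt_nonneg)
    also have "\<dots> \<le> (\<Sum>i\<in>UNIV. KI i * c)" unfolding sum_distrib_left
      by (intro sum_mono wbd_D KI(2) s X)
    also have "\<dots> \<le> K * c" unfolding sum_distrib_right[symmetric] using K c by (intro mult_right_mono) auto
    finally show "wt s y k * norm (nv X k) \<le> K * c" .
    show "wbd (wt s y) (K * c) (L X)" using KL(2)[OF s X] by (rule wbd_mono) (intro mult_right_mono K c)
  qed
  show ?thesis using K(1) 1 2 3 by (intro exI[of _ K]) blast
qed

definition "KN = (SOME K. K \<ge> 1 \<and> (\<forall>X k. norm (nv X k) \<le> K * norm X) \<and> (\<forall>X. norm (L X) \<le> K * norm X) \<and>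
  (\<forall>s\<in>{b, - b}. \<forall>y c X. wbd (wt s y) c X \<longrightarrow>
    (\<forall>k. wt s y k * norm (nv X k) \<le> K * c) \<and> wbd (wt s y) (K * c) (L X)))"

lemma KN: "KN \<ge> 1" "norm (nv X k) \<le> KN * norm X" "norm (L X) \<le> KN * norm X"
  "s \<in> {b, - b} \<Longrightarrow> wbd (wt s y) c X \<Longrightarrow> wt s y k * norm (nv X k) \<le> KN * c"
  "s \<in> {b, - b} \<Longrightarrow> wbd (wt s y) c X \<Longrightarrow> wbd (wt s y) (KN * c) (L X)"
  using someI_ex[OF KN_ex] unfolding KN_def[symmetric] by blast+

text \<open>Contains all values \<open>nv X k\<close> for \<open>X\<close> in the ball of radius
  \<open>R\<close>. Convexity is used for mean value estimates, compactness for a uniform Lipschitz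
  constant of \<open>g'\<close>.\<close>

definition "B = cball (0 :: real ^ 'n ^ 'm) (KN * R)"

lemma KR_nonneg: "KN * R \<ge> 0" using KN(1) R_pos by simp

lemma convex_B: "convex B" and zero_in_B: "0 \<in> B" using KR_nonneg by (auto simp: B_def)

lemma nv_in_B: "norm X \<le> R \<Longrightarrow> nv X k \<in> B"
  using order_trans[OF KN(2)[of X k] mult_left_mono[of "norm X" R KN]] KN(1) by (simp add: B_def)

lemma KG_ex: "\<exists>K\<ge>0. (\<forall>x\<in>B. norm (g' x) \<le> K) \<and> (\<forall>x\<in>B. \<forall>y\<in>B. norm (g' x - g' y) \<le> K * norm (x - y))"
proof -
  obtain K where K: "K-lipschitz_on B g'"
    using locally_lipschitz_cball[OF g'_lipschitz] unfolding B_def by blast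
  then have lip: "norm (g' x - g' y) \<le> K * norm (x - y)" if "x \<in> B" "y \<in> B" for x y
    using that by (auto simp: lipschitz_on_def dist_norm)
  have K0: "K \<ge> 0" using K by (rule lipschitz_on_nonneg)
  define K' where "K' = K + K * (KN * R) + norm (g' 0)"
  have "norm (g' x) \<le> K'" if "x \<in> B" for x
  proof -
    have "norm (g' x) \<le> norm (g' x - g' 0) + norm (g' 0)" by (metis norm_triangle_sub add.commute)
    also have "norm (g' x - g' 0) \<le> K * norm x" using lip[OF that zero_in_B] by simp
    also have "\<dots> \<le> K * (KN * R)" using that K0 by (intro mult_left_mono) (auto simp: B_def)
    finally show ?thesis using K0 by (simp add: K'_def)
  qed
  moreover have "K * norm (x - y) \<le> K' * norm (x - y)" for x y
    using K0 KR_nonneg by (intro mult_right_mono) (auto simp: K'_def)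
  then have "norm (g' x - g' y) \<le> K' * norm (x - y)" if "x \<in> B" "y \<in> B" for x y
    using lip[OF that] order_trans by blast
  moreover have "K' \<ge> 0" using K0 KR_nonneg by (simp add: K'_def)
  ultimately show ?thesis by blast
qed

definition "KG = (SOME K. K \<ge> 0 \<and> (\<forall>x\<in>B. norm (g' x) \<le> K) \<and> (\<forall>x\<in>B. \<forall>y\<in>B. norm (g' x - g' y) \<le> K * norm (x - y)))"

lemma KG: "KG \<ge> 0" "x \<in> B \<Longrightarrow> norm (g' x) \<le> KG" "x \<in> B \<Longrightarrow> y \<in> B \<Longrightarrow> norm (g' x - g' y) \<le> KG * norm (x - y)"
  using someI_ex[OF KG_ex] unfolding KG_def[symmetric] by blast+

lemma segment_in_B: "x \<in> B \<Longrightarrow> y \<in> B \<Longrightarrow> u \<in> closed_segment x y \<Longrightarrow> u \<in> B"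
  using convex_B by (meson closed_segment_subset subsetD)

lemma g_lipschitz: "x \<in> B \<Longrightarrow> y \<in> B \<Longrightarrow> norm (g y - g x) \<le> KG * norm (y - x)"
  by (rule blinfun_bound_segment[OF g_deriv]) (use KG segment_in_B in blast)

lemma g_taylor:
  assumes "x \<in> B" "y \<in> B" shows "norm (g y - g x - g' x (y - x)) \<le> KG * norm (y - x) * norm (y - x)"
proof -
  have "norm ((g y - g' x y) - (g x - g' x x)) \<le> KG * norm (y - x) * norm (y - x)"
  proof (rule blinfun_bound_segment[where f' = "\<lambda>u. g' u - g' x"])
    fix u assume u: "u \<in> closed_segment x y"
    show "((\<lambda>u. g u - g' x u) has_derivative blinfun_apply (g' u - g' x)) (at u)"
      by (auto intro!: derivative_eq_intros g_deriv simp: blinfun.diff_left)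
    have "norm (g' u - g' x) \<le> KG * norm (u - x)" using assms u segment_in_B KG by blast
    also have "\<dots> \<le> KG * norm (y - x)" by (intro mult_left_mono segment_norm_le u KG)
    finally show "norm (g' u - g' x) \<le> KG * norm (y - x)" .
  qed
  then show ?thesis by (simp add: blinfun.diff_right algebra_simps)
qed

text \<open>The map \<open>u \<mapsto> g (u + y) - g u\<close> has a derivative of size at most
  \<open>KG * norm y\<close> on the segment from 0 to \<open>x\<close>, and \<open>g 0 = 0\<close>.
  The bound is a product of the two norms, so it is small as soon as one of the factors is, which is
  the case at every site for two separated waves.\<close>

lemma g_interaction:
  assumes "x \<in> B" "y \<in> B" "x + y \<in> B"
  shows "norm (g (x + y) - g x - g y) \<le> KG * norm x * norm y"
proof -
  have "norm ((g (x + y) - g x) - (g (0 + y) - g 0)) \<le> KG * norm y * norm (x - 0)"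
  proof (rule blinfun_bound_segment[where f' = "\<lambda>u. g' (u + y) - g' u"])
    fix u assume u: "u \<in> closed_segment 0 x"
    have d: "((\<lambda>u. g (u + y)) has_derivative blinfun_apply (g' (u + y))) (at u)"
      by (rule has_derivative_compose[of "\<lambda>u. u + y" "\<lambda>h. h" u UNIV g, simplified])
        (auto intro!: derivative_eq_intros g_deriv)
    show "((\<lambda>u. g (u + y) - g u) has_derivative blinfun_apply (g' (u + y) - g' u)) (at u)"
      by (rule has_derivative_eq_rhs[OF has_derivative_diff[OF d g_deriv]])
        (simp add: fun_eq_iff blinfun.diff_left)
    have "u + y \<in> closed_segment (0 + y) (x + y)"
      using u by (auto simp: closed_segment_def algebra_simps)
    then have "u \<in> B" "u + y \<in> B"
      using assms u zero_in_B segment_in_B[of 0 x u] segment_in_B[of "0 + y" "x + y" "u + y"] by auto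
    then show "norm (g' (u + y) - g' u) \<le> KG * norm y" using KG(3)[of "u + y" u] by simp
  qed
  then show ?thesis by (simp add: g_0 mult_ac)
qed

text \<open>Chosen to dominate the Lipschitz constants, the growth rates and the coefficients of the
  quadratic remainders, plain and weighted.\<close>

definition "K = KN * KN * (1 + KG)"

lemma K: "K \<ge> 1" "KN * (1 + KG) \<le> K" "KG * KN * KN \<le> K" "KG \<le> K" "KN \<le> K"
proof -
  have a: "1 \<le> KN * KN" using KN(1) mult_mono[of 1 KN 1 KN] by simp
  show "K \<ge> 1" unfolding K_def using a KG(1) mult_mono[of 1 "KN * KN" 1 "1 + KG"] by simp
  show b: "KN * (1 + KG) \<le> K" unfolding K_def using KN(1) KG(1) mult_right_mono[of 1 KN KN]
    by (intro mult_right_mono) auto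
  show "KG * KN * KN \<le> K" unfolding K_def using KN(1) KG(1) by (simp add: algebra_simps)
  have "1 * KG \<le> KN * KG" "KN * 1 \<le> KN * (1 + KG)" using KN(1) KG(1)
    by (intro mult_right_mono mult_left_mono; simp)+
  then show "KG \<le> K" "KN \<le> K" using b KN(1) by (auto simp: algebra_simps)
qed

text \<open>
  Composing \<open>g\<close> with the projection onto a large ball makes the vector field globally Lipschitz
  and leaves it unchanged on the solutions of interest, which stay in the ball of radius \<open>R\<close>.
\<close>

definition "gc x = g (closest_point B x)"

lemma closest_point_B: "closest_point B x \<in> B"
  unfolding B_def using KR_nonneg by (intro closest_point_in_set) auto

lemma gc_lipschitz: "norm (gc x - gc y) \<le> KG * norm (x - y)"
proof -
  have "norm (gc x - gc y) \<le> KG * norm (closest_point B x - closest_point B y)"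
    unfolding gc_def by (intro g_lipschitz closest_point_B)
  also have "\<dots> \<le> KG * norm (x - y)"
    unfolding B_def by (intro mult_left_mono closest_point_cball_lipschitz KR_nonneg KG)
  finally show ?thesis .
qed

lemma gc_eq: "x \<in> B \<Longrightarrow> gc x = g x"
  by (simp add: gc_def closest_point_self)

lemma gc_norm: "norm (gc x) \<le> KG * norm x"
  using gc_lipschitz[of x 0] gc_eq[OF zero_in_B] by (simp add: g_0)

definition Gc :: "'n bseq \<Rightarrow> 'n bseq" where "Gc X = Bcontfun (\<lambda>k. gc (nv X k))"

lemma Gc_apply: "Gc X k = gc (nv X k)"
proof -
  have "norm (gc (nv X j)) \<le> KG * (KN * norm X)" for j
    using gc_norm[of "nv X j"] mult_left_mono[OF KN(2)[of X j] KG(1)] by linarith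
  then have "bounded (range (\<lambda>j. gc (nv X j)))" by (auto intro!: boundedI)
  then show ?thesis unfolding Gc_def by (subst Bcontfun_inverse) (auto simp: int_bcontfun_iff)
qed

definition Fc :: "'n bseq \<Rightarrow> 'n bseq" where "Fc X = L X + Gc X"

lemma nonlinearity_g: "nonlinearity g N X k = g (nv X k)"
  unfolding nv_def
  by (rule nonlinearity_apply) (meson g_deriv has_derivative_continuous continuous_at_imp_continuous_on)

lemma Fc_eq: "norm X \<le> R \<Longrightarrow> Fc X = L X + nonlinearity g N X"
  unfolding Fc_def by (intro arg_cong2[of _ _ _ _ "(+)"] refl bcontfun_eqI)
    (simp add: Gc_apply nonlinearity_g gc_eq nv_in_B)

lemma Fc_lipschitz: "norm (Fc X - Fc Y) \<le> K * norm (X - Y)"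
proof -
  have "norm (Gc X - Gc Y) \<le> KG * (KN * norm (X - Y))"
  proof (rule norm_bound)
    fix k
    have "norm ((Gc X - Gc Y) k) \<le> KG * norm (nv (X - Y) k)"
      using gc_lipschitz[of "nv X k" "nv Y k"] by (simp add: Gc_apply nv_linear)
    also have "\<dots> \<le> KG * (KN * norm (X - Y))" by (intro mult_left_mono KN KG)
    finally show "norm ((Gc X - Gc Y) k) \<le> KG * (KN * norm (X - Y))" .
  qed
  moreover have "norm (Fc X - Fc Y) \<le> norm (L (X - Y)) + norm (Gc X - Gc Y)"
    unfolding Fc_def by (metis add_diff_add blinfun.diff_right norm_triangle_ineq)
  ultimately have "norm (Fc X - Fc Y) \<le> KN * (1 + KG) * norm (X - Y)"
    using KN(3)[of "X - Y"] by (simp add: algebra_simps)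
  also have "\<dots> \<le> K * norm (X - Y)" by (intro mult_right_mono K) auto
  finally show ?thesis .
qed

lemma Fc_0: "Fc 0 = 0"
  unfolding Fc_def by (rule bcontfun_eqI) (simp add: Gc_apply nv_linear gc_eq zero_in_B g_0 blinfun.zero_right)

lemma Fc_wbd:
  assumes s: "s \<in> {b, - b}" and X: "wbd (wt s y) c X"
  shows "wbd (wt s y) (K * c) (Fc X)"
proof -
  have c: "c \<ge> 0" using wbd_nonneg[OF wt_nonneg X] .
  have "wbd (wt s y) (KG * (KN * c)) (Gc X)"
    unfolding wbd_def
  proof
    fix j
    have "wt s y j * norm (Gc X j) \<le> wt s y j * (KG * norm (nv X j))"
      by (intro mult_left_mono wt_nonneg) (simp add: Gc_apply gc_norm)
    also have "\<dots> = KG * (wt s y j * norm (nv X j))" by simp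
    also have "\<dots> \<le> KG * (KN * c)" by (intro mult_left_mono KN s X KG)
    finally show "wt s y j * norm (Gc X j) \<le> KG * (KN * c)" .
  qed
  then have "wbd (wt s y) (KN * c + KG * (KN * c)) (Fc X)"
    unfolding Fc_def by (intro wbd_add wt_nonneg KN s X)
  moreover have "KN * c + KG * (KN * c) = KN * (1 + KG) * c" by (simp add: algebra_simps)
  moreover have "\<dots> \<le> K * c" by (intro mult_right_mono K c)
  ultimately show ?thesis by (metis wbd_mono)
qed

definition DG :: "'n bseq \<Rightarrow> 'n bseq \<Rightarrow> 'n bseq" where
  "DG X V = Bcontfun (\<lambda>k. g' (nv X k) (nv V k))"

lemma norm_g'_nv: "norm X \<le> R \<Longrightarrow> norm (g' (nv X k) z) \<le> KG * norm z"
  using norm_blinfun[of "g' (nv X k)" z] mult_right_mono[OF KG(2)[OF nv_in_B], of X "norm z" k] by simp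

lemma DG_apply:
  assumes "norm X \<le> R" shows "DG X V k = g' (nv X k) (nv V k)"
proof -
  have "norm (g' (nv X j) (nv V j)) \<le> KG * (KN * norm V)" for j
    using norm_g'_nv[OF assms, of j "nv V j"] mult_left_mono[OF KN(2)[of V j] KG(1)] by linarith
  then have "bounded (range (\<lambda>j. g' (nv X j) (nv V j)))" by (auto intro!: boundedI)
  then show ?thesis unfolding DG_def by (subst Bcontfun_inverse) (auto simp: int_bcontfun_iff)
qed

lemma norm_DG: "norm X \<le> R \<Longrightarrow> norm (DG X V) \<le> KG * (KN * norm V)"
proof (rule norm_bound)
  fix k assume X: "norm X \<le> R"
  show "norm (DG X V k) \<le> KG * (KN * norm V)"
    using norm_g'_nv[OF X, of k "nv V k"] mult_left_mono[OF KN(2)[of V k] KG(1)] by (simp add: DG_apply X)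
qed

lemma bounded_linear_DG: "norm X \<le> R \<Longrightarrow> bounded_linear (DG X)"
  by (rule bounded_linear_intro[where K = "KG * KN"])
    (auto intro!: bcontfun_eqI simp: DG_apply nv_linear blinfun.bilinear_simps mult_ac
      intro: order_trans[OF norm_DG])

definition M :: "'n bseq \<Rightarrow> 'n bseq \<Rightarrow>\<^sub>L 'n bseq" where
  "M X = L + Blinfun (DG X)"

lemma M_apply: "norm X \<le> R \<Longrightarrow> M X V = L V + DG X V"
  by (simp add: M_def blinfun.add_left bounded_linear_Blinfun_apply bounded_linear_DG)

lemma norm_M_apply:
  assumes "norm X \<le> R" shows "norm (M X V) \<le> K * norm V"
proof -
  have "norm (M X V) \<le> KN * norm V + KG * (KN * norm V)"
    unfolding M_apply[OF assms] by (intro order_trans[OF norm_triangle_ineq] add_mono KN norm_DG assms)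
  also have "\<dots> = KN * (1 + KG) * norm V" by (simp add: algebra_simps)
  also have "\<dots> \<le> K * norm V" by (intro mult_right_mono K) auto
  finally show ?thesis .
qed

lemma M_wbd:
  assumes X: "norm X \<le> R" and s: "s \<in> {b, - b}" and V: "wbd (wt s y) c V"
  shows "wbd (wt s y) (K * c) (M X V)"
proof -
  have c: "c \<ge> 0" using wbd_nonneg[OF wt_nonneg V] .
  have "wbd (wt s y) (KG * (KN * c)) (DG X V)"
    unfolding wbd_def
  proof
    fix j
    have "wt s y j * norm (DG X V j) \<le> wt s y j * (KG * norm (nv V j))"
      by (intro mult_left_mono wt_nonneg) (simp add: DG_apply X norm_g'_nv)
    also have "\<dots> = KG * (wt s y j * norm (nv V j))" by simp
    also have "\<dots> \<le> KG * (KN * c)" by (intro mult_left_mono KN s V KG)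
    finally show "wt s y j * norm (DG X V j) \<le> KG * (KN * c)" .
  qed
  then have "wbd (wt s y) (KN * c + KG * (KN * c)) (M X V)"
    unfolding M_apply[OF X] by (intro wbd_add wt_nonneg KN s V)
  moreover have "KN * c + KG * (KN * c) = KN * (1 + KG) * c" by (simp add: algebra_simps)
  moreover have "\<dots> \<le> K * c" by (intro mult_right_mono K c)
  ultimately show ?thesis by (metis wbd_mono)
qed

text \<open>Kept pointwise so that the two factors can be estimated in weights of opposite
  sign.\<close>

lemma M_diff_pointwise:
  assumes "norm X \<le> R" "norm Y \<le> R"
  shows "norm ((M X V - M Y V) k) \<le> KG * norm (nv (X - Y) k) * norm (nv V k)"
proof -
  have "(M X V - M Y V) k = (g' (nv X k) - g' (nv Y k)) (nv V k)"
    using assms by (simp add: M_apply DG_apply blinfun.diff_left)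
  also have "norm \<dots> \<le> norm (g' (nv X k) - g' (nv Y k)) * norm (nv V k)" by (rule norm_blinfun)
  also have "\<dots> \<le> KG * norm (nv (X - Y) k) * norm (nv V k)"
    using KG(3)[of "nv X k" "nv Y k"] assms by (intro mult_right_mono) (auto simp: nv_in_B nv_linear)
  finally show ?thesis .
qed

lemma M_diff:
  assumes "norm X \<le> R" "norm Y \<le> R"
  shows "norm (M X V - M Y V) \<le> K * norm (X - Y) * norm V"
proof (rule norm_bound)
  fix k
  have "norm ((M X V - M Y V) k) \<le> KG * norm (nv (X - Y) k) * norm (nv V k)"
    by (rule M_diff_pointwise[OF assms])
  also have "\<dots> \<le> KG * (KN * norm (X - Y)) * (KN * norm V)"
    using KN(1) KG(1) by (intro mult_mono KN) auto
  also have "\<dots> = (KG * KN * KN) * (norm (X - Y) * norm V)" by simp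
  also have "\<dots> \<le> K * (norm (X - Y) * norm V)" by (intro mult_right_mono K) auto
  finally show "norm ((M X V - M Y V) k) \<le> K * norm (X - Y) * norm V" by (simp add: mult.assoc)
qed

lemma continuous_on_M: "continuous_on (cball 0 R) M"
proof (rule lipschitz_on_continuous_on[of K], rule lipschitz_onI)
  fix X Y :: "'n bseq" assume "X \<in> cball 0 R" "Y \<in> cball 0 R"
  then show "dist (M X) (M Y) \<le> K * dist X Y"
    unfolding dist_norm using K(1)
    by (intro norm_blinfun_bound) (auto simp: blinfun.diff_left M_diff)
qed (use K(1) in simp)

lemma M_shift: "norm X \<le> R \<Longrightarrow> M (shift q X) (shift q V) = shift q (M X V)"
  by (rule bcontfun_eqI) (simp add: M_apply DG_apply shift_apply nv_shift shift_invariant_shift[OF L_shift])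

lemma Fc_taylor:
  assumes "norm X \<le> R" "norm Y \<le> R"
  shows "norm (Fc Y - Fc X - M X (Y - X)) \<le> K * norm (Y - X) * norm (Y - X)"
proof (rule norm_bound)
  fix k
  have "(Fc Y - Fc X - M X (Y - X)) k = g (nv Y k) - g (nv X k) - g' (nv X k) (nv Y k - nv X k)"
    using assms by (simp add: Fc_def M_apply DG_apply Gc_apply gc_eq nv_in_B blinfun.diff_right nv_linear)
  also have "norm \<dots> \<le> KG * norm (nv (Y - X) k) * norm (nv (Y - X) k)"
    unfolding nv_linear by (intro g_taylor nv_in_B assms)
  also have "\<dots> \<le> KG * (KN * norm (Y - X)) * (KN * norm (Y - X))"
    using KN(1) KG(1) by (intro mult_mono KN) auto
  also have "\<dots> = (KG * KN * KN) * (norm (Y - X) * norm (Y - X))" by simp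
  also have "\<dots> \<le> K * (norm (Y - X) * norm (Y - X))" by (intro mult_right_mono K) auto
  finally show "norm ((Fc Y - Fc X - M X (Y - X)) k) \<le> K * norm (Y - X) * norm (Y - X)"
    by (simp add: mult.assoc)
qed

lemma Fc_interaction:
  assumes "norm X \<le> R" "norm Y \<le> R" "norm (X + Y) \<le> R"
  shows "norm ((Fc (X + Y) - Fc X - Fc Y) k) \<le> KG * norm (nv X k) * norm (nv Y k)"
proof -
  have "(Fc (X + Y) - Fc X - Fc Y) k = g (nv X k + nv Y k) - g (nv X k) - g (nv Y k)"
    using assms by (simp add: Fc_def Gc_apply gc_eq nv_in_B blinfun.add_right flip: nv_linear)
  also have "norm \<dots> \<le> KG * norm (nv X k) * norm (nv Y k)"
    using nv_in_B[OF assms(3), of k] by (intro g_interaction nv_in_B assms) (simp add: nv_linear)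
  finally show ?thesis .
qed

text \<open>Differentiability in the supremum norm rests on the uniform quadratic remainder of
  \<open>Fc_taylor\<close>. The strict inequality leaves a neighbourhood of \<open>X\<close> inside
  the ball where the cut-off is invisible.\<close>

lemma has_derivative_nonlinearity:
  assumes X: "norm X < R"
  shows "(nonlinearity g N has_derivative DG X) (at X)"
  unfolding has_derivative_iff_norm
proof
  show "bounded_linear (DG X)" using X by (simp add: bounded_linear_DG)
  have ev: "\<forall>\<^sub>F Y in at X. norm Y < R"
  proof (rule eventually_at_topological[THEN iffD2])
    show "\<exists>S. open S \<and> X \<in> S \<and> (\<forall>Y\<in>S. Y \<noteq> X \<longrightarrow> Y \<in> UNIV \<longrightarrow> norm Y < R)"
      using X by (intro exI[of _ "ball 0 R"]) auto
  qed
  show "((\<lambda>Y. norm (nonlinearity g N Y - nonlinearity g N X - DG X (Y - X)) / norm (Y - X)) \<longlongrightarrow> 0) (at X)"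
  proof (rule tendsto_sandwich[OF _ _ tendsto_const])
    show "\<forall>\<^sub>F Y in at X. norm (nonlinearity g N Y - nonlinearity g N X - DG X (Y - X)) / norm (Y - X) \<le> K * norm (Y - X)"
      using ev
    proof eventually_elim
      case (elim Y)
      have "nonlinearity g N Y - nonlinearity g N X - DG X (Y - X) = Fc Y - Fc X - M X (Y - X)"
        using elim X by (simp add: Fc_eq M_apply[of X "Y - X"] blinfun.diff_right[of L])
      then have "norm (nonlinearity g N Y - nonlinearity g N X - DG X (Y - X)) \<le> K * norm (Y - X) * norm (Y - X)"
        using Fc_taylor[of X Y] elim X by simp
      then show ?case using K(1) by (cases "Y = X") (auto simp: divide_le_eq)
    qed
    show "((\<lambda>Y. K * norm (Y - X)) \<longlongrightarrow> 0) (at X)"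
      by (auto intro!: tendsto_eq_intros)
  qed (simp add: always_eventually)
qed

lemma linearization_eq:
  assumes "norm (translate \<phi> (c * t)) < R"
  shows "linearization L (nonlinearity g N) \<phi> c t = M (translate \<phi> (c * t))"
  using frechet_derivative_at[OF has_derivative_nonlinearity[OF assms]] assms
  by (auto simp: linearization_def M_apply fun_eq_iff)

end

section \<open>The linearized evolution\<close>

lemma wbd_wt_nonneg: "wbd (wt s y) c V \<Longrightarrow> c \<ge> 0"
  by (rule wbd_nonneg[OF wt_nonneg])

context lattice_eq
begin

definition path_in :: "(real \<Rightarrow> 'n bseq) \<Rightarrow> bool" where
  "path_in \<Psi> \<longleftrightarrow> continuous_on UNIV \<Psi> \<and> (\<forall>t. norm (\<Psi> t) \<le> R)"

text \<open>The solution is chosen on the whole line, but uniqueness is derived forward in time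
  only; hence the assumptions on nonnegative times in what follows.\<close>

definition flow :: "(real \<Rightarrow> 'n bseq) \<Rightarrow> 'n bseq \<Rightarrow> real \<Rightarrow> 'n bseq" where
  "flow \<Psi> V = (SOME Y. (\<forall>t. (Y has_vector_derivative M (\<Psi> t) (Y t)) (at t)) \<and> Y 0 = V)"

lemma path_norm: "path_in \<Psi> \<Longrightarrow> norm (\<Psi> t) \<le> R"
  by (simp add: path_in_def)

lemma path_shift_time: "path_in \<Psi> \<Longrightarrow> path_in (\<lambda>r. \<Psi> (s + r))"
  unfolding path_in_def by (auto intro!: continuous_on_compose2[of UNIV \<Psi>] continuous_intros)

lemma path_shift: "path_in \<Psi> \<Longrightarrow> path_in (\<lambda>r. shift q (\<Psi> r))"
  unfolding path_in_def
  by (auto intro!: bounded_linear.continuous_on[OF bounded_linear_shift])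

lemma path_zero: "path_in (\<lambda>_. 0)"
  using R_pos by (simp add: path_in_def)

lemma path_M_lipschitz: "path_in \<Psi> \<Longrightarrow> norm (M (\<Psi> t) x - M (\<Psi> t) y) \<le> K * norm (x - y)"
  using norm_M_apply[OF path_norm, of \<Psi> t "x - y"] by (simp add: blinfun.diff_right)

lemma path_M_continuous:
  assumes "path_in \<Psi>" "continuous_on UNIV y"
  shows "continuous_on UNIV (\<lambda>t. M (\<Psi> t) (y t))"
proof -
  have "continuous_on UNIV (\<lambda>t. M (\<Psi> t))"
    by (rule continuous_on_compose2[OF continuous_on_M]) (use assms in \<open>auto simp: path_in_def\<close>)
  then show ?thesis using assms by (intro continuous_intros)
qed

lemma flow_ex:
  assumes "path_in \<Psi>"
  shows "\<exists>Y. (\<forall>t. (Y has_vector_derivative M (\<Psi> t) (Y t)) (at t)) \<and> Y 0 = V"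
  using picard[of "\<lambda>t. M (\<Psi> t)" K "\<lambda>_. UNIV" V] path_M_lipschitz[OF assms] path_M_continuous[OF assms]
  by (auto simp: blinfun.zero_right)

lemma flow_deriv: "path_in \<Psi> \<Longrightarrow> (flow \<Psi> V has_vector_derivative M (\<Psi> t) (flow \<Psi> V t)) (at t within A)"
  and flow_0 [simp]: "path_in \<Psi> \<Longrightarrow> flow \<Psi> V 0 = V"
  using someI_ex[OF flow_ex[of \<Psi> V]] unfolding flow_def[symmetric]
  by (auto intro: has_vector_derivative_at_within)

lemma flow_unique:
  assumes \<Psi>: "path_in \<Psi>" and T: "T \<ge> 0"
    and Y: "\<And>t. t \<in> {0..T} \<Longrightarrow> (Y has_vector_derivative M (\<Psi> t) (Y t)) (at t within {0..T})"
  shows "flow \<Psi> (Y 0) T = Y T"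
  by (rule ode_unique[OF T, where F = "\<lambda>t. M (\<Psi> t)" and K = K])
    (use K(1) in \<open>auto intro: flow_deriv Y path_M_lipschitz \<Psi> simp: \<Psi>\<close>)

lemma flow_add:
  assumes \<Psi>: "path_in \<Psi>" and T: "T \<ge> 0"
  shows "flow \<Psi> (U + V) T = flow \<Psi> U T + flow \<Psi> V T"
  using flow_unique[OF \<Psi> T, of "\<lambda>t. flow \<Psi> U t + flow \<Psi> V t"] \<Psi>
  by (auto intro!: derivative_eq_intros flow_deriv simp: blinfun.add_right)

lemma flow_scaleR:
  assumes \<Psi>: "path_in \<Psi>" and T: "T \<ge> 0"
  shows "flow \<Psi> (r *\<^sub>R V) T = r *\<^sub>R flow \<Psi> V T"
proof -
  have "((\<lambda>t. r *\<^sub>R flow \<Psi> V t) has_vector_derivative M (\<Psi> t) (r *\<^sub>R flow \<Psi> V t)) (at t within {0..T})" for t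
    unfolding blinfun.scaleR_right
    by (rule bounded_linear.has_vector_derivative[OF bounded_linear_scaleR_right flow_deriv[OF \<Psi>]])
  then show ?thesis using flow_unique[OF \<Psi> T, of "\<lambda>t. r *\<^sub>R flow \<Psi> V t"] \<Psi> by simp
qed

lemma norm_flow:
  assumes \<Psi>: "path_in \<Psi>" and T: "T \<ge> 0"
  shows "norm (flow \<Psi> V T) \<le> exp (K * T) * norm V"
  using gronwall[OF T, of K 0 "flow \<Psi> V" "\<lambda>t. M (\<Psi> t) (flow \<Psi> V t)"] K(1) \<Psi>
  by (auto simp: flow_deriv norm_M_apply path_norm mult.commute)

lemma flow_wbd:
  assumes \<Psi>: "path_in \<Psi>" and T: "T \<ge> 0" and s: "s \<in> {b, - b}" and V: "wbd (wt s y) c V"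
  shows "wbd (wt s y) (c * exp (K * T)) (flow \<Psi> V T)"
proof (rule solution_wbd[where F = "\<lambda>t. M (\<Psi> t)" and K = K])
  show "wbd (wt s y) c (flow \<Psi> V 0)" using V \<Psi> by simp
qed (use K(1) T \<Psi> in \<open>auto intro: path_M_lipschitz path_M_continuous wt_nonneg flow_deriv
    M_wbd[OF path_norm s] simp: blinfun.zero_right\<close>)

lemma flow_cocycle:
  assumes \<Psi>: "path_in \<Psi>" and s: "s \<ge> 0" and t: "t \<ge> 0"
  shows "flow \<Psi> V (s + t) = flow (\<lambda>r. \<Psi> (s + r)) (flow \<Psi> V s) t"
proof -
  have "((\<lambda>r. flow \<Psi> V (s + r)) has_vector_derivative M (\<Psi> (s + r)) (flow \<Psi> V (s + r))) (at r within {0..t})" for r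
    proof -
      have "((\<lambda>r. s + r) has_vector_derivative 1) (at r)" by (auto intro!: derivative_eq_intros)
      from vector_diff_chain_at[OF this flow_deriv[OF \<Psi>]] show ?thesis
        by (simp add: o_def has_vector_derivative_at_within)
    qed
  from flow_unique[OF path_shift_time[OF \<Psi>] t this] show ?thesis by simp
qed

lemma flow_shift:
  assumes \<Psi>: "path_in \<Psi>" and t: "t \<ge> 0"
  shows "flow (\<lambda>r. shift q (\<Psi> r)) (shift q V) t = shift q (flow \<Psi> V t)"
proof -
  have "((\<lambda>r. shift q (flow \<Psi> V r)) has_vector_derivative
      M (shift q (\<Psi> r)) (shift q (flow \<Psi> V r))) (at r within {0..t})" for r
    unfolding M_shift[OF path_norm[OF \<Psi>]]
    by (rule bounded_linear.has_vector_derivative[OF bounded_linear_shift flow_deriv[OF \<Psi>]])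
  from flow_unique[OF path_shift[OF \<Psi>] t this] \<Psi> show ?thesis by simp
qed

lemma flow_compare:
  assumes \<Psi>: "path_in \<Psi>" "path_in \<Psi>'" and T: "T \<ge> 0" and e: "e \<ge> 0"
    and bnd: "\<And>t. t \<in> {0..T} \<Longrightarrow> norm (M (\<Psi> t) (flow \<Psi>' V t) - M (\<Psi>' t) (flow \<Psi>' V t)) \<le> e"
  shows "norm (flow \<Psi> V T - flow \<Psi>' V T) \<le> e * T * exp (K * T)"
proof -
  have "norm (flow \<Psi> V T - flow \<Psi>' V T) \<le> (norm (flow \<Psi> V 0 - flow \<Psi>' V 0) + e * T) * exp (K * T)"
  proof (rule gronwall[OF T _ e, where Y' = "\<lambda>t. M (\<Psi> t) (flow \<Psi> V t) - M (\<Psi>' t) (flow \<Psi>' V t)"])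
    fix t assume t: "t \<in> {0..T}"
    have "M (\<Psi> t) (flow \<Psi> V t) - M (\<Psi>' t) (flow \<Psi>' V t) = M (\<Psi> t) (flow \<Psi> V t - flow \<Psi>' V t) +
        (M (\<Psi> t) (flow \<Psi>' V t) - M (\<Psi>' t) (flow \<Psi>' V t))"
      by (simp add: blinfun.diff_right)
    also have "norm \<dots> \<le> K * norm (flow \<Psi> V t - flow \<Psi>' V t) + e"
      by (intro order_trans[OF norm_triangle_ineq] add_mono norm_M_apply path_norm \<Psi> bnd t)
    finally show "norm (M (\<Psi> t) (flow \<Psi> V t) - M (\<Psi>' t) (flow \<Psi>' V t)) \<le> K * norm (flow \<Psi> V t - flow \<Psi>' V t) + e" .
  qed (use K(1) \<Psi> in \<open>auto intro!: derivative_intros flow_deriv\<close>)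
  then show ?thesis using \<Psi> by simp
qed

lemma M_diff_if_wbd:
  assumes XY: "norm X \<le> R" "norm Y \<le> R" and s: "s \<in> {b, - b}"
    and X: "wbd (wt s y) c (X - Y)" and V: "wbd (wt (- s) y') d V"
  shows "norm (M X V - M Y V) \<le> K * c * d * exp (- s * (y' - y))"
proof (rule norm_bound)
  fix k
  have cd: "c \<ge> 0" "d \<ge> 0" using wbd_wt_nonneg X V by blast+
  have s': "- s \<in> {b, - b}" using s by auto
  have "norm ((M X V - M Y V) k) \<le> KG * (norm (nv (X - Y) k) * norm (nv V k))"
    using M_diff_pointwise[OF XY, of V k] by (simp add: mult.assoc)
  also have "\<dots> \<le> KG * ((KN * c) * (KN * d) * exp (- s * (y' - y)))"
    by (intro mult_left_mono KG mult_le_if_weights[of s y k _ _ y'] KN(4) X V s s') auto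
  also have "\<dots> = KG * KN * KN * (c * d * exp (- s * (y' - y)))" by simp
  also have "\<dots> \<le> K * (c * d * exp (- s * (y' - y)))" using cd by (intro mult_right_mono K) auto
  finally show "norm ((M X V - M Y V) k) \<le> K * c * d * exp (- s * (y' - y))" by (simp add: mult_ac)
qed

text \<open>The data keeps its weighted bound up to exponential growth in time, and the difference
  of the two generators carries the opposite weight. So the product of the weights makes the forcing
  of the difference small, and Gronwall adds the factor \<open>T * exp (K * T)\<close>.\<close>

lemma flow_compare_wbd:
  assumes \<Psi>: "path_in \<Psi>" "path_in \<Psi>'" and T: "T \<ge> 0" and s: "s \<in> {b, - b}"
    and diff: "\<And>t. t \<in> {0..T} \<Longrightarrow> wbd (wt s y) c (\<Psi> t - \<Psi>' t)" and V: "wbd (wt (- s) y') d V"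
  shows "norm (flow \<Psi> V T - flow \<Psi>' V T) \<le> K * T * exp (2 * K * T) * c * d * exp (- s * (y' - y))"
proof -
  have cd: "c \<ge> 0" "d \<ge> 0" using wbd_wt_nonneg diff[of 0] T V by auto
  have "norm (flow \<Psi> V T - flow \<Psi>' V T) \<le>
      (K * c * (d * exp (K * T)) * exp (- s * (y' - y))) * T * exp (K * T)"
  proof (rule flow_compare[OF \<Psi> T])
    fix t assume t: "t \<in> {0..T}"
    have "wbd (wt (- s) y') (d * exp (K * t)) (flow \<Psi>' V t)"
      by (rule flow_wbd) (use \<Psi> t s V in auto)
    then have V': "wbd (wt (- s) y') (d * exp (K * T)) (flow \<Psi>' V t)"
      by (rule wbd_mono) (use t cd K(1) in \<open>auto intro: mult_left_mono\<close>)
    show "norm (M (\<Psi> t) (flow \<Psi>' V t) - M (\<Psi>' t) (flow \<Psi>' V t)) \<le>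
        K * c * (d * exp (K * T)) * exp (- s * (y' - y))"
      by (rule M_diff_if_wbd[OF _ _ s diff[OF t] V']) (use \<Psi> path_norm in auto)
  qed (use K(1) cd in auto)
  also have "\<dots> = K * T * (exp (K * T) * exp (K * T)) * c * d * exp (- s * (y' - y))" by simp
  also have "exp (K * T) * exp (K * T) = exp (2 * K * T)" by (simp flip: exp_add)
  finally show ?thesis .
qed

section \<open>Solutions of the truncated equation and its linearization\<close>

lemma Fc_solution_ex: "\<exists>Y. (\<forall>t. (Y has_vector_derivative Fc (Y t)) (at t)) \<and> Y 0 = V"
proof -
  have "continuous_on UNIV Fc"
    using K(1) by (intro lipschitz_on_continuous_on[of K] lipschitz_onI) (auto simp: dist_norm Fc_lipschitz)
  then have "continuous_on UNIV (\<lambda>t. Fc (y t))" if "continuous_on UNIV y" for y :: "real \<Rightarrow> 'n bseq"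
    by (rule continuous_on_compose2) (use that in auto)
  then show ?thesis using picard[of "\<lambda>_. Fc" K "\<lambda>_. UNIV" V] by (auto simp: Fc_lipschitz Fc_0)
qed

lemma Fc_solution_wbd:
  assumes T: "T \<ge> 0" and s: "s \<in> {b, - b}"
    and Y: "\<And>t. t \<in> {0..T} \<Longrightarrow> (Y has_vector_derivative Fc (Y t)) (at t within {0..T})"
    and init: "wbd (wt s y) c (Y 0)"
  shows "wbd (wt s y) (c * exp (K * T)) (Y T)"
proof (rule solution_wbd[where F = "\<lambda>_. Fc" and K = K])
  have "continuous_on UNIV Fc"
    using K(1) by (intro lipschitz_on_continuous_on[of K] lipschitz_onI) (auto simp: dist_norm Fc_lipschitz)
  then show "continuous_on UNIV (\<lambda>t. Fc (y t))" if "continuous_on UNIV y" for y :: "real \<Rightarrow> 'n bseq"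
    by (rule continuous_on_compose2) (use that in auto)
qed (use K(1) assms in \<open>auto simp: Fc_lipschitz Fc_0 wt_nonneg intro: Fc_wbd\<close>)

lemma has_derivative_Fc:
  assumes "norm X < R"
  shows "(Fc has_derivative blinfun_apply (M X)) (at X)"
proof -
  have "((\<lambda>Y. L Y + nonlinearity g N Y) has_derivative (\<lambda>Y. L Y + DG X Y)) (at X)"
    by (intro has_derivative_add bounded_linear_imp_has_derivative[OF blinfun.bounded_linear_right]
        has_derivative_nonlinearity assms)
  then have "(Fc has_derivative (\<lambda>Y. L Y + DG X Y)) (at X)"
    by (rule has_derivative_transform_within_open[of _ _ _ _ "ball 0 R"]) (use assms in \<open>auto simp: Fc_eq\<close>)
  then show ?thesis by (rule has_derivative_eq_rhs) (use assms in \<open>auto simp: fun_eq_iff M_apply\<close>)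
qed

lemma solution_map_linearization:
  assumes path: "path_in (\<lambda>t. translate \<phi> (c * t))" and lt: "\<And>t. norm (translate \<phi> (c * t)) < R" and T: "T \<ge> 0"
  shows "solution_map (linearization L (nonlinearity g N) \<phi> c) T 0 V = flow (\<lambda>t. translate \<phi> (c * t)) V T"
  unfolding solution_map_def
proof (rule the_equality)
  show "\<exists>Y. solves (linearization L (nonlinearity g N) \<phi> c) UNIV Y \<and> Y 0 = V \<and> Y T = flow (\<lambda>t. translate \<phi> (c * t)) V T"
    by (intro exI[of _ "flow (\<lambda>t. translate \<phi> (c * t)) V"])
      (auto simp: solves_def linearization_eq[OF lt] path intro!: flow_deriv[OF path])
  fix Y1 assume "\<exists>Y. solves (linearization L (nonlinearity g N) \<phi> c) UNIV Y \<and> Y 0 = V \<and> Y T = Y1"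
  then obtain Y where Y: "solves (linearization L (nonlinearity g N) \<phi> c) UNIV Y" "Y 0 = V" "Y T = Y1" by blast
  have "flow (\<lambda>t. translate \<phi> (c * t)) (Y 0) T = Y T"
    by (rule flow_unique[OF path T])
      (use Y in \<open>auto simp: solves_def linearization_eq[OF lt] intro: has_vector_derivative_at_within\<close>)
  then show "Y1 = flow (\<lambda>t. translate \<phi> (c * t)) V T" using Y by simp
qed

end

section \<open>A single traveling wave\<close>

lemma traveling_wave_bounded:
  assumes "traveling_wave F \<phi> c \<alpha> \<omega>"
  shows "bounded (range \<phi>)"
proof -
  have cont: "continuous_on UNIV \<phi>" and lim: "(\<phi> \<longlongrightarrow> \<alpha>) at_bot" "(\<phi> \<longlongrightarrow> \<omega>) at_top"
    using assms by (auto simp: traveling_wave_def)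
  obtain a where a: "\<And>x. x \<le> a \<Longrightarrow> dist (\<phi> x) \<alpha> < 1"
    using tendstoD[OF lim(1) zero_less_one] by (auto simp: eventually_at_bot_linorder)
  obtain d where d: "\<And>x. x \<ge> d \<Longrightarrow> dist (\<phi> x) \<omega> < 1"
    using tendstoD[OF lim(2) zero_less_one] by (auto simp: eventually_at_top_linorder)
  have "bounded (\<phi> ` {a..d})"
    by (intro compact_imp_bounded compact_continuous_image continuous_on_subset[OF cont]) auto
  then have "bounded (ball \<alpha> 1 \<union> \<phi> ` {a..d} \<union> ball \<omega> 1)" by simp
  moreover have "range \<phi> \<subseteq> ball \<alpha> 1 \<union> \<phi> ` {a..d} \<union> ball \<omega> 1"
  proof
    fix z assume "z \<in> range \<phi>"
    then obtain x where "z = \<phi> x" by blast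
    then show "z \<in> ball \<alpha> 1 \<union> \<phi> ` {a..d} \<union> ball \<omega> 1"
      using a[of x] d[of x] by (cases "x \<le> a"; cases "x \<ge> d") (auto simp: dist_commute)
  qed
  ultimately show ?thesis by (rule bounded_subset)
qed

lemma translate_shift:
  assumes "bounded (range \<phi>)" shows "translate \<phi> (y + of_int k) = shift k (translate \<phi> y)"
  by (rule bcontfun_eqI) (simp add: translate_apply assms shift_apply algebra_simps)

text \<open>A wave of speed \<open>c\<close> starting at the integer phase \<open>q\<close> reaches
  phase \<open>y\<close> within one period, forward in time. This forces the floor of
  \<open>y\<close> for positive \<open>c\<close> and the ceiling for negative
  \<open>c\<close>.\<close>

lemma int_phase:
  fixes c y :: real
  assumes "c \<noteq> 0"
  shows "\<exists>q :: int. 0 \<le> (y - of_int q) / c \<and> (y - of_int q) / c \<le> 1 / \<bar>c\<bar> \<and> \<bar>y - of_int q\<bar> \<le> 1"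
proof (cases "c > 0")
  case True
  have "0 \<le> y - of_int \<lfloor>y\<rfloor>" "y - of_int \<lfloor>y\<rfloor> \<le> 1" by linarith+
  then show ?thesis using True by (intro exI[of _ "\<lfloor>y\<rfloor>"]) (auto simp: divide_right_mono)
next
  case False
  have "y - of_int \<lceil>y\<rceil> \<le> 0" "- 1 \<le> y - of_int \<lceil>y\<rceil>" by linarith+
  then show ?thesis using False assms
    by (intro exI[of _ "\<lceil>y\<rceil>"]) (auto simp: divide_le_eq zero_le_divide_iff)
qed

lemma vector_derivative_bound_segment:
  fixes f :: "real \<Rightarrow> 'a::real_normed_vector"
  assumes "\<And>u. u \<in> closed_segment x y \<Longrightarrow> (f has_vector_derivative f' u) (at u)"
    and "\<And>u. u \<in> closed_segment x y \<Longrightarrow> norm (f' u) \<le> B"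
  shows "norm (f y - f x) \<le> B * \<bar>y - x\<bar>"
proof -
  have "norm (f y - f x) \<le> B * norm (y - x)"
  proof (rule differentiable_bound[where S = "closed_segment x y" and f' = "\<lambda>u h. h *\<^sub>R f' u"])
    fix u assume u: "u \<in> closed_segment x y"
    show "(f has_derivative (\<lambda>h. h *\<^sub>R f' u)) (at u within closed_segment x y)"
      using assms(1)[OF u] by (simp add: has_vector_derivative_def has_derivative_at_withinI)
    show "onorm (\<lambda>h. h *\<^sub>R f' u) \<le> B"
      using assms(2)[OF u] by (intro onorm_le) (simp add: mult.commute[of B] mult_left_mono)
  qed auto
  then show ?thesis by simp
qed

text \<open>
  The sign \<open>\<sigma>\<close> is \<open>1\<close> for a wave in \<open>X\<^sub>b\<close>, which decays to its right, and \<open>- 1\<close> for a wave in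
  \<open>X\<^sub>-\<^sub>b\<close>, which decays to its left. The words ahead and behind refer to this direction, not to the
  sign of the speed.
\<close>

locale wave = lattice_eq L N g g' b R
  for L :: "'n::finite bseq \<Rightarrow>\<^sub>L 'n bseq"
    and N :: "'m::finite \<Rightarrow> 'n bseq \<Rightarrow>\<^sub>L 'n bseq"
    and g :: "real ^ 'n ^ 'm \<Rightarrow> real ^ 'n"
    and g' :: "real ^ 'n ^ 'm \<Rightarrow> ((real ^ 'n ^ 'm) \<Rightarrow>\<^sub>L (real ^ 'n))"
    and b R :: real +
  fixes \<phi> \<phi>' :: "real \<Rightarrow> real ^ 'n" and c :: real and \<alpha> \<omega> :: "real ^ 'n" and \<sigma> :: int
  assumes wave: "traveling_wave (\<lambda>X. L X + nonlinearity g N X) \<phi> c \<alpha> \<omega>"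
    and c_nonzero: "c \<noteq> 0" and \<sigma>: "\<sigma> \<in> {1, - 1}"
    and \<phi>_weighted: "sampled_in_wspace \<phi> (of_int \<sigma> * b)"
    and \<phi>_deriv: "\<And>x. (\<phi> has_vector_derivative \<phi>' x) (at x)"
    and norm_translate: "\<And>y. norm (translate \<phi> y) < R"
    and simple: "simple_eigenvalue (of_int \<sigma> * b) (period_map L (nonlinearity g N) \<phi> c) 1 (translate \<phi>' 0)"
    and spec: "spectrum (of_int \<sigma> * b) (period_map L (nonlinearity g N) \<phi> c) - {1} \<subseteq> ball 0 1"
begin

definition "s = of_int \<sigma> * b"

lemma s_in: "s \<in> {b, - b}" "- s \<in> {b, - b}" "\<bar>s\<bar> = b"
  using \<sigma> b_pos by (auto simp: s_def)

abbreviation "W \<equiv> translate \<phi>"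
abbreviation "W' \<equiv> translate \<phi>'"

lemma bounded_\<phi>: "bounded (range \<phi>)"
  by (rule traveling_wave_bounded[OF wave])

lemma norm_W: "norm (W y) \<le> R"
  using norm_translate[of y] by simp

lemma W_int: "W (y + of_int k) = shift k (W y)"
  by (rule translate_shift[OF bounded_\<phi>])

lemma W_solution: "((\<lambda>t. W (c * t)) has_vector_derivative Fc (W (c * t))) (at t)"
  using wave by (auto simp: traveling_wave_def solves_def Fc_eq norm_W)

text \<open>At a fixed site the time derivative of the wave is computed twice, from the equation and
  from the profile. Expressing \<open>\<phi>'\<close> by the vector field yields its boundedness,
  Lipschitz continuity and weighted decay at every real phase.\<close>

lemma \<phi>'_eq: "\<phi>' (of_int j - y) = (- 1 / c) *\<^sub>R Fc (W y) j"
proof -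
  define t where "t = y / c"
  have y: "y = c * t" using c_nonzero by (simp add: t_def)
  have "((\<lambda>t. W (c * t) j) has_vector_derivative Fc (W (c * t)) j) (at t)"
    by (rule bounded_linear.has_vector_derivative[OF bounded_linear_bcontfun_apply W_solution])
  moreover have "((\<lambda>t. of_int j - c * t) has_vector_derivative - c) (at t)"
    by (auto intro!: derivative_eq_intros)
  from vector_diff_chain_at[OF this \<phi>_deriv] have "((\<lambda>t. W (c * t) j) has_vector_derivative (- c) *\<^sub>R \<phi>' (of_int j - c * t)) (at t)"
    by (simp add: o_def translate_apply[OF bounded_\<phi>])
  ultimately have "Fc (W (c * t)) j = (- c) *\<^sub>R \<phi>' (of_int j - c * t)"
    by (rule vector_derivative_unique_at)
  then show ?thesis using c_nonzero by (simp add: y)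
qed

lemma norm_Fc: "norm X \<le> R \<Longrightarrow> norm (Fc X) \<le> K * R"
  using order_trans[OF Fc_lipschitz[of X 0] mult_left_mono[of "norm (X - 0)" R K]] K(1) by (simp add: Fc_0)

lemma bounded_\<phi>': "bounded (range \<phi>')"
proof (rule boundedI)
  fix z assume "z \<in> range \<phi>'"
  then obtain x where z: "z = \<phi>' x" by blast
  have "norm (Fc (W (- x)) 0) \<le> K * R"
    by (rule order_trans[OF norm_bounded norm_Fc[OF norm_W]])
  then have "norm (Fc (W (- x)) 0) / \<bar>c\<bar> \<le> K * R / \<bar>c\<bar>" by (rule divide_right_mono) simp
  then show "norm z \<le> K * R / \<bar>c\<bar>" using \<phi>'_eq[of 0 "- x"] by (simp add: z)
qed

lemma W'_eq: "W' y = (- 1 / c) *\<^sub>R Fc (W y)"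
  by (rule bcontfun_eqI) (simp add: translate_apply[OF bounded_\<phi>'] \<phi>'_eq)

lemma W'_int: "W' (y + of_int k) = shift k (W' y)"
  by (rule translate_shift[OF bounded_\<phi>'])

text \<open>The sum of Lipschitz constants of \<open>W'\<close> and of \<open>W\<close>, so that one
  constant serves both.\<close>

definition "CW = K * (K * R / \<bar>c\<bar>) / \<bar>c\<bar> + K * R / \<bar>c\<bar>"

lemma CW_pos: "CW > 0"
  using K(1) R_pos c_nonzero by (auto simp: CW_def intro!: add_nonneg_pos)

lemma norm_W': "norm (W' y) \<le> K * R / \<bar>c\<bar>" "norm (W' y) \<le> CW"
proof -
  have "norm (Fc (W y)) \<le> K * R" by (rule norm_Fc[OF norm_W])
  then have "norm (Fc (W y)) / \<bar>c\<bar> \<le> K * R / \<bar>c\<bar>" by (rule divide_right_mono) simp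
  then show *: "norm (W' y) \<le> K * R / \<bar>c\<bar>" by (simp add: W'_eq)
  then show "norm (W' y) \<le> CW" using K(1) R_pos by (simp add: CW_def add_nonneg_nonneg add_increasing)
qed

lemma W_deriv: "(W has_vector_derivative - W' y) (at y)"
proof -
  have "((\<lambda>y. y / c) has_vector_derivative 1 / c) (at y)"
    unfolding has_real_derivative_iff_has_vector_derivative[symmetric]
    using c_nonzero by (auto intro!: derivative_eq_intros)
  from vector_diff_chain_at[OF this W_solution] show ?thesis
    using c_nonzero by (simp add: o_def W'_eq)
qed

lemma W_affine_deriv: "((\<lambda>t. W (y + c * t)) has_vector_derivative Fc (W (y + c * t))) (at t)"
proof -
  have "((\<lambda>t. y + c * t) has_vector_derivative c) (at t)" by (auto intro!: derivative_eq_intros)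
  from vector_diff_chain_at[OF this W_deriv] show ?thesis
    using c_nonzero by (simp add: o_def W'_eq)
qed

lemma W_lipschitz: "norm (W y - W z) \<le> CW * \<bar>y - z\<bar>"
  by (rule vector_derivative_bound_segment[where f' = "\<lambda>y. - W' y"]) (use W_deriv norm_W'(2) in auto)

lemma W'_lipschitz: "norm (W' y - W' z) \<le> CW * \<bar>y - z\<bar>"
proof -
  have lip: "norm (W y - W z) \<le> (K * R / \<bar>c\<bar>) * \<bar>y - z\<bar>"
    by (rule vector_derivative_bound_segment[where f' = "\<lambda>y. - W' y"]) (use W_deriv norm_W'(1) in auto)
  have "norm (W' y - W' z) = norm (Fc (W y) - Fc (W z)) / \<bar>c\<bar>"
    unfolding W'_eq scaleR_diff_right[symmetric] by simp
  also have "\<dots> \<le> K * norm (W y - W z) / \<bar>c\<bar>" by (intro divide_right_mono Fc_lipschitz) auto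
  also have "\<dots> \<le> K * ((K * R / \<bar>c\<bar>) * \<bar>y - z\<bar>) / \<bar>c\<bar>"
    using K(1) by (intro divide_right_mono mult_left_mono lip) auto
  also have "\<dots> = (K * (K * R / \<bar>c\<bar>) / \<bar>c\<bar>) * \<bar>y - z\<bar>" by simp
  also have "\<dots> \<le> CW * \<bar>y - z\<bar>" unfolding CW_def using K(1) R_pos by (intro mult_right_mono) auto
  finally show ?thesis .
qed

text \<open>The plus sign is due to \<open>W y\<close> being the profile at \<open>j - y\<close>,
  whose derivative in \<open>y\<close> is \<open>- W' y\<close>.\<close>

lemma W_taylor: "norm (W (y + \<gamma>) - W y + \<gamma> *\<^sub>R W' y) \<le> CW * \<gamma>\<^sup>2"
proof -
  define h where "h u = W u + (u - y) *\<^sub>R W' y" for u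
  have "norm (h (y + \<gamma>) - h y) \<le> CW * \<bar>\<gamma>\<bar> * \<bar>y + \<gamma> - y\<bar>"
  proof (rule vector_derivative_bound_segment)
    fix u assume u: "u \<in> closed_segment y (y + \<gamma>)"
    show "(h has_vector_derivative - W' u + W' y) (at u)"
      unfolding h_def by (auto intro!: derivative_eq_intros W_deriv)
    have "norm (- W' u + W' y) \<le> CW * \<bar>y - u\<bar>" using W'_lipschitz[of y u] by simp
    also have "\<dots> \<le> CW * \<bar>\<gamma>\<bar>"
      using segment_norm_le[OF u] CW_pos by (intro mult_left_mono) auto
    finally show "norm (- W' u + W' y) \<le> CW * \<bar>\<gamma>\<bar>" .
  qed
  then show ?thesis by (simp add: h_def power2_eq_square algebra_simps)
qed

lemma path_W: "path_in (\<lambda>r. W (y + c * r))"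
  unfolding path_in_def using norm_W
  by (auto intro!: continuous_at_imp_continuous_on has_vector_derivative_continuous[OF W_affine_deriv])

text \<open>Differentiating the nonlinear equation in time along the wave shows that the time
  derivative of the wave solves the linearized equation; \<open>W'\<close> is this derivative
  divided by \<open>- c\<close>.\<close>

lemma flow_W': "t \<ge> 0 \<Longrightarrow> flow (\<lambda>r. W (y + c * r)) (W' y) t = W' (y + c * t)"
proof -
  assume t: "t \<ge> 0"
  have "((\<lambda>t. W' (y + c * t)) has_vector_derivative M (W (y + c * t)) (W' (y + c * t))) (at t)" for t
  proof -
    have "((Fc \<circ> (\<lambda>t. W (y + c * t))) has_vector_derivative M (W (y + c * t)) (Fc (W (y + c * t)))) (at t)"
      by (rule vector_derivative_diff_chain_within[OF W_affine_deriv])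
        (rule has_derivative_at_withinI[OF has_derivative_Fc[OF norm_translate]])
    from bounded_linear.has_vector_derivative[OF bounded_linear_scaleR_right this, of "- 1 / c"]
    show ?thesis by (simp only: W'_eq o_def blinfun.scaleR_right)
  qed
  from flow_unique[OF path_W t has_vector_derivative_at_within[OF this]] show ?thesis by simp
qed

text \<open>The hypothesis controls the profile only at the integers, that is, at phase 0. Every
  other phase is reached by solving the equation for at most one period, which preserves weighted
  bounds, followed by an integer shift.\<close>

lemma W_wbd_ex: "\<exists>C. \<forall>y. wbd (wt s y) C (W y)"
proof -
  obtain X where X: "X \<in> wspace s" "\<And>j. X j = \<phi> (of_int j)"
    using \<phi>_weighted unfolding sampled_in_wspace_def s_def by blast
  then have "X = W 0" by (intro bcontfun_eqI) (simp add: translate_apply[OF bounded_\<phi>])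
  then obtain C where C: "wbd (wt s 0) C (W 0)" using X(1) wspace_iff by blast
  have C0: "C \<ge> 0" using wbd_wt_nonneg[OF C] .
  have "wbd (wt s y) (exp b * (C * exp (K * (1 / \<bar>c\<bar>)))) (W y)" for y
  proof -
    obtain q where q: "0 \<le> (y - of_int q) / c" "(y - of_int q) / c \<le> 1 / \<bar>c\<bar>" "\<bar>y - of_int q\<bar> \<le> 1"
      using int_phase[OF c_nonzero] by blast
    define t where "t = (y - of_int q) / c"
    have "wbd (wt s 0) (C * exp (K * t)) (W (c * t))"
      using Fc_solution_wbd[of t s "\<lambda>t. W (c * t)" 0 C] q s_in C W_solution
      by (auto simp: t_def has_vector_derivative_at_within)
    then have "wbd (wt s (of_int q)) (C * exp (K * t)) (W (c * t + of_int q))"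
      using wbd_shift[of s 0 q _ "W (c * t)"] by (simp add: W_int)
    moreover have "c * t + of_int q = y" using c_nonzero by (simp add: t_def)
    ultimately have "wbd (wt s y) (exp (\<bar>s\<bar> * \<bar>of_int q - y\<bar>) * (C * exp (K * t))) (W y)"
      using wbd_change[of s "of_int q" _ _ y] by metis
    then show ?thesis
    proof (rule wbd_mono)
      show "exp (\<bar>s\<bar> * \<bar>of_int q - y\<bar>) * (C * exp (K * t)) \<le> exp b * (C * exp (K * (1 / \<bar>c\<bar>)))"
        using q C0 K(1) b_pos s_in(3) mult_left_mono[OF q(2), of K]
        by (intro mult_mono) (auto simp: t_def abs_minus_commute intro!: mult_left_le mult_left_mono)
    qed
  qed
  then show ?thesis by blast
qed

definition "CX = (SOME C. \<forall>y. wbd (wt s y) C (W y))"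

lemma W_wbd: "wbd (wt s y) CX (W y)"
  using someI_ex[OF W_wbd_ex] unfolding CX_def[symmetric] by blast

lemma CX_nonneg: "CX \<ge> 0" using wbd_wt_nonneg[OF W_wbd] .

lemma W'_wbd: "wbd (wt s y) (K * CX / \<bar>c\<bar>) (W' y)"
  unfolding wbd_def
proof
  fix j
  have "wt s y j * norm (W' y j) = (wt s y j * norm (Fc (W y) j)) / \<bar>c\<bar>" by (simp add: W'_eq)
  also have "\<dots> \<le> K * CX / \<bar>c\<bar>"
    by (intro divide_right_mono wbd_D[OF Fc_wbd[OF s_in(1) W_wbd]]) auto
  finally show "wt s y j * norm (W' y j) \<le> K * CX / \<bar>c\<bar>" .
qed

abbreviation "\<Psi> \<equiv> \<lambda>r. W (c * r)"

lemma path_\<Psi>: "path_in \<Psi>" using path_W[of 0] by simp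

abbreviation "A \<equiv> period_map L (nonlinearity g N) \<phi> c"

definition "sg = (if c > 0 then 1 else - 1 :: int)"

definition "p = 1 / \<bar>c\<bar>"

lemma p_pos: "p > 0" using c_nonzero by (simp add: p_def)

lemma c_p: "c * p = of_int sg" using c_nonzero by (auto simp: p_def sg_def)

lemma A_eq: "A V = shift (- sg) (flow \<Psi> V p)"
  using solution_map_linearization[OF path_\<Psi> norm_translate, of p] p_pos
  by (simp add: period_map_def sg_def p_def)

lemma \<Psi>_periodic: "\<Psi> (of_nat n * p + r) = shift (sg * int n) (\<Psi> r)"
proof -
  have "c * (of_nat n * p + r) = c * r + of_nat n * (c * p)" by (simp only: distrib_left mult_ac add_ac)
  also have "of_nat n * (c * p) = of_int (sg * int n)" unfolding c_p by simp
  finally show ?thesis by (simp only: W_int)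
qed

lemma flow_\<Psi>_periodic:
  assumes "r \<ge> 0"
  shows "flow \<Psi> V (of_nat n * p + r) = shift (sg * int n) (flow \<Psi> (shift (- (sg * int n)) (flow \<Psi> V (of_nat n * p))) r)"
proof -
  have "flow \<Psi> V (of_nat n * p + r) = flow (\<lambda>r. \<Psi> (of_nat n * p + r)) (flow \<Psi> V (of_nat n * p)) r"
    by (rule flow_cocycle) (use path_\<Psi> p_pos assms in auto)
  also have "\<dots> = flow (\<lambda>r. shift (sg * int n) (\<Psi> r)) (shift (sg * int n) (shift (- (sg * int n)) (flow \<Psi> V (of_nat n * p)))) r"
    unfolding \<Psi>_periodic by (simp add: shift_shift)
  also have "\<dots> = shift (sg * int n) (flow \<Psi> (shift (- (sg * int n)) (flow \<Psi> V (of_nat n * p))) r)"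
    by (rule flow_shift[OF path_\<Psi> assms])
  finally show ?thesis .
qed

lemma A_pow: "(A ^^ n) V = shift (- (sg * int n)) (flow \<Psi> V (of_nat n * p))"
proof (induction n)
  case 0
  then show ?case using path_\<Psi> by simp
next
  case (Suc n)
  have "(A ^^ Suc n) V = shift (- sg) (flow \<Psi> (shift (- (sg * int n)) (flow \<Psi> V (of_nat n * p))) p)"
    by (simp add: Suc A_eq)
  also have "- sg = - (sg * int (Suc n)) + sg * int n" by (simp add: algebra_simps)
  also have "shift \<dots> (flow \<Psi> (shift (- (sg * int n)) (flow \<Psi> V (of_nat n * p))) p) =
      shift (- (sg * int (Suc n))) (flow \<Psi> V (of_nat n * p + p))"
    unfolding flow_\<Psi>_periodic[OF less_imp_le[OF p_pos]] shift_shift ..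
  also have "of_nat n * p + p = of_nat (Suc n) * p" by (simp add: algebra_simps)
  finally show ?case .
qed

end

section \<open>Decay in the weighted space\<close>

context wave
begin

text \<open>
  The maps \<open>unw\<close> and \<open>wgt\<close> identify the space of bounded sequences with \<open>X\<^sub>s\<close>; off \<open>X\<^sub>s\<close>, where
  the weighted sequence is unbounded, \<open>wgt\<close> has no meaning.
\<close>

definition "unw V = Bcontfun (\<lambda>j. (1 / wt s 0 j) *\<^sub>R V j)" for V :: "'n bseq"
definition "wgt X = Bcontfun (\<lambda>j. wt s 0 j *\<^sub>R X j)" for X :: "'n bseq"

lemma unw_apply: "unw V j = (1 / wt s 0 j) *\<^sub>R V j"
proof -
  have "norm ((1 / wt s 0 j) *\<^sub>R V j) \<le> norm V" for j
    using wt_ge_1[of s 0 j] mult_mono[of "1 / wt s 0 j" 1 "norm (V j)" "norm V"] by (simp add: norm_bounded)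
  then have "bounded (range (\<lambda>j. (1 / wt s 0 j) *\<^sub>R V j))" by (auto intro!: boundedI)
  then show ?thesis unfolding unw_def by (subst Bcontfun_inverse) (auto simp: int_bcontfun_iff)
qed

lemma wgt_apply:
  assumes "wbd (wt s 0) d X" shows "wgt X j = wt s 0 j *\<^sub>R X j"
proof -
  have "norm (wt s 0 j *\<^sub>R X j) \<le> d" for j
    using wbd_D[OF assms, of j] wt_nonneg[of s 0 j] by simp
  then have "bounded (range (\<lambda>j. wt s 0 j *\<^sub>R X j))" by (auto intro!: boundedI)
  then show ?thesis unfolding wgt_def by (subst Bcontfun_inverse) (auto simp: int_bcontfun_iff)
qed

lemma wbd_unw_iff: "wbd (wt s 0) d (unw V) \<longleftrightarrow> norm V \<le> d"
proof -
  have "wt s 0 j * norm (unw V j) = norm (V j)" for j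
    using wt_pos[of s 0 j] by (simp add: unw_apply)
  then show ?thesis unfolding wbd_def by (metis norm_bound norm_bounded order_trans)
qed

lemma wgt_unw: "wgt (unw V) = V"
  using wt_pos[of s 0] by (intro bcontfun_eqI) (simp add: wgt_apply[OF wbd_unw_iff[THEN iffD2, OF order_refl]] unw_apply less_imp_neq[symmetric])

lemma unw_wgt: "wbd (wt s 0) d X \<Longrightarrow> unw (wgt X) = X"
  using wt_pos[of s 0] by (intro bcontfun_eqI) (simp add: wgt_apply unw_apply less_imp_neq[symmetric])

lemma norm_wgt: "wbd (wt s 0) d X \<Longrightarrow> norm (wgt X) \<le> d"
  using wbd_unw_iff[of d "wgt X"] by (simp add: unw_wgt)

lemma unw_in: "unw V \<in> wspace s"
  using wbd_unw_iff[of "norm V" V] by (auto simp: wspace_iff)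

lemma wspace_unw: "X \<in> wspace s \<Longrightarrow> \<exists>V. X = unw V"
  by (metis wspace_iff unw_wgt)

lemma unw_inj: "unw U = unw V \<longleftrightarrow> U = V"
  by (metis wgt_unw)

lemma unw_linear: "unw (U + V) = unw U + unw V" "unw (U - V) = unw U - unw V" "unw (r *\<^sub>R V) = r *\<^sub>R unw V"
  by (auto intro!: bcontfun_eqI simp: unw_apply algebra_simps)

lemma wnorm_unw: "wnorm s (unw V) = norm V"
  using wnorm_le_iff[OF unw_in, of V] by (metis wbd_unw_iff order_antisym order_refl)

lemma A_linear: "A (U + V) = A U + A V" "A (r *\<^sub>R V) = r *\<^sub>R A V"
  using p_pos by (simp_all add: A_eq flow_add flow_scaleR path_\<Psi> shift_linear)

lemma A_wbd:
  assumes "wbd (wt s 0) d X"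
  shows "wbd (wt s 0) (exp b * (d * exp (K * p))) (A X)"
proof -
  have "wbd (wt s 0) (d * exp (K * p)) (flow \<Psi> X p)"
    by (rule flow_wbd[OF path_\<Psi> _ s_in(1) assms]) (use p_pos in simp)
  then have "wbd (wt s (0 + of_int (- sg))) (d * exp (K * p)) (A X)"
    unfolding A_eq wbd_shift .
  from wbd_change[OF this, of 0] show ?thesis using s_in(3) by (simp add: sg_def split: if_splits)
qed

text \<open>The period map transported to bounded sequences by \<open>unw\<close>, which is an
  isometry onto \<open>X_s\<close>; in this form it acts on a Banach space type, as
  \<open>spectral_decay\<close> requires.\<close>

definition "At V = wgt (A (unw V))"

lemma unw_At: "unw (At V) = A (unw V)"
  unfolding At_def by (rule unw_wgt[OF A_wbd[of "norm V"]]) (simp add: wbd_unw_iff)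

lemma unw_At_pow: "unw ((At ^^ k) V) = (A ^^ k) (unw V)"
  by (induction k) (simp_all add: unw_At)

lemma bounded_linear_At: "bounded_linear At"
proof (rule bounded_linear_intro)
  show "At (U + V) = At U + At V" for U V
    using unw_inj[of "At (U + V)" "At U + At V"] by (simp add: unw_At unw_linear A_linear)
  show "At (r *\<^sub>R V) = r *\<^sub>R At V" for r V
    using unw_inj[of "At (r *\<^sub>R V)" "r *\<^sub>R At V"] by (simp add: unw_At unw_linear A_linear)
  show "norm (At V) \<le> norm V * (exp b * exp (K * p))" for V
    using A_wbd[of "norm V" "unw V"] by (simp add: wbd_unw_iff mult_ac flip: unw_At)
qed

lemma At_resolvent:
  assumes z: "norm z \<ge> 1" "z \<noteq> 1"
  shows "surj (\<lambda>q. complex_scale z q - map_prod At At q) \<and>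
    (\<exists>C. \<forall>q. norm q \<le> C * norm (complex_scale z q - map_prod At At q))"
proof -
  define unw2 where "unw2 = map_prod unw unw"
  have "z \<notin> spectrum s A - {1}" using spec z by (auto simp: s_def)
  then have "z \<in> resolvent_set s A" using z by (auto simp: spectrum_def)
  then obtain C where bij: "bij_betw (complex_shifted A z) (wspace s \<times> wspace s) (wspace s \<times> wspace s)"
    and C: "\<And>Z. Z \<in> wspace s \<times> wspace s \<Longrightarrow> wnorm_pair s Z \<le> C * wnorm_pair s (complex_shifted A z Z)"
    by (auto simp: resolvent_set_def)
  have eq: "complex_shifted A z (unw2 q) = unw2 (complex_scale z q - map_prod At At q)" for q
    by (cases q) (simp add: unw2_def complex_shifted_def complex_scale_def unw_linear unw_At)
  have in_ws: "unw2 q \<in> wspace s \<times> wspace s" for q by (cases q) (simp add: unw2_def unw_in)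
  have inj: "unw2 q = unw2 q' \<longleftrightarrow> q = q'" for q q'
    by (cases q; cases q') (simp add: unw2_def unw_inj)
  \<comment> \<open>The resolvent condition uses the sum of the two weighted norms, the product type
    the Euclidean combination; they are equivalent with factor 2.\<close>
  have pair: "norm q \<le> wnorm_pair s (unw2 q)" "wnorm_pair s (unw2 q) \<le> 2 * norm q" for q
  proof -
    obtain U V where q: "q = (U, V)" by (cases q)
    show "norm q \<le> wnorm_pair s (unw2 q)" "wnorm_pair s (unw2 q) \<le> 2 * norm q"
      using norm_Pair_le[of U V] norm_fst_le[of U V] norm_snd_le[of V U]
      by (auto simp: q unw2_def wnorm_pair_def wnorm_unw)
  qed
  have "\<exists>q. complex_scale z q - map_prod At At q = y" for y
  proof -
    have "unw2 y \<in> complex_shifted A z ` (wspace s \<times> wspace s)"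
      using bij in_ws by (auto simp: bij_betw_def)
    then obtain X Y where "X \<in> wspace s" "Y \<in> wspace s" "complex_shifted A z (X, Y) = unw2 y" by auto
    moreover then obtain U V where "X = unw U" "Y = unw V" using wspace_unw by blast
    ultimately have "complex_shifted A z (unw2 (U, V)) = unw2 y" by (simp add: unw2_def)
    then show ?thesis unfolding eq inj by blast
  qed
  moreover have "norm q \<le> 2 * \<bar>C\<bar> * norm (complex_scale z q - map_prod At At q)" for q
  proof -
    have "norm q \<le> C * wnorm_pair s (unw2 (complex_scale z q - map_prod At At q))"
      using C[OF in_ws, of q] pair(1)[of q] by (simp add: eq)
    also have "\<dots> \<le> \<bar>C\<bar> * (2 * norm (complex_scale z q - map_prod At At q))"
      by (rule mult_mono) (use pair order_trans[OF norm_ge_zero pair(1)] in auto)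
    finally show ?thesis by simp
  qed
  ultimately show ?thesis unfolding surj_def by metis
qed

lemma W'_0_wbd: "wbd (wt s 0) (K * CX / \<bar>c\<bar>) (W' 0)" by (rule W'_wbd)

lemma At_decay: "\<exists>N\<ge>1. \<exists>l C. bounded_linear l \<and>
  (\<forall>k V. norm ((At ^^ (N * k)) V - l V *\<^sub>R wgt (W' 0)) \<le> C * (1 / 2) ^ k * norm V)"
proof (rule spectral_decay[OF bounded_linear_At _ _ _ _ At_resolvent])
  define v where "v = wgt (W' 0)"
  have unw_v: "unw v = W' 0" unfolding v_def by (rule unw_wgt[OF W'_0_wbd])
  have ev: "W' 0 \<noteq> 0" "{Y \<in> wspace s. A Y = Y} = span {W' 0}"
    "W' 0 \<notin> (\<lambda>Y. A Y - Y) ` wspace s"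
    "wspace s = {r *\<^sub>R W' 0 + Z |r Z. Z \<in> (\<lambda>Y. A Y - Y) ` wspace s}"
    using simple unfolding simple_eigenvalue_def Let_def s_def[symmetric] by simp_all
  show "wgt (W' 0) \<noteq> 0"
  proof
    assume "wgt (W' 0) = 0"
    then have "unw (0 *\<^sub>R v) = W' 0" using unw_v by (simp add: v_def)
    then show False using ev(1) by (simp only: unw_linear) simp
  qed
  have "At V = V \<longleftrightarrow> V \<in> span {v}" for V
  proof -
    have "At V = V \<longleftrightarrow> A (unw V) = unw V" using unw_inj[of "At V" V] by (simp add: unw_At)
    also have "\<dots> \<longleftrightarrow> unw V \<in> span {W' 0}" using ev(2) unw_in by blast
    also have "\<dots> \<longleftrightarrow> (\<exists>k. unw V = unw (k *\<^sub>R v))" by (auto simp: span_singleton unw_linear unw_v)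
    also have "\<dots> \<longleftrightarrow> V \<in> span {v}" by (auto simp: span_singleton unw_inj)
    finally show ?thesis .
  qed
  then show "{Y. At Y = Y} = span {wgt (W' 0)}" by (auto simp: v_def)
  show "wgt (W' 0) \<notin> range (\<lambda>Z. At Z - Z)"
  proof
    assume "wgt (W' 0) \<in> range (\<lambda>Z. At Z - Z)"
    then obtain Z where "v = At Z - Z" by (auto simp: v_def)
    then have "W' 0 = A (unw Z) - unw Z" by (metis unw_v unw_linear(2) unw_At)
    then show False using ev(3) unw_in by blast
  qed
  fix X
  have "unw X \<in> {r *\<^sub>R W' 0 + Z |r Z. Z \<in> (\<lambda>Y. A Y - Y) ` wspace s}" using ev(4) unw_in by blast
  then obtain r Y where "Y \<in> wspace s" "unw X = r *\<^sub>R W' 0 + (A Y - Y)" by blast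
  moreover then obtain Z where "Y = unw Z" using wspace_unw by blast
  ultimately have "unw X = unw (r *\<^sub>R v + (At Z - Z))" by (simp add: unw_linear unw_At unw_v)
  then show "\<exists>s Z. X = s *\<^sub>R wgt (W' 0) + (At Z - Z)" unfolding unw_inj v_def by blast
qed

lemma wgt_linear:
  "wbd (wt s 0) d X \<Longrightarrow> wbd (wt s 0) d' Y \<Longrightarrow> wgt (X + Y) = wgt X + wgt Y"
  "wbd (wt s 0) d X \<Longrightarrow> wgt (r *\<^sub>R X) = r *\<^sub>R wgt X"
  by (metis unw_wgt unw_linear(1) wgt_unw) (metis unw_wgt unw_linear(3) wgt_unw)

text \<open>The functional \<open>l\<close> gives the coefficient of the translation mode. Decay
  over multiples of \<open>N\<close> periods extends to all times because the linearized equation is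
  periodic up to a shift and grows boundedly in the remaining time. Linearity is claimed on weighted
  sequences only, where \<open>wgt\<close> has its meaning.\<close>

lemma flow_decay_ex:
  "\<exists>l C a. a > 0 \<and> C \<ge> 0 \<and>
    (\<forall>X Y d d'. wbd (wt s 0) d X \<longrightarrow> wbd (wt s 0) d' Y \<longrightarrow> l (X + Y) = l X + (l Y :: real)) \<and>
    (\<forall>X d r. wbd (wt s 0) d X \<longrightarrow> l (r *\<^sub>R X) = r * l X) \<and>
    (\<forall>X d. wbd (wt s 0) d X \<longrightarrow> \<bar>l X\<bar> \<le> C * d) \<and>
    (\<forall>X d t. wbd (wt s 0) d X \<longrightarrow> t \<ge> 0 \<longrightarrow>
      wbd (wt s (c * t)) (C * exp (- a * t) * d) (flow \<Psi> X t - l X *\<^sub>R W' (c * t)))"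
proof -
  obtain N l0 C0 where N: "N \<ge> 1" and l0: "bounded_linear l0"
    and dec: "\<And>k V. norm ((At ^^ (N * k)) V - l0 V *\<^sub>R wgt (W' 0)) \<le> C0 * (1 / 2) ^ k * norm V"
    using At_decay by blast
  interpret l0: bounded_linear l0 by (rule l0)
  define l where "l X = l0 (wgt X)" for X
  define P where "P = of_nat N * p"
  have P: "P > 0" using N p_pos by (simp add: P_def)
  define a where "a = ln 2 / P"
  have a: "a > 0" using P by (simp add: a_def)
  \<comment> \<open>The 2 pays for rounding \<open>t / P\<close> down, the first exponential for
    growth during the remaining time, the second for recentring the weight from \<open>q\<close> to
    \<open>c * t\<close>.\<close>
  define C1 where "C1 = 2 * \<bar>C0\<bar> * exp (K * P) * exp (b * \<bar>c\<bar> * P)"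
  define C where "C = C1 + onorm l0"
  have C: "C \<ge> 0" "C1 \<le> C" "onorm l0 \<le> C" by (auto simp: C_def C1_def onorm_pos_le[OF l0])
  have l_bound: "\<bar>l X\<bar> \<le> C * d" if X: "wbd (wt s 0) d X" for X d
  proof -
    have "\<bar>l X\<bar> \<le> onorm l0 * norm (wgt X)" using onorm[OF l0, of "wgt X"] by (simp add: l_def)
    also have "\<dots> \<le> C * d"
      by (intro mult_mono C norm_wgt[OF X]) auto
    finally show ?thesis .
  qed
  have decay: "wbd (wt s (c * t)) (C * exp (- a * t) * d) (flow \<Psi> X t - l X *\<^sub>R W' (c * t))"
    if X: "wbd (wt s 0) d X" and t: "t \<ge> 0" for X d t
  proof -
    have d: "d \<ge> 0" using wbd_wt_nonneg[OF X] .
    define k where "k = nat \<lfloor>t / P\<rfloor>"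
    define r where "r = t - of_nat k * P"
    have "of_nat k \<le> t / P" "t / P < of_nat k + 1" using t P unfolding k_def by (simp_all add: floor_less_iff)
    then have r: "0 \<le> r" "r < P" using P by (auto simp: r_def field_simps)
    define m where "m = N * k"
    define q where "q = sg * int m"
    have t_eq: "t = of_nat m * p + r" by (simp add: r_def m_def P_def)
    have cmp: "c * (of_nat m * p) = of_int q" using c_p by (simp add: q_def mult.left_commute[of c])
    have ct: "c * t = c * r + of_int q" unfolding t_eq distrib_left cmp by simp
    define E where "E = (A ^^ m) X - l X *\<^sub>R W' 0"
    have "unw ((At ^^ m) (wgt X) - l0 (wgt X) *\<^sub>R wgt (W' 0)) = E"
      by (simp add: unw_linear unw_At_pow unw_wgt[OF X] unw_wgt[OF W'_0_wbd] E_def l_def)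
    then have "wbd (wt s 0) (C0 * (1 / 2) ^ k * norm (wgt X)) E"
      using dec[of k "wgt X"] wbd_unw_iff m_def by metis
    then have E: "wbd (wt s 0) (\<bar>C0\<bar> * (1 / 2) ^ k * d) E"
      by (rule wbd_mono) (intro mult_mono norm_wgt[OF X]; simp)
    have "flow \<Psi> X t = shift q (flow \<Psi> ((A ^^ m) X) r)"
      unfolding t_eq A_pow q_def by (rule flow_\<Psi>_periodic[OF r(1)])
    also have "(A ^^ m) X = E + l X *\<^sub>R W' 0" by (simp add: E_def)
    also have "shift q (flow \<Psi> \<dots> r) = shift q (flow \<Psi> E r) + l X *\<^sub>R shift q (flow \<Psi> (W' 0) r)"
      by (simp add: flow_add[OF path_\<Psi> r(1)] flow_scaleR[OF path_\<Psi> r(1)] shift_linear)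
    also have "shift q (flow \<Psi> (W' 0) r) = W' (c * t)"
      using flow_W'[OF r(1), of 0] by (simp add: ct W'_int)
    finally have eq: "flow \<Psi> X t - l X *\<^sub>R W' (c * t) = shift q (flow \<Psi> E r)" by simp
    have "wbd (wt s (0 + of_int q)) (\<bar>C0\<bar> * (1 / 2) ^ k * d * exp (K * r)) (shift q (flow \<Psi> E r))"
      unfolding wbd_shift by (rule flow_wbd[OF path_\<Psi> r(1) s_in(1) E])
    from wbd_change[OF this, of "c * t"] show ?thesis unfolding eq
    proof (rule wbd_mono)
      have "exp (\<bar>s\<bar> * \<bar>0 + of_int q - c * t\<bar>) \<le> exp (b * \<bar>c\<bar> * P)"
        using r b_pos by (simp add: ct s_in(3) abs_mult mult_left_mono mult.assoc)
      moreover have "exp (K * r) \<le> exp (K * P)" using r K(1) by simp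
      moreover have "(1 / 2) ^ k \<le> 2 * exp (- a * t)"
      proof -
        have "a * t \<le> ln 2 * (real k + 1)"
        proof -
          have "a * t = ln 2 * (t / P)" by (simp add: a_def)
          also have "\<dots> \<le> ln 2 * (real k + 1)" using \<open>t / P < of_nat k + 1\<close> by (intro mult_left_mono) auto
          finally show ?thesis .
        qed
        then have "exp (- (ln 2 * (real k + 1))) \<le> exp (- a * t)" by simp
        moreover have "exp (- (ln 2 * (real k + 1))) = (1 / 2) ^ Suc k"
          using exp_of_nat_mult[of "Suc k" "- ln 2 :: real"] by (simp add: exp_minus algebra_simps power_one_over)
        ultimately show ?thesis by simp
      qed
      ultimately have "exp (\<bar>s\<bar> * \<bar>0 + of_int q - c * t\<bar>) * (\<bar>C0\<bar> * (1 / 2) ^ k * d * exp (K * r)) \<le>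
          exp (b * \<bar>c\<bar> * P) * (\<bar>C0\<bar> * (2 * exp (- a * t)) * d * exp (K * P))"
        using d by (intro mult_mono) auto
      also have "\<dots> = C1 * (exp (- a * t) * d)" by (simp add: C1_def mult_ac)
      also have "\<dots> \<le> C * (exp (- a * t) * d)" using d by (intro mult_right_mono C) auto
      finally show "exp (\<bar>s\<bar> * \<bar>0 + of_int q - c * t\<bar>) * (\<bar>C0\<bar> * (1 / 2) ^ k * d * exp (K * r)) \<le> C * exp (- a * t) * d"
        by (simp add: mult_ac)
    qed
  qed
  show ?thesis
    by (rule exI[of _ l], rule exI[of _ C], rule exI[of _ a])
      (use a C l_bound decay in \<open>auto simp: l_def wgt_linear l0.add l0.scaleR\<close>)
qed

end

section \<open>The state ahead of a wave\<close>

lemma wbd_scaleR: "wbd w d V \<Longrightarrow> wbd w (\<bar>r\<bar> * d) (r *\<^sub>R V)"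
  unfolding wbd_def by (simp add: mult.left_commute mult_left_mono)

lemma norm_le_wbd: "wbd (wt s y) d V \<Longrightarrow> norm V \<le> d"
  by (rule norm_bound) (rule norm_le_if_wbd)

lemma norm_apply_le_exp: "wbd (wt s y) d V \<Longrightarrow> norm (V j) \<le> d * exp (- s * (of_int j - y))"
proof -
  assume V: "wbd (wt s y) d V"
  have "exp (s * (of_int j - y)) * norm (V j) \<le> wt s y j * norm (V j)"
    by (intro mult_right_mono exp_le_wt) auto
  also have "\<dots> \<le> d" by (rule wbd_D[OF V])
  finally have "exp (- s * (of_int j - y)) * (exp (s * (of_int j - y)) * norm (V j)) \<le> exp (- s * (of_int j - y)) * d"
    by (rule mult_left_mono) simp
  moreover have "exp (- s * (of_int j - y)) * exp (s * (of_int j - y)) = 1"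
    unfolding exp_add[symmetric] by simp
  ultimately show ?thesis by (metis mult.assoc mult.commute mult_1)
qed

lemma norm_add_diff_le: "u = x + y - z \<Longrightarrow> norm u \<le> norm x + norm y + norm z"
  for x :: "'a::real_normed_vector"
  using norm_triangle_ineq[of x y] norm_triangle_ineq4[of "x + y" z] by simp

lemma Suc_le_two_power: "real m + 1 \<le> 2 ^ m"
  by (induction m) auto

context wave
begin

lemma s_\<sigma>: "s * (of_int \<sigma> * x) = b * x"
  using \<sigma> by (auto simp: s_def)

lemma \<Psi>_wbd: "t \<in> {0..T} \<Longrightarrow> wbd (wt s 0) (exp (b * \<bar>c\<bar> * T) * CX) (\<Psi> t - 0)"
proof -
  assume t: "t \<in> {0..T}"
  have "b * \<bar>c * t\<bar> \<le> b * \<bar>c\<bar> * T" using t b_pos by (simp add: abs_mult mult_left_mono mult.assoc)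
  then show ?thesis
    using wbd_change[OF W_wbd[of "c * t"], of 0] CX_nonneg
    by (auto simp: s_in(3) intro!: mult_right_mono elim!: wbd_mono)
qed

lemma flow_vs_zero:
  assumes "t \<ge> 0" "wbd (wt (- s) y) d V"
  shows "norm (flow \<Psi> V t - flow (\<lambda>_. 0) V t) \<le>
    K * t * exp (2 * K * t) * (exp (b * \<bar>c\<bar> * t) * CX) * d * exp (- s * y)"
  using flow_compare_wbd[OF path_\<Psi> path_zero assms(1) s_in(1) \<Psi>_wbd assms(2)] by simp

text \<open>
  The functional \<open>l\<close> tends to zero along weighted translates of a finitely supported sequence:
  sums of translates with disjoint supports, whatever their number and signs, stay bounded in the
  weighted norm, so the values of \<open>l\<close> on them are summable.
\<close>

lemma functional_translates:
  assumes l_add: "\<And>X Y d d'. wbd (wt s 0) d X \<Longrightarrow> wbd (wt s 0) d' Y \<Longrightarrow> l (X + Y) = l X + (l Y :: real)"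
    and l_scale: "\<And>X d r. wbd (wt s 0) d X \<Longrightarrow> l (r *\<^sub>R X) = r * l X"
    and l_bound: "\<And>X d. wbd (wt s 0) d X \<Longrightarrow> \<bar>l X\<bar> \<le> C * d"
    and V: "\<And>i. wbd (wt s 0) D (V i)"
    and disjoint: "\<And>i i' j. V i j \<noteq> 0 \<Longrightarrow> V i' j \<noteq> 0 \<Longrightarrow> i = i'"
  shows "(\<lambda>i :: nat. l (V i)) \<longlonglongrightarrow> 0"
proof -
  have D: "D \<ge> 0" using wbd_wt_nonneg[OF V] .
  define Z where "Z n = (\<Sum>i<n. sgn (l (V i)) *\<^sub>R V i)" for n
  have Z_apply: "Z n j = (\<Sum>i<n. sgn (l (V i)) *\<^sub>R V i j)" for n j
    unfolding Z_def by (induction n) auto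
  have Z_wbd: "wbd (wt s 0) D (Z n)" for n
    unfolding wbd_def
  proof
    fix j
    show "wt s 0 j * norm (Z n j) \<le> D"
    proof (cases "\<exists>i<n. V i j \<noteq> 0")
      case True
      then obtain i where i: "i < n" "V i j \<noteq> 0" by blast
      have "Z n j = (\<Sum>k\<in>{i}. sgn (l (V k)) *\<^sub>R V k j)"
        unfolding Z_apply using i disjoint by (intro sum.mono_neutral_right) auto
      then have "norm (Z n j) = \<bar>sgn (l (V i))\<bar> * norm (V i j)" by simp
      also have "\<dots> \<le> 1 * norm (V i j)" by (intro mult_right_mono) (auto simp: sgn_if)
      finally have "wt s 0 j * norm (Z n j) \<le> wt s 0 j * norm (V i j)"
        by (intro mult_left_mono wt_nonneg) simp
      then show ?thesis using wbd_D[OF V, of j i] by linarith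
    next
      case False
      then have "Z n j = 0" unfolding Z_apply by (intro sum.neutral) auto
      then show ?thesis using D by simp
    qed
  qed
  have "l (Z n) = (\<Sum>i<n. \<bar>l (V i)\<bar>)" for n
  proof (induction n)
    case 0
    then show ?case using l_scale[OF wbd_zero[OF order_refl], of 0] by (simp add: Z_def)
  next
    case (Suc n)
    have "l (Z (Suc n)) = l (Z n) + sgn (l (V n)) * l (V n)"
      using l_add[OF Z_wbd wbd_scaleR[OF V], of n "sgn (l (V n))" n] l_scale[OF V]
      by (simp add: Z_def)
    then show ?case by (simp add: Suc abs_sgn mult.commute)
  qed
  then have "(\<Sum>i<n. \<bar>l (V i)\<bar>) \<le> C * D" for n using l_bound[OF Z_wbd, of n] by (metis abs_ge_self order_trans)
  then have "(\<Sum>i\<le>n. \<bar>l (V i)\<bar>) \<le> C * D" for n by (simp only: lessThan_Suc_atMost[symmetric])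
  then have "summable (\<lambda>i. \<bar>l (V i)\<bar>)" by (intro bounded_imp_summable[where B = "C * D"]) auto
  then have "(\<lambda>i. \<bar>l (V i)\<bar>) \<longlonglongrightarrow> 0" by (rule summable_LIMSEQ_zero)
  then show ?thesis by (simp add: tendsto_rabs_zero_iff)
qed

text \<open>
  Far ahead of the wave its linearization looks like the linearization at zero. So the decay of
  the former on the weighted space is inherited by the latter, up to the component along the
  eigenfunction, which disappears in the limit.
\<close>

lemma ahead_decay_ex:
  "\<exists>C a. a > 0 \<and> C \<ge> 0 \<and> (\<forall>t\<ge>0. \<forall>h V. (\<forall>j. apply_bcontfun V j \<noteq> 0 \<longrightarrow> s * (of_int j + of_int h) \<le> 0) \<longrightarrow>
    norm (flow (\<lambda>_. 0) V t 0) \<le> C * exp (- a * t) * exp (s * (c * t - of_int h)) * norm V)"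
proof -
  obtain l :: "'n bseq \<Rightarrow> real" and C a where a: "a > 0" and C: "C \<ge> 0"
    and l_add: "\<And>X Y d d'. wbd (wt s 0) d X \<Longrightarrow> wbd (wt s 0) d' Y \<Longrightarrow> l (X + Y) = l X + l Y"
    and l_scale: "\<And>X d r. wbd (wt s 0) d X \<Longrightarrow> l (r *\<^sub>R X) = r * l X"
    and l_bound: "\<And>X d. wbd (wt s 0) d X \<Longrightarrow> \<bar>l X\<bar> \<le> C * d"
    and decay: "\<And>X d t. wbd (wt s 0) d X \<Longrightarrow> t \<ge> 0 \<Longrightarrow>
      wbd (wt s (c * t)) (C * exp (- a * t) * d) (flow \<Psi> X t - l X *\<^sub>R W' (c * t))"
    using flow_decay_ex by blast
  have fin: "norm (flow (\<lambda>_. 0) V t 0) \<le> C * exp (- a * t) * exp (s * (c * t - of_int h)) * norm V"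
    if t: "t \<ge> 0" and supp: "\<And>j. V j \<noteq> 0 \<Longrightarrow> s * (of_int j + of_int h) \<le> 0"
      and fin_supp: "\<And>j. V j \<noteq> 0 \<Longrightarrow> \<bar>j\<bar> \<le> int H" for t h H and V :: "'n bseq"
  proof -
    \<comment> \<open>The support of \<open>V\<close> fits into \<open>2 * H + 1\<close> consecutive
      sites, so translates by different multiples of \<open>w\<close> are disjoint.\<close>
    define w where "w = 2 * int H + 1"
    define \<beta> where "\<beta> i = b * (real i * of_int w)" for i :: nat
    define q where "q i = \<sigma> * (int i * w)" for i :: nat
    have \<beta>: "\<beta> i \<ge> 0" "s * of_int (q i) = \<beta> i" for i
      using b_pos s_\<sigma>[of "real i * of_int w"] by (auto simp: \<beta>_def q_def w_def)
    \<comment> \<open>Moving the data ahead by \<open>q i\<close> raises the weight by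
      \<open>exp (\<beta> i)\<close>; the scalar compensates for this and keeps the
      \<open>X i\<close> bounded in the weighted norm.\<close>
    define X where "X i = exp (- \<beta> i) *\<^sub>R shift (q i) V" for i
    have X_apply: "X i j = exp (- \<beta> i) *\<^sub>R V (j - q i)" for i j by (simp add: X_def shift_apply)
    have norm_X: "norm (X i) = exp (- \<beta> i) * norm V" for i by (simp add: X_def)
    define D where "D i = (exp (- \<beta> i) + exp (- s * of_int h)) * norm V" for i
    have X_wbd: "wbd (wt s 0) (D i) (X i)" for i
      unfolding wbd_def
    proof
      fix j
      show "wt s 0 j * norm (X i j) \<le> D i"
      proof (cases "V (j - q i) = 0")
        case False
        then have "s * of_int j \<le> \<beta> i - s * of_int h" using supp[of "j - q i"] \<beta>(2)[of i] by (simp add: algebra_simps)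
        then have "wt s 0 j \<le> 1 + exp (\<beta> i - s * of_int h)" by (simp add: wt_def)
        then have "wt s 0 j * exp (- \<beta> i) \<le> (1 + exp (\<beta> i - s * of_int h)) * exp (- \<beta> i)"
          by (rule mult_right_mono) simp
        also have "\<dots> = exp (- \<beta> i) + exp (- s * of_int h)" by (simp add: distrib_right flip: exp_add)
        finally have "wt s 0 j * exp (- \<beta> i) * norm (V (j - q i)) \<le> (exp (- \<beta> i) + exp (- s * of_int h)) * norm V"
          by (intro mult_mono norm_bounded) (auto simp: add_nonneg_nonneg)
        then show ?thesis by (simp add: X_apply D_def mult.assoc)
      qed (simp add: X_apply D_def add_nonneg_nonneg)
    qed
    define D0 where "D0 = (1 + exp (- s * of_int h)) * norm V"
    have "D i \<le> D0" for i unfolding D_def D0_def using \<beta>(1) by (intro mult_right_mono add_mono) auto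
    then have X_wbd0: "wbd (wt s 0) D0 (X i)" for i using X_wbd wbd_mono by blast
    have l_lim: "(\<lambda>i. l (X i)) \<longlonglongrightarrow> 0"
    proof (rule functional_translates[OF l_add l_scale l_bound X_wbd0])
      fix i i' j assume "X i j \<noteq> 0" "X i' j \<noteq> 0"
      then have "\<bar>j - q i\<bar> \<le> int H" "\<bar>j - q i'\<bar> \<le> int H" using fin_supp by (auto simp: X_apply)
      then have "\<bar>q i - q i'\<bar> < w" by (simp add: w_def)
      moreover have "\<bar>q i - q i'\<bar> = \<bar>int i - int i'\<bar> * w"
        using \<sigma> by (auto simp: q_def w_def abs_mult simp flip: left_diff_distrib right_diff_distrib)
      ultimately have "\<bar>int i - int i'\<bar> * w < 1 * w" by simp
      then have "\<bar>int i - int i'\<bar> < 1" by (rule mult_right_less_imp_less) (simp add: w_def)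
      then show "i = i'" by simp
    qed
    define E where "E = K * t * exp (2 * K * t) * (exp (b * \<bar>c\<bar> * t) * CX) * 2 * norm V * exp (b * real H)"
    define F where "F = K * CX / \<bar>c\<bar> * exp (s * (c * t))"
    \<comment> \<open>At the site \<open>q i\<close> every weighted bound carries a factor
      \<open>exp (- \<beta> i)\<close>, which cancels against the scaling of \<open>X i\<close>. For
      large \<open>i\<close> the mode vanishes with \<open>l (X i)\<close>, the replacement of the
      wave by zero keeps a further factor \<open>exp (- \<beta> i)\<close>, and \<open>D i\<close>
      tends to \<open>exp (- s * of_int h) * norm V\<close>.\<close>
    have le: "norm (flow (\<lambda>_. 0) V t 0) \<le> \<bar>l (X i)\<bar> * F + C * exp (- a * t) * D i * exp (s * (c * t)) + E * exp (- \<beta> i)" for i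
    proof -
      have "flow (\<lambda>_. 0) (X i) t = exp (- \<beta> i) *\<^sub>R shift (q i) (flow (\<lambda>_. 0) V t)"
        using flow_shift[OF path_zero t, of "q i" V] flow_scaleR[OF path_zero t] by (simp add: X_def shift_linear)
      then have eq: "norm (flow (\<lambda>_. 0) (X i) t (q i)) = exp (- \<beta> i) * norm (flow (\<lambda>_. 0) V t 0)"
        by (simp add: shift_apply)
      have "wbd (wt (- s) (of_int (q i) - of_int \<sigma> * real H)) ((1 + exp 0) * norm (X i)) (X i)"
      proof (rule wbd_if_support)
        fix j assume "X i j \<noteq> 0"
        then have "\<bar>j - q i\<bar> \<le> int H" using fin_supp by (simp add: X_apply)
        then have "\<bar>real_of_int (j - q i)\<bar> \<le> real H" by linarith
        then have "b * \<bar>real_of_int (j - q i)\<bar> \<le> b * real H" using b_pos by (intro mult_left_mono) auto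
        moreover have "- (s * of_int (j - q i)) \<le> b * \<bar>real_of_int (j - q i)\<bar>"
          using s_in(3) abs_ge_minus_self[of "s * of_int (j - q i)"] by (simp add: abs_mult)
        moreover have "- s * (of_int j - (of_int (q i) - of_int \<sigma> * real H)) =
            - (s * of_int (j - q i)) - s * (of_int \<sigma> * real H)" by (simp add: algebra_simps)
        ultimately show "- s * (of_int j - (of_int (q i) - of_int \<sigma> * real H)) \<le> 0"
          unfolding s_\<sigma> by linarith
      qed
      from flow_vs_zero[OF t this] have "norm (flow \<Psi> (X i) t - flow (\<lambda>_. 0) (X i) t) \<le>
          K * t * exp (2 * K * t) * (exp (b * \<bar>c\<bar> * t) * CX) * ((1 + exp 0) * norm (X i)) *
          exp (- s * (of_int (q i) - of_int \<sigma> * real H))" .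
      also have "- s * (of_int (q i) - of_int \<sigma> * real H) = b * real H - \<beta> i"
        using \<beta>(2)[of i] s_\<sigma>[of "real H"] by (simp add: algebra_simps)
      also have "K * t * exp (2 * K * t) * (exp (b * \<bar>c\<bar> * t) * CX) * ((1 + exp 0) * norm (X i)) * exp (b * real H - \<beta> i)
          = exp (- \<beta> i) * (E * exp (- \<beta> i))"
        unfolding norm_X E_def diff_conv_add_uminus exp_add by simp
      finally have 1: "norm (flow \<Psi> (X i) t - flow (\<lambda>_. 0) (X i) t) \<le> exp (- \<beta> i) * (E * exp (- \<beta> i))" .
      have ex: "exp (- s * (of_int (q i) - c * t)) = exp (- \<beta> i) * exp (s * (c * t))"
        unfolding exp_add[symmetric] using \<beta>(2)[of i] by (simp add: algebra_simps)
      have 2: "norm ((flow \<Psi> (X i) t - l (X i) *\<^sub>R W' (c * t)) (q i)) \<le> C * exp (- a * t) * D i * (exp (- \<beta> i) * exp (s * (c * t)))"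
        using norm_apply_le_exp[OF decay[OF X_wbd t], of i "q i"] unfolding ex .
      have 3: "norm (W' (c * t) (q i)) \<le> K * CX / \<bar>c\<bar> * (exp (- \<beta> i) * exp (s * (c * t)))"
        using norm_apply_le_exp[OF W'_wbd, of "c * t" "q i"] unfolding ex .
      have "flow (\<lambda>_. 0) (X i) t (q i) = (flow \<Psi> (X i) t - l (X i) *\<^sub>R W' (c * t)) (q i) + l (X i) *\<^sub>R W' (c * t) (q i)
          - (flow \<Psi> (X i) t - flow (\<lambda>_. 0) (X i) t) (q i)" by simp
      then have "norm (flow (\<lambda>_. 0) (X i) t (q i)) \<le> norm ((flow \<Psi> (X i) t - l (X i) *\<^sub>R W' (c * t)) (q i)) +
          norm (l (X i) *\<^sub>R W' (c * t) (q i)) + norm ((flow \<Psi> (X i) t - flow (\<lambda>_. 0) (X i) t) (q i))"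
        by (rule norm_add_diff_le)
      moreover have "norm (l (X i) *\<^sub>R W' (c * t) (q i)) \<le> \<bar>l (X i)\<bar> * (K * CX / \<bar>c\<bar> * (exp (- \<beta> i) * exp (s * (c * t))))"
        by (simp only: norm_scaleR) (intro mult_left_mono 3, simp)
      ultimately have "exp (- \<beta> i) * norm (flow (\<lambda>_. 0) V t 0) \<le>
          C * exp (- a * t) * D i * (exp (- \<beta> i) * exp (s * (c * t))) +
          \<bar>l (X i)\<bar> * (K * CX / \<bar>c\<bar> * (exp (- \<beta> i) * exp (s * (c * t)))) + exp (- \<beta> i) * (E * exp (- \<beta> i))"
        using 1 2 norm_bounded[of "flow \<Psi> (X i) t - flow (\<lambda>_. 0) (X i) t" "q i"] unfolding eq by linarith
      also have "\<dots> = exp (- \<beta> i) * (\<bar>l (X i)\<bar> * F + C * exp (- a * t) * D i * exp (s * (c * t)) + E * exp (- \<beta> i))"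
        by (simp add: F_def algebra_simps)
      finally show ?thesis by (simp only: mult_le_cancel_left_pos[OF exp_gt_zero])
    qed
    have exp_lim: "(\<lambda>i. exp (- \<beta> i)) \<longlonglongrightarrow> 0"
    proof -
      have "(\<lambda>i. exp (- (b * of_int w)) ^ i) \<longlonglongrightarrow> 0"
        using b_pos by (intro LIMSEQ_realpow_zero) (auto simp: w_def)
      then show ?thesis by (simp add: \<beta>_def mult_ac flip: exp_of_nat_mult)
    qed
    have "(\<lambda>i. \<bar>l (X i)\<bar> * F + C * exp (- a * t) * D i * exp (s * (c * t)) + E * exp (- \<beta> i)) \<longlonglongrightarrow>
        \<bar>0\<bar> * F + C * exp (- a * t) * ((0 + exp (- s * of_int h)) * norm V) * exp (s * (c * t)) + E * 0"
      unfolding D_def by (intro tendsto_intros l_lim exp_lim)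
    then have "norm (flow (\<lambda>_. 0) V t 0) \<le>
        \<bar>0\<bar> * F + C * exp (- a * t) * ((0 + exp (- s * of_int h)) * norm V) * exp (s * (c * t)) + E * 0"
      by (rule LIMSEQ_le_const) (use le in auto)
    also have "\<dots> = C * exp (- a * t) * (exp (- s * of_int h) * exp (s * (c * t))) * norm V" by simp
    also have "exp (- s * of_int h) * exp (s * (c * t)) = exp (s * (c * t - of_int h))"
      unfolding exp_add[symmetric] by (simp add: algebra_simps)
    finally show ?thesis .
  qed
  have "norm (flow (\<lambda>_. 0) V t 0) \<le> C * exp (- a * t) * exp (s * (c * t - of_int h)) * norm V"
    if t: "t \<ge> 0" and supp: "\<And>j. V j \<noteq> 0 \<Longrightarrow> s * (of_int j + of_int h) \<le> 0" for t h and V :: "'n bseq"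
  proof -
    define Q where "Q = C * exp (- a * t) * exp (s * (c * t - of_int h))"
    have Q: "Q \<ge> 0" using C by (simp add: Q_def)
    \<comment> \<open>Removes the finite support. For \<open>H\<close> at least
      \<open>\<bar>h\<bar>\<close>, the condition on the support leaves only sites behind
      \<open>- \<sigma> * H\<close> in the tail, and these reach site 0 with a factor
      \<open>exp (- b) ^ H\<close>.\<close>
    have le: "norm (flow (\<lambda>_. 0) V t 0) \<le> Q * norm V + 2 * norm V * exp (K * t) * exp (- b) ^ H"
      if H: "nat \<bar>h\<bar> \<le> H" for H
    proof -
      define S where "S = {- int H..int H}"
      define U where "U = restrict_seq (- S) V"
      have "norm (flow (\<lambda>_. 0) (restrict_seq S V) t 0) \<le> Q * norm (restrict_seq S V)"
        unfolding Q_def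
        by (rule fin[OF t, where H = H]) (use supp in \<open>auto simp: restrict_seq_apply S_def split: if_splits\<close>)
      also have "\<dots> \<le> Q * norm V" by (intro mult_left_mono norm_restrict_seq Q)
      finally have 1: "norm (flow (\<lambda>_. 0) (restrict_seq S V) t 0) \<le> Q * norm V" .
      have "wbd (wt s (- (of_int \<sigma> * real H))) ((1 + exp 0) * norm U) U"
      proof (rule wbd_if_support)
        fix j assume "U j \<noteq> 0"
        then have j: "\<bar>j\<bar> > int H" "s * (of_int j + of_int h) \<le> 0"
          using supp[of j] by (auto simp: U_def S_def restrict_seq_apply split: if_splits)
        have "b * (of_int \<sigma> * (of_int j + of_int h)) \<le> 0" using j(2) by (simp add: s_def mult_ac)
        then have "real_of_int \<sigma> * (of_int j + of_int h) \<le> 0" using b_pos by (simp add: mult_le_0_iff)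
        then have "real_of_int (\<sigma> * j + int H) \<le> 0" using \<sigma> H j(1) by auto
        then have "b * real_of_int (\<sigma> * j + int H) \<le> 0" using b_pos by (simp add: mult_le_0_iff)
        then show "s * (of_int j - - (of_int \<sigma> * real H)) \<le> 0"
          unfolding diff_minus_eq_add distrib_left s_\<sigma> by (simp add: s_def algebra_simps)
      qed
      then have "wbd (wt s (- (of_int \<sigma> * real H))) (2 * norm V) U"
        by (rule wbd_mono) (use norm_restrict_seq[of "- S" V] in \<open>simp add: U_def\<close>)
      from norm_apply_le_exp[OF flow_wbd[OF path_zero t s_in(1) this], of 0]
      have "norm (flow (\<lambda>_. 0) U t 0) \<le>
          2 * norm V * exp (K * t) * exp (- s * (of_int 0 - - (of_int \<sigma> * real H)))" .
      also have "exp (- s * (of_int 0 - - (of_int \<sigma> * real H))) = exp (- b) ^ H"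
        unfolding exp_of_nat_mult[symmetric] using s_\<sigma>[of "real H"] by simp
      finally have 2: "norm (flow (\<lambda>_. 0) U t 0) \<le> 2 * norm V * exp (K * t) * exp (- b) ^ H" .
      have "flow (\<lambda>_. 0) V t = flow (\<lambda>_. 0) (restrict_seq S V) t + flow (\<lambda>_. 0) U t"
        unfolding U_def using restrict_seq_split[of V S] flow_add[OF path_zero t] by metis
      then have "norm (flow (\<lambda>_. 0) V t 0) \<le> norm (flow (\<lambda>_. 0) (restrict_seq S V) t 0) + norm (flow (\<lambda>_. 0) U t 0)"
        by (simp add: norm_triangle_ineq)
      then show ?thesis using 1 2 by linarith
    qed
    have lim: "(\<lambda>H. exp (- b) ^ H) \<longlonglongrightarrow> 0" using b_pos by (intro LIMSEQ_realpow_zero) auto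
    have "(\<lambda>H. Q * norm V + 2 * norm V * exp (K * t) * exp (- b) ^ H) \<longlonglongrightarrow> Q * norm V + 2 * norm V * exp (K * t) * 0"
      by (intro tendsto_add tendsto_mult tendsto_const lim)
    then have "norm (flow (\<lambda>_. 0) V t 0) \<le> Q * norm V + 2 * norm V * exp (K * t) * 0"
      by (rule LIMSEQ_le_const) (use le in blast)
    then show ?thesis by (simp add: Q_def)
  qed
  then show ?thesis using a C by blast
qed

end

section \<open>Decay in the supremum norm\<close>

context wave
begin

text \<open>
  A perturbation that is merely bounded is cut off ahead of the wave at each time \<open>\<tau>\<close>:
  the part behind the cut decays in the weighted space up to a multiple of the eigenfunction,
  while the part ahead of it is governed by the linearization at zero.
\<close>

lemma sup_norm_decay_steps:
  assumes zero_decay: "\<And>\<epsilon>. \<epsilon> > 0 \<Longrightarrow> \<exists>t0. \<forall>t\<ge>t0. \<forall>V. norm (flow (\<lambda>_. 0) V t) \<le> \<epsilon> * norm V"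
  shows "\<exists>n\<ge>1. \<exists>C\<ge>0. \<forall>m V. \<exists>\<kappa>. \<bar>\<kappa>\<bar> \<le> C * norm V \<and>
    norm (flow \<Psi> V (of_nat m * (of_nat n * p)) - \<kappa> *\<^sub>R W' (c * (of_nat m * (of_nat n * p)))) \<le> C * (1 / 2) ^ m * norm V"
proof -
  obtain l :: "'n bseq \<Rightarrow> real" and C a where a: "a > 0" and C: "C \<ge> 0"
    and l_bound: "\<And>X d. wbd (wt s 0) d X \<Longrightarrow> \<bar>l X\<bar> \<le> C * d"
    and decay: "\<And>X d t. wbd (wt s 0) d X \<Longrightarrow> t \<ge> 0 \<Longrightarrow>
      wbd (wt s (c * t)) (C * exp (- a * t) * d) (flow \<Psi> X t - l X *\<^sub>R W' (c * t))"
    using flow_decay_ex by blast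
  \<comment> \<open>One eighth is allotted to the decay at zero and another, through the choice of
    \<open>H\<close>, to replacing the wave by zero ahead of the cut; so the part ahead shrinks to a
    quarter in time \<tau>.\<close>
  obtain t0 where t0: "\<And>t V. t \<ge> t0 \<Longrightarrow> norm (flow (\<lambda>_. 0) V t) \<le> 1 / 8 * norm V"
    using zero_decay[of "1 / 8"] by auto
  obtain n0 :: nat where n0: "max t0 (ln 4 / a) / p \<le> real n0" using real_arch_simple by blast
  define n where "n = Suc n0"
  define \<tau> where "\<tau> = of_nat n * p"
  have "max t0 (ln 4 / a) \<le> real n0 * p" using n0 p_pos by (simp add: divide_le_eq)
  also have "\<dots> \<le> \<tau>" using p_pos by (simp add: \<tau>_def n_def)
  finally have \<tau>: "t0 \<le> \<tau>" "ln 4 / a \<le> \<tau>" by simp_all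
  have \<tau>_pos: "\<tau> > 0" using p_pos by (simp add: \<tau>_def n_def)
  have "ln 4 \<le> a * \<tau>" using \<tau>(2) a by (simp add: divide_le_eq mult.commute)
  then have "exp (- a * \<tau>) \<le> exp (- ln 4)" by simp
  then have quarter: "exp (- a * \<tau>) \<le> 1 / 4" by (simp add: exp_minus)
  define E where "E = K * \<tau> * exp (2 * K * \<tau>) * (exp (b * \<bar>c\<bar> * \<tau>) * CX) * 2"
  have E: "E \<ge> 0" using K(1) \<tau>_pos CX_nonneg by (simp add: E_def)
  obtain H :: nat where H: "exp (- b) ^ H < 1 / (8 * (E + 1))"
    using real_arch_pow_inv[of "1 / (8 * (E + 1))" "exp (- b)"] E b_pos by auto
  have "E * exp (- b) ^ H \<le> E * (1 / (8 * (E + 1)))" using H E by (intro mult_left_mono) auto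
  also have "\<dots> \<le> 1 / 8" using E by (simp add: field_simps)
  finally have EH: "E * exp (- b) ^ H \<le> 1 / 8" .
  define S where "S = {j. \<sigma> * j \<le> int H}"
  define D where "D = 1 + exp (b * real H)"
  define C2 where "C2 = C * D"
  have C2: "C2 \<ge> 0" using C by (simp add: C2_def D_def add_nonneg_nonneg)
  have s_eq: "s * of_int j = b * of_int (\<sigma> * j)" for j by (simp add: s_def)
  have V1_wbd: "wbd (wt s 0) (D * norm V) (restrict_seq S V)" for V
  proof -
    have "wbd (wt s 0) ((1 + exp (b * real H)) * norm (restrict_seq S V)) (restrict_seq S V)"
    proof (rule wbd_if_support)
      fix j assume "restrict_seq S V j \<noteq> 0"
      then have "\<sigma> * j \<le> int H" by (auto simp: restrict_seq_apply S_def split: if_splits)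
      then have "b * of_int (\<sigma> * j) \<le> b * real H" using b_pos by (intro mult_left_mono) linarith+
      then show "s * (of_int j - 0) \<le> b * real H" unfolding s_eq[symmetric] by simp
    qed
    then show ?thesis
      by (rule wbd_mono) (auto simp: D_def norm_restrict_seq intro!: mult_left_mono add_nonneg_nonneg)
  qed
  have V2_norm: "norm (flow \<Psi> (restrict_seq (- S) V) \<tau>) \<le> 1 / 4 * norm V" for V
  proof -
    define U where "U = restrict_seq (- S) V"
    have U: "norm U \<le> norm V" unfolding U_def by (rule norm_restrict_seq)
    have "wbd (wt (- s) (of_int \<sigma> * real H)) ((1 + exp 0) * norm U) U"
    proof (rule wbd_if_support)
      fix j assume "U j \<noteq> 0"
      then have "\<sigma> * j \<ge> int H" by (auto simp: U_def restrict_seq_apply S_def split: if_splits)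
      then have "b * of_int (\<sigma> * j) \<ge> b * real H" using b_pos by (intro mult_left_mono) linarith+
      moreover have "- s * (of_int j - of_int \<sigma> * real H) = s * (of_int \<sigma> * real H) - s * of_int j"
        by (simp add: algebra_simps)
      ultimately show "- s * (of_int j - of_int \<sigma> * real H) \<le> 0" unfolding s_\<sigma> s_eq by linarith
    qed
    from flow_vs_zero[OF less_imp_le[OF \<tau>_pos] this]
    have "norm (flow \<Psi> U \<tau> - flow (\<lambda>_. 0) U \<tau>) \<le> E * exp (- s * (of_int \<sigma> * real H)) * norm U"
      by (simp add: E_def mult_ac)
    also have "exp (- s * (of_int \<sigma> * real H)) = exp (- b) ^ H"
      using s_\<sigma>[of "real H"] by (simp add: mult_ac flip: exp_of_nat_mult)
    also have "E * exp (- b) ^ H * norm U \<le> 1 / 8 * norm V" by (intro mult_mono EH U) auto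
    finally have 1: "norm (flow \<Psi> U \<tau> - flow (\<lambda>_. 0) U \<tau>) \<le> 1 / 8 * norm V" .
    have "norm (flow (\<lambda>_. 0) U \<tau>) \<le> 1 / 8 * norm V" using t0[OF \<tau>(1), of U] U by simp
    then show ?thesis unfolding U_def[symmetric]
      using 1 norm_triangle_sub[of "flow \<Psi> U \<tau>" "flow (\<lambda>_. 0) U \<tau>"] by linarith
  qed
  define q where "q = sg * int n"
  have c\<tau>: "c * \<tau> = of_int q" using c_p by (simp add: \<tau>_def q_def mult.left_commute[of c])
  \<comment> \<open>The first time step is split off: the part behind the cut is followed by
    weighted decay through all remaining time, and the part ahead, shifted back, is bounded data of
    a quarter of the size. The mode coefficients stay below \<open>2 * C2\<close> because
    \<open>C2 + 2 * C2 / 4 \<le> 2 * C2\<close>. The \<open>m\<close> cuts cause the linear factor,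
    later absorbed by replacing 1/4 with 1/2.\<close>
  have main: "\<exists>\<kappa>. \<bar>\<kappa>\<bar> \<le> 2 * C2 * norm V \<and>
      norm (flow \<Psi> V (of_nat m * \<tau>) - \<kappa> *\<^sub>R W' (c * (of_nat m * \<tau>))) \<le> (C2 * real m + 1) * (1 / 4) ^ m * norm V" for m V
  proof (induction m arbitrary: V)
    case 0
    then show ?case using path_\<Psi> C2 by (intro exI[of _ 0]) simp
  next
    case (Suc m)
    define V1 where "V1 = restrict_seq S V"
    define V2 where "V2 = restrict_seq (- S) V"
    define t where "t = of_nat m * \<tau>"
    have t: "t \<ge> 0" using \<tau>_pos by (simp add: t_def)
    have Suc_t: "of_nat (Suc m) * \<tau> = \<tau> + t" by (simp add: t_def algebra_simps)
    define U where "U = shift (- q) (flow \<Psi> V2 \<tau>)"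
    have U: "norm U \<le> 1 / 4 * norm V" using V2_norm[of V] by (simp add: U_def V2_def)
    obtain k2 where k2: "\<bar>k2\<bar> \<le> 2 * C2 * norm U"
      "norm (flow \<Psi> U t - k2 *\<^sub>R W' (c * t)) \<le> (C2 * real m + 1) * (1 / 4) ^ m * norm U"
      using Suc.IH[of U] unfolding t_def by blast
    have V1: "wbd (wt s 0) (D * norm V) V1" unfolding V1_def by (rule V1_wbd)
    define k1 where "k1 = l V1"
    have k1: "\<bar>k1\<bar> \<le> C2 * norm V" using l_bound[OF V1] by (simp add: k1_def C2_def mult.assoc)
    have "exp (- a * (\<tau> + t)) = exp (- a * \<tau>) ^ Suc m"
      unfolding exp_of_nat_mult[symmetric] by (simp add: t_def algebra_simps)
    also have "\<dots> \<le> (1 / 4) ^ Suc m" by (intro power_mono quarter) simp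
    finally have ea: "exp (- a * (\<tau> + t)) \<le> (1 / 4) ^ Suc m" .
    have "norm (flow \<Psi> V1 (\<tau> + t) - k1 *\<^sub>R W' (c * (\<tau> + t))) \<le> C * exp (- a * (\<tau> + t)) * (D * norm V)"
      unfolding k1_def by (rule norm_le_wbd[OF decay[OF V1]]) (use t \<tau>_pos in simp)
    also have "\<dots> = C2 * norm V * exp (- a * (\<tau> + t))" by (simp add: C2_def mult_ac)
    also have "\<dots> \<le> C2 * norm V * (1 / 4) ^ Suc m" using C2 by (intro mult_left_mono ea) auto
    finally have e1: "norm (flow \<Psi> V1 (\<tau> + t) - k1 *\<^sub>R W' (c * (\<tau> + t))) \<le> C2 * norm V * (1 / 4) ^ Suc m" .
    have f2: "flow \<Psi> V2 (\<tau> + t) = shift q (flow \<Psi> U t)"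
      unfolding \<tau>_def U_def q_def by (rule flow_\<Psi>_periodic[OF t])
    have W2: "W' (c * (\<tau> + t)) = shift q (W' (c * t))"
      using W'_int[of "c * t" q] by (simp add: distrib_left c\<tau> add.commute)
    have "norm (flow \<Psi> V2 (\<tau> + t) - k2 *\<^sub>R W' (c * (\<tau> + t))) = norm (flow \<Psi> U t - k2 *\<^sub>R W' (c * t))"
      unfolding f2 W2 shift_linear(3)[symmetric] shift_linear(2)[symmetric] by simp
    also have "\<dots> \<le> (C2 * real m + 1) * (1 / 4) ^ m * (1 / 4 * norm V)"
      using k2(2) mult_left_mono[OF U, of "(C2 * real m + 1) * (1 / 4) ^ m"] C2 by simp
    finally have e2: "norm (flow \<Psi> V2 (\<tau> + t) - k2 *\<^sub>R W' (c * (\<tau> + t))) \<le> (C2 * real m + 1) * (1 / 4) ^ Suc m * norm V"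
      by simp
    have "flow \<Psi> V (\<tau> + t) = flow \<Psi> V1 (\<tau> + t) + flow \<Psi> V2 (\<tau> + t)"
      unfolding V1_def V2_def using restrict_seq_split[of V S] flow_add[OF path_\<Psi>, of "\<tau> + t"] t \<tau>_pos
      by (metis add_nonneg_nonneg less_imp_le)
    then have "flow \<Psi> V (\<tau> + t) - (k1 + k2) *\<^sub>R W' (c * (\<tau> + t)) =
        (flow \<Psi> V1 (\<tau> + t) - k1 *\<^sub>R W' (c * (\<tau> + t))) + (flow \<Psi> V2 (\<tau> + t) - k2 *\<^sub>R W' (c * (\<tau> + t)))"
      by (simp add: scaleR_add_left)
    then have "norm (flow \<Psi> V (\<tau> + t) - (k1 + k2) *\<^sub>R W' (c * (\<tau> + t))) \<le>
        C2 * norm V * (1 / 4) ^ Suc m + (C2 * real m + 1) * (1 / 4) ^ Suc m * norm V"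
      using norm_triangle_le[OF add_mono[OF e1 e2]] by simp
    also have "\<dots> = (C2 * real (Suc m) + 1) * (1 / 4) ^ Suc m * norm V" by (simp add: algebra_simps)
    finally have "norm (flow \<Psi> V (\<tau> + t) - (k1 + k2) *\<^sub>R W' (c * (\<tau> + t))) \<le> (C2 * real (Suc m) + 1) * (1 / 4) ^ Suc m * norm V" .
    moreover have "\<bar>k1 + k2\<bar> \<le> 2 * C2 * norm V"
    proof -
      have "2 * C2 * norm U \<le> 2 * C2 * (1 / 4 * norm V)" using C2 by (intro mult_left_mono U) auto
      moreover have "0 \<le> C2 * norm V" using C2 by simp
      ultimately show ?thesis using k1 k2(1) by linarith
    qed
    ultimately show ?case unfolding Suc_t by blast
  qed
  define C3 where "C3 = 2 * C2 + 1"
  have C3: "C3 \<ge> 0" using C2 by (simp add: C3_def)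
  have "\<exists>\<kappa>. \<bar>\<kappa>\<bar> \<le> C3 * norm V \<and>
      norm (flow \<Psi> V (of_nat m * \<tau>) - \<kappa> *\<^sub>R W' (c * (of_nat m * \<tau>))) \<le> C3 * (1 / 2) ^ m * norm V" for m V
  proof -
    obtain \<kappa> where \<kappa>: "\<bar>\<kappa>\<bar> \<le> 2 * C2 * norm V"
      "norm (flow \<Psi> V (of_nat m * \<tau>) - \<kappa> *\<^sub>R W' (c * (of_nat m * \<tau>))) \<le> (C2 * real m + 1) * (1 / 4) ^ m * norm V"
      using main by blast
    have "(C2 * real m + 1) * (1 / 4) ^ m \<le> C3 * (1 / 2) ^ m"
    proof -
      have "C2 * real m + 1 \<le> C3 * (real m + 1)" using C2 by (simp add: C3_def algebra_simps)
      also have "\<dots> \<le> C3 * 2 ^ m" by (intro mult_left_mono Suc_le_two_power C3)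
      finally have "(C2 * real m + 1) * (1 / 4) ^ m \<le> C3 * 2 ^ m * (1 / 4) ^ m" by (rule mult_right_mono) simp
      also have "C3 * 2 ^ m * (1 / 4) ^ m = C3 * (1 / 2) ^ m" by (simp add: mult.assoc flip: power_mult_distrib)
      finally show ?thesis .
    qed
    then have "(C2 * real m + 1) * (1 / 4) ^ m * norm V \<le> C3 * (1 / 2) ^ m * norm V" by (rule mult_right_mono) simp
    moreover have "2 * C2 * norm V \<le> C3 * norm V" by (simp add: C3_def mult_right_mono)
    ultimately show ?thesis using \<kappa> by (intro exI[of _ \<kappa>]) linarith
  qed
  then show ?thesis using C3 by (intro exI[of _ n] conjI exI[of _ C3]) (auto simp: n_def \<tau>_def)
qed

text \<open>Extends the discrete estimate to all phases and all late times: one waits for an integer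
  phase, performs whole steps, and lets the remainder grow for less than one step. The bound
  \<open>C\<close> on the mode coefficient depends on neither \<open>\<epsilon>\<close> nor
  \<open>T\<close>.\<close>

lemma sup_norm_decay:
  assumes zero_decay: "\<And>\<epsilon>. \<epsilon> > 0 \<Longrightarrow> \<exists>t0. \<forall>t\<ge>t0. \<forall>V. norm (flow (\<lambda>_. 0) V t) \<le> \<epsilon> * norm V"
  shows "\<exists>C\<ge>0. \<forall>\<epsilon>>0. \<exists>T0. \<forall>T\<ge>T0. \<forall>y V. \<exists>\<kappa>. \<bar>\<kappa>\<bar> \<le> C * norm V \<and>
    norm (flow (\<lambda>r. W (y + c * r)) V T - \<kappa> *\<^sub>R W' (y + c * T)) \<le> \<epsilon> * norm V"
proof -
  obtain n C where n: "n \<ge> 1" and C: "C \<ge> 0" and dec: "\<And>m V. \<exists>\<kappa>. \<bar>\<kappa>\<bar> \<le> C * norm V \<and>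
    norm (flow \<Psi> V (of_nat m * (of_nat n * p)) - \<kappa> *\<^sub>R W' (c * (of_nat m * (of_nat n * p)))) \<le> C * (1 / 2) ^ m * norm V"
    using sup_norm_decay_steps[OF zero_decay] by blast
  define \<tau> where "\<tau> = of_nat n * p"
  have \<tau>: "\<tau> > 0" using n p_pos by (simp add: \<tau>_def)
  define C' where "C' = C * exp (K * p)"
  have "\<exists>T0. \<forall>T\<ge>T0. \<forall>y V. \<exists>\<kappa>. \<bar>\<kappa>\<bar> \<le> C' * norm V \<and>
    norm (flow (\<lambda>r. W (y + c * r)) V T - \<kappa> *\<^sub>R W' (y + c * T)) \<le> \<epsilon> * norm V" if \<epsilon>: "\<epsilon> > 0" for \<epsilon>
  proof -
    define F where "F = exp (K * \<tau>) * C * exp (K * p)"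
    have F: "F \<ge> 0" using C by (simp add: F_def)
    obtain m0 :: nat where m0: "(1 / 2) ^ m0 < \<epsilon> / (F + 1)"
      using real_arch_pow_inv[of "\<epsilon> / (F + 1)" "1 / 2"] \<epsilon> F by auto
    have Fm: "F * (1 / 2) ^ m \<le> \<epsilon>" if "m \<ge> m0" for m
    proof -
      have "F * (1 / 2) ^ m \<le> (F + 1) * (1 / 2) ^ m0"
        using F that by (intro mult_mono power_decreasing) auto
      also have "\<dots> \<le> \<epsilon>" using m0 F by (simp add: field_simps)
      finally show ?thesis .
    qed
    have "\<exists>\<kappa>. \<bar>\<kappa>\<bar> \<le> C' * norm V \<and>
        norm (flow (\<lambda>r. W (y + c * r)) V T - \<kappa> *\<^sub>R W' (y + c * T)) \<le> \<epsilon> * norm V"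
      if T: "T \<ge> p + of_nat (Suc m0) * \<tau>" for T y V
    proof -
      \<comment> \<open>The wave starting at \<open>y\<close> reaches an integer phase after time
        \<open>r0\<close>; applying \<open>int_phase\<close> to \<open>- y\<close> makes this time
        nonnegative for either sign of \<open>c\<close>.\<close>
      obtain q' :: int where q': "0 \<le> (- y - of_int q') / c" "(- y - of_int q') / c \<le> 1 / \<bar>c\<bar>"
        using int_phase[OF c_nonzero] by blast
      define r0 where "r0 = (- y - of_int q') / c"
      define q where "q = - q'"
      have r0: "0 \<le> r0" "r0 \<le> p" using q' by (auto simp: r0_def p_def)
      have yc: "y + c * r0 = of_int q" using c_nonzero by (simp add: r0_def q_def)
      define m where "m = nat \<lfloor>(T - r0) / \<tau>\<rfloor>"
      define r1 where "r1 = T - r0 - of_nat m * \<tau>"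
      have "of_nat (Suc m0) * \<tau> \<le> T - r0" using T r0 by linarith
      then have ge: "of_nat (Suc m0) \<le> (T - r0) / \<tau>" using \<tau> by (simp add: le_divide_eq)
      then have m: "m \<ge> m0" unfolding m_def by linarith
      have fl: "of_nat m \<le> (T - r0) / \<tau>" "(T - r0) / \<tau> < of_nat m + 1" unfolding m_def using ge by linarith+
      have "of_nat m * \<tau> \<le> T - r0" using fl(1) \<tau> by (simp add: le_divide_eq)
      moreover have "T - r0 < (of_nat m + 1) * \<tau>" using fl(2) \<tau> by (simp add: divide_less_eq)
      ultimately have r1: "0 \<le> r1" "r1 \<le> \<tau>" by (auto simp: r1_def algebra_simps)
      define t where "t = of_nat m * \<tau>"
      have t: "t \<ge> 0" using \<tau> by (simp add: t_def)
      have T_eq: "T = r0 + (t + r1)" by (simp add: r1_def t_def)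
      define U where "U = shift (- q) (flow (\<lambda>r. W (y + c * r)) V r0)"
      have "norm U \<le> exp (K * r0) * norm V" unfolding U_def using norm_flow[OF path_W r0(1)] by simp
      also have "\<dots> \<le> exp (K * p) * norm V" using r0 K(1) by (intro mult_right_mono) auto
      finally have U: "norm U \<le> exp (K * p) * norm V" .
      obtain \<kappa> where \<kappa>: "\<bar>\<kappa>\<bar> \<le> C * norm U" "norm (flow \<Psi> U t - \<kappa> *\<^sub>R W' (c * t)) \<le> C * (1 / 2) ^ m * norm U"
        using dec[of U m] unfolding t_def \<tau>_def by blast
      define E where "E = flow \<Psi> U t - \<kappa> *\<^sub>R W' (c * t)"
      have path': "path_in (\<lambda>r. W (c * t + c * r))" by (rule path_W)
      have shifted: "W (y + c * (r0 + r)) = shift q (\<Psi> r)" for r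
      proof -
        have "y + c * (r0 + r) = c * r + of_int q" unfolding yc[symmetric] by (simp add: distrib_left)
        then show ?thesis by (simp only: W_int)
      qed
      have "flow (\<lambda>r. W (y + c * r)) V T = flow (\<lambda>r. shift q (\<Psi> r)) (shift q U) (t + r1)"
        unfolding T_eq using flow_cocycle[OF path_W r0(1), of "t + r1" y V] t r1(1)
        by (simp add: shifted U_def shift_shift)
      also have "\<dots> = shift q (flow \<Psi> U (t + r1))"
        by (rule flow_shift[OF path_\<Psi>]) (use t r1 in simp)
      also have "flow \<Psi> U (t + r1) = flow (\<lambda>r. W (c * t + c * r)) (E + \<kappa> *\<^sub>R W' (c * t)) r1"
        using flow_cocycle[OF path_\<Psi> t r1(1), of U] by (simp add: E_def distrib_left)
      also have "\<dots> = flow (\<lambda>r. W (c * t + c * r)) E r1 + \<kappa> *\<^sub>R W' (c * t + c * r1)"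
        by (simp add: flow_add[OF path' r1(1)] flow_scaleR[OF path' r1(1)] flow_W'[OF r1(1)])
      also have "shift q \<dots> = shift q (flow (\<lambda>r. W (c * t + c * r)) E r1) + \<kappa> *\<^sub>R W' (y + c * T)"
      proof -
        have "y + c * T = c * t + c * r1 + of_int q" unfolding yc[symmetric] T_eq by (simp add: distrib_left)
        then show ?thesis by (simp only: W'_int shift_linear)
      qed
      finally have "norm (flow (\<lambda>r. W (y + c * r)) V T - \<kappa> *\<^sub>R W' (y + c * T)) = norm (flow (\<lambda>r. W (c * t + c * r)) E r1)"
        by simp
      also have "\<dots> \<le> exp (K * r1) * norm E" by (rule norm_flow[OF path' r1(1)])
      also have "\<dots> \<le> exp (K * \<tau>) * (C * (1 / 2) ^ m * (exp (K * p) * norm V))"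
      proof (rule mult_mono)
        show "exp (K * r1) \<le> exp (K * \<tau>)" using r1 K(1) by simp
        have "C * (1 / 2) ^ m * norm U \<le> C * (1 / 2) ^ m * (exp (K * p) * norm V)"
          using C by (intro mult_left_mono U) auto
        then show "norm E \<le> C * (1 / 2) ^ m * (exp (K * p) * norm V)" using \<kappa>(2) unfolding E_def by linarith
      qed auto
      also have "\<dots> = F * (1 / 2) ^ m * norm V" by (simp add: F_def mult_ac)
      also have "\<dots> \<le> \<epsilon> * norm V" by (intro mult_right_mono Fm m) auto
      finally have "norm (flow (\<lambda>r. W (y + c * r)) V T - \<kappa> *\<^sub>R W' (y + c * T)) \<le> \<epsilon> * norm V" .
      moreover have "\<bar>\<kappa>\<bar> \<le> C' * norm V"
        using \<kappa>(1) mult_left_mono[OF U C] by (simp add: C'_def mult.assoc)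
      ultimately show ?thesis by blast
    qed
    then show ?thesis by blast
  qed
  moreover have "C' \<ge> 0" using C by (simp add: C'_def)
  ultimately show ?thesis by blast
qed

end

section \<open>Two separated waves\<close>

lemma tendsto_exp_decay: "a > 0 \<Longrightarrow> ((\<lambda>t. C * exp (- a * t)) \<longlongrightarrow> 0) at_top" for a C :: real
proof -
  assume a: "a > 0"
  have "filterlim (\<lambda>t. - a * t) at_bot at_top"
    using a by (intro filterlim_tendsto_neg_mult_at_bot[OF tendsto_const] filterlim_ident) auto
  from filterlim_compose[OF exp_at_bot this] show ?thesis by (rule tendsto_mult_right_zero)
qed

text \<open>The margin 1 in \<open>room\<close> keeps a solution in the ball where the cut-off field
  is the true one, as long as it deviates by at most 1 from the sum of the waves.\<close>

locale two_waves = lattice_eq L N g g' b R +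
  m: wave L N g g' b R \<phi>m \<phi>m' cm \<alpha>m \<omega>m 1 + p: wave L N g g' b R \<phi>p \<phi>p' cp \<alpha>p \<omega>p "- 1"
  for L :: "'n::finite bseq \<Rightarrow>\<^sub>L 'n bseq"
    and N :: "'m::finite \<Rightarrow> 'n bseq \<Rightarrow>\<^sub>L 'n bseq"
    and g :: "real ^ 'n ^ 'm \<Rightarrow> real ^ 'n"
    and g' :: "real ^ 'n ^ 'm \<Rightarrow> ((real ^ 'n ^ 'm) \<Rightarrow>\<^sub>L (real ^ 'n))"
    and b R :: real and \<phi>m \<phi>m' cm \<alpha>m \<omega>m \<phi>p \<phi>p' cp \<alpha>p \<omega>p +
  assumes speeds: "cm < cp"
    and room: "\<And>y z. norm (translate \<phi>p y + translate \<phi>m z) + 1 \<le> R"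
begin

lemma signs: "m.s = b" "p.s = - b"
  by (simp_all add: m.s_def p.s_def)

text \<open>
  The linearization at zero decays to the right of the rear wave and to the left of the front
  wave. Since \<open>cm < cp\<close>, every site can be put into both regions by splitting the data between
  the points \<open>- cp t\<close> and \<open>- cm t\<close>.
\<close>

lemma zero_decay:
  assumes \<epsilon>: "\<epsilon> > 0"
  shows "\<exists>t0. \<forall>t\<ge>t0. \<forall>V. norm (flow (\<lambda>_. 0) V t) \<le> \<epsilon> * norm V"
proof -
  obtain C1 a1 where C1: "a1 > 0" "C1 \<ge> 0" "\<And>t h V. t \<ge> 0 \<Longrightarrow>
      (\<And>j. apply_bcontfun V j \<noteq> 0 \<Longrightarrow> b * (of_int j + of_int h) \<le> 0) \<Longrightarrow>
      norm (flow (\<lambda>_. 0) V t 0) \<le> C1 * exp (- a1 * t) * exp (b * (cm * t - of_int h)) * norm V"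
    using m.ahead_decay_ex unfolding signs by blast
  obtain C2 a2 where C2: "a2 > 0" "C2 \<ge> 0" "\<And>t h V. t \<ge> 0 \<Longrightarrow>
      (\<And>j. apply_bcontfun V j \<noteq> 0 \<Longrightarrow> - b * (of_int j + of_int h) \<le> 0) \<Longrightarrow>
      norm (flow (\<lambda>_. 0) V t 0) \<le> C2 * exp (- a2 * t) * exp (- b * (cp * t - of_int h)) * norm V"
    using p.ahead_decay_ex unfolding signs by blast
  have "((\<lambda>t. C1 * exp (- a1 * t) + C2 * exp (- a2 * t)) \<longlongrightarrow> 0 + 0) at_top"
    by (intro tendsto_add tendsto_exp_decay C1 C2)
  then have "\<forall>\<^sub>F t in at_top. C1 * exp (- a1 * t) + C2 * exp (- a2 * t) < \<epsilon>"
    using \<epsilon> by (intro order_tendstoD) auto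
  then obtain t1 where t1: "\<And>t. t \<ge> t1 \<Longrightarrow> C1 * exp (- a1 * t) + C2 * exp (- a2 * t) < \<epsilon>"
    by (auto simp: eventually_at_top_linorder)
  \<comment> \<open>From time \<open>1 / (cp - cm)\<close> on, an integer \<open>h\<close> lies
    between \<open>cm * t\<close> and \<open>cp * t\<close>. Splitting the data at
    \<open>- h\<close> then makes both exponential factors at most 1.\<close>
  define t0 where "t0 = max t1 (max 0 (1 / (cp - cm)))"
  have "norm (flow (\<lambda>_. 0) V t) \<le> \<epsilon> * norm V" if t: "t \<ge> t0" for t V
  proof (rule norm_bound)
    fix k
    have t': "t \<ge> t1" "t \<ge> 0" "1 / (cp - cm) \<le> t" using t by (auto simp: t0_def)
    have "1 \<le> (cp - cm) * t" using t'(3) speeds by (simp add: divide_le_eq mult.commute)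
    define h where "h = \<lceil>cm * t\<rceil>"
    have h: "cm * t \<le> of_int h" "of_int h \<le> cp * t"
      using \<open>1 \<le> (cp - cm) * t\<close> unfolding h_def by (simp_all add: left_diff_distrib) linarith
    define U where "U = shift (- k) V"
    define S where "S = {j. j \<le> - h}"
    have 1: "norm (flow (\<lambda>_. 0) (restrict_seq S U) t 0) \<le> C1 * exp (- a1 * t) * norm V"
    proof -
      have "norm (flow (\<lambda>_. 0) (restrict_seq S U) t 0) \<le>
          C1 * exp (- a1 * t) * exp (b * (cm * t - of_int h)) * norm (restrict_seq S U)"
      proof (rule C1(3)[OF t'(2)])
        fix j assume "restrict_seq S U j \<noteq> 0"
        then have "j + h \<le> 0" by (auto simp: restrict_seq_apply S_def split: if_splits)
        then have "real_of_int (j + h) \<le> 0" by linarith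
        then show "b * (of_int j + of_int h) \<le> 0" using b_pos by (simp add: mult_le_0_iff)
      qed
      also have "\<dots> \<le> C1 * exp (- a1 * t) * 1 * norm V"
        using C1(2) h(1) b_pos norm_restrict_seq[of S U]
        by (intro mult_mono) (auto simp: U_def mult_le_0_iff)
      finally show ?thesis by simp
    qed
    have 2: "norm (flow (\<lambda>_. 0) (restrict_seq (- S) U) t 0) \<le> C2 * exp (- a2 * t) * norm V"
    proof -
      have "norm (flow (\<lambda>_. 0) (restrict_seq (- S) U) t 0) \<le>
          C2 * exp (- a2 * t) * exp (- b * (cp * t - of_int h)) * norm (restrict_seq (- S) U)"
      proof (rule C2(3)[OF t'(2)])
        fix j assume "restrict_seq (- S) U j \<noteq> 0"
        then have "j + h \<ge> 0" by (auto simp: restrict_seq_apply S_def split: if_splits)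
        then have "real_of_int (j + h) \<ge> 0" by linarith
        then show "- b * (of_int j + of_int h) \<le> 0" using b_pos by simp
      qed
      also have "\<dots> \<le> C2 * exp (- a2 * t) * 1 * norm V"
        using C2(2) h(2) b_pos norm_restrict_seq[of "- S" U]
        by (intro mult_mono) (auto simp: U_def)
      finally show ?thesis by simp
    qed
    have "shift (- k) (flow (\<lambda>_. 0) V t) = flow (\<lambda>_. 0) U t"
      using flow_shift[OF path_zero t'(2), of "- k" V] by (simp add: U_def shift_linear)
    also have "\<dots> = flow (\<lambda>_. 0) (restrict_seq S U) t + flow (\<lambda>_. 0) (restrict_seq (- S) U) t"
      using restrict_seq_split[of U S] flow_add[OF path_zero t'(2)] by metis
    finally have "flow (\<lambda>_. 0) V t k = flow (\<lambda>_. 0) (restrict_seq S U) t 0 + flow (\<lambda>_. 0) (restrict_seq (- S) U) t 0"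
      by (metis add.left_neutral diff_minus_eq_add plus_bcontfun.rep_eq shift_apply)
    then have "norm (flow (\<lambda>_. 0) V t k) \<le> C1 * exp (- a1 * t) * norm V + C2 * exp (- a2 * t) * norm V"
      using norm_triangle_le[OF add_mono[OF 1 2]] by simp
    also have "\<dots> = (C1 * exp (- a1 * t) + C2 * exp (- a2 * t)) * norm V" by (simp add: algebra_simps)
    also have "\<dots> \<le> \<epsilon> * norm V" using t1[OF t'(1)] by (intro mult_right_mono) auto
    finally show "norm (flow (\<lambda>_. 0) V t k) \<le> \<epsilon> * norm V" .
  qed
  then show ?thesis by blast
qed

section \<open>Interaction of the two waves\<close>

abbreviation "Wm \<equiv> translate \<phi>m"
abbreviation "Wp \<equiv> translate \<phi>p"
abbreviation "Wm' \<equiv> translate \<phi>m'"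
abbreviation "Wp' \<equiv> translate \<phi>p'"

definition pair :: "real \<Rightarrow> real \<Rightarrow> real \<Rightarrow> 'n bseq" where
  "pair yp ym t = Wp (yp + cp * t) + Wm (ym + cm * t)"

lemma norm_pair: "norm (pair yp ym t) \<le> R - 1"
  using room[of "yp + cp * t" "ym + cm * t"] by (simp add: pair_def)

text \<open>The rear wave decays to its right and the front wave to its left, so their product is
  exponentially small in the current separation, which only increases as
  \<open>cm < cp\<close>.\<close>

lemma pair_interaction:
  assumes t: "t \<ge> 0"
  shows "norm (Fc (pair yp ym t) - Fc (Wp (yp + cp * t)) - Fc (Wm (ym + cm * t))) \<le>
    K * m.CX * p.CX * exp (- b * (yp - ym))"
proof (rule norm_bound)
  fix k
  have "norm ((Fc (pair yp ym t) - Fc (Wp (yp + cp * t)) - Fc (Wm (ym + cm * t))) k)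
      \<le> KG * (norm (nv (Wm (ym + cm * t)) k) * norm (nv (Wp (yp + cp * t)) k))"
    unfolding pair_def using Fc_interaction[of "Wp (yp + cp * t)" "Wm (ym + cm * t)" k]
      p.norm_W m.norm_W norm_pair[of yp ym t] by (simp add: pair_def mult_ac)
  also have "\<dots> \<le> KG * ((KN * m.CX) * (KN * p.CX) * exp (- b * ((yp + cp * t) - (ym + cm * t))))"
    using m.W_wbd[of "ym + cm * t"] p.W_wbd[of "yp + cp * t"] unfolding signs
    by (intro mult_left_mono KG mult_le_if_weights[of b "ym + cm * t" k _ _ "yp + cp * t"] KN(4)) auto
  also have "\<dots> \<le> KG * ((KN * m.CX) * (KN * p.CX) * exp (- b * (yp - ym)))"
  proof -
    have "0 \<le> b * ((cp - cm) * t)" using b_pos speeds t by simp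
    then have "exp (- b * ((yp + cp * t) - (ym + cm * t))) \<le> exp (- b * (yp - ym))"
      by (simp add: algebra_simps)
    then show ?thesis using KG(1) KN(1) m.CX_nonneg p.CX_nonneg by (intro mult_left_mono) auto
  qed
  also have "\<dots> = (KG * KN * KN) * (m.CX * p.CX * exp (- b * (yp - ym)))" by simp
  also have "\<dots> \<le> K * (m.CX * p.CX * exp (- b * (yp - ym)))"
    using m.CX_nonneg p.CX_nonneg by (intro mult_right_mono K) auto
  finally show "norm ((Fc (pair yp ym t) - Fc (Wp (yp + cp * t)) - Fc (Wm (ym + cm * t))) k)
    \<le> K * m.CX * p.CX * exp (- b * (yp - ym))" by (simp add: mult.assoc)
qed

definition deviation :: "(real \<Rightarrow> 'n bseq) \<Rightarrow> real \<Rightarrow> real \<Rightarrow> real \<Rightarrow> 'n bseq" where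
  "deviation X yp ym t = X t - pair yp ym t"

lemma deviation_deriv:
  assumes "(X has_vector_derivative Fc (X t)) (at t within A)"
  shows "(deviation X yp ym has_vector_derivative
    Fc (X t) - (Fc (Wp (yp + cp * t)) + Fc (Wm (ym + cm * t)))) (at t within A)"
  unfolding deviation_def pair_def
  by (intro has_vector_derivative_diff has_vector_derivative_add assms
      has_vector_derivative_at_within[OF p.W_affine_deriv] has_vector_derivative_at_within[OF m.W_affine_deriv])

definition "CI = K * m.CX * p.CX"

lemma CI_nonneg: "CI \<ge> 0"
  using K(1) m.CX_nonneg p.CX_nonneg by (simp add: CI_def)

text \<open>A crude bound without decay; it keeps the solution in the ball during one step, where
  the Taylor remainder is controlled.\<close>

lemma deviation_growth:
  assumes X: "\<And>t. t \<ge> 0 \<Longrightarrow> (X has_vector_derivative Fc (X t)) (at t within {0..})" and T: "T \<ge> 0"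
  shows "norm (deviation X yp ym T) \<le> (norm (deviation X yp ym 0) + CI * exp (- b * (yp - ym)) * T) * exp (K * T)"
proof (rule gronwall[OF T])
  fix t assume t: "t \<in> {0..T}"
  have "(X has_vector_derivative Fc (X t)) (at t within {0..T})"
    using X[of t] t by (auto intro: has_vector_derivative_within_subset)
  then show "(deviation X yp ym has_vector_derivative
      Fc (X t) - (Fc (Wp (yp + cp * t)) + Fc (Wm (ym + cm * t)))) (at t within {0..T})"
    by (rule deviation_deriv)
  have "Fc (X t) - (Fc (Wp (yp + cp * t)) + Fc (Wm (ym + cm * t))) =
      (Fc (X t) - Fc (pair yp ym t)) + (Fc (pair yp ym t) - Fc (Wp (yp + cp * t)) - Fc (Wm (ym + cm * t)))"
    by simp
  also have "norm \<dots> \<le> K * norm (deviation X yp ym t) + CI * exp (- b * (yp - ym))"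
    unfolding CI_def deviation_def
    by (intro order_trans[OF norm_triangle_ineq] add_mono Fc_lipschitz pair_interaction) (use t in simp)
  finally show "norm (Fc (X t) - (Fc (Wp (yp + cp * t)) + Fc (Wm (ym + cm * t)))) \<le>
      K * norm (deviation X yp ym t) + CI * exp (- b * (yp - ym))" .
qed (use K(1) CI_nonneg in auto)

text \<open>Half the separation enters the exponential because the cut at the midpoint leaves each
  piece at that distance from the other wave. The shifts \<open>\<gamma>p\<close> and
  \<open>\<gamma>m\<close> are the negatives of the mode coefficients found for the two
  pieces.\<close>

lemma step_ex:
  "\<exists>T>0. \<exists>Q\<ge>1. \<exists>\<eta>>0. \<forall>X yp ym q.
    (\<forall>t\<ge>0. (X has_vector_derivative Fc (X t)) (at t within {0..})) \<longrightarrow>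
    norm (X 0 - Wp yp - Wm ym) \<le> q \<longrightarrow> q \<le> \<eta> \<longrightarrow> exp (- b * (yp - ym) / 2) \<le> \<eta> \<longrightarrow>
    (\<forall>t\<in>{0..T}. norm (X t - Wp (yp + cp * t) - Wm (ym + cm * t)) \<le> Q * (q + exp (- b * (yp - ym) / 2))) \<and>
    (\<exists>\<gamma>p \<gamma>m. \<bar>\<gamma>p\<bar> \<le> Q * (q + exp (- b * (yp - ym) / 2)) \<and> \<bar>\<gamma>m\<bar> \<le> Q * (q + exp (- b * (yp - ym) / 2)) \<and>
      norm (X T - Wp (yp + cp * T + \<gamma>p) - Wm (ym + cm * T + \<gamma>m)) \<le> 1 / 2 * q + Q * exp (- b * (yp - ym) / 2))"
proof -
  obtain Cm where Cm: "Cm \<ge> 0" and m_dec: "\<And>\<epsilon>. \<epsilon> > 0 \<Longrightarrow> \<exists>T0. \<forall>T\<ge>T0. \<forall>y V. \<exists>\<kappa>. \<bar>\<kappa>\<bar> \<le> Cm * norm V \<and>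
    norm (flow (\<lambda>r. Wm (y + cm * r)) V T - \<kappa> *\<^sub>R Wm' (y + cm * T)) \<le> \<epsilon> * norm V"
    using m.sup_norm_decay[OF zero_decay] by blast
  obtain Cp where Cp: "Cp \<ge> 0" and p_dec: "\<And>\<epsilon>. \<epsilon> > 0 \<Longrightarrow> \<exists>T0. \<forall>T\<ge>T0. \<forall>y V. \<exists>\<kappa>. \<bar>\<kappa>\<bar> \<le> Cp * norm V \<and>
    norm (flow (\<lambda>r. Wp (y + cp * r)) V T - \<kappa> *\<^sub>R Wp' (y + cp * T)) \<le> \<epsilon> * norm V"
    using p.sup_norm_decay[OF zero_decay] by blast
  have eighth: "(0 :: real) < 1 / 8" by simp
  obtain Tm where Tm: "\<And>T y V. T \<ge> Tm \<Longrightarrow> \<exists>\<kappa>. \<bar>\<kappa>\<bar> \<le> Cm * norm V \<and>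
    norm (flow (\<lambda>r. Wm (y + cm * r)) V T - \<kappa> *\<^sub>R Wm' (y + cm * T)) \<le> 1 / 8 * norm V"
    using m_dec[OF eighth] by blast
  obtain Tp where Tp: "\<And>T y V. T \<ge> Tp \<Longrightarrow> \<exists>\<kappa>. \<bar>\<kappa>\<bar> \<le> Cp * norm V \<and>
    norm (flow (\<lambda>r. Wp (y + cp * r)) V T - \<kappa> *\<^sub>R Wp' (y + cp * T)) \<le> 1 / 8 * norm V"
    using p_dec[OF eighth] by blast
  define T where "T = max 1 (max Tm Tp)"
  have T: "T > 0" "T \<ge> Tm" "T \<ge> Tp" by (auto simp: T_def)
  define Q0 where "Q0 = (1 + CI * T) * exp (K * T)"
  have Q0: "Q0 \<ge> 1"
  proof -
    have "1 * 1 \<le> (1 + CI * T) * exp (K * T)" using CI_nonneg T K(1) by (intro mult_mono) auto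
    then show ?thesis by (simp add: Q0_def)
  qed
  define c2 where "c2 = K * p.CX * (2 * exp (K * T)) * exp (b * \<bar>cp\<bar> * T)"
  define c3 where "c3 = K * m.CX * (2 * exp (K * T)) * exp (b * \<bar>cm\<bar> * T)"
  have c23: "c2 \<ge> 0" "c3 \<ge> 0" using K(1) m.CX_nonneg p.CX_nonneg by (auto simp: c2_def c3_def)
  define G where "G = (c2 + c3 + 4 * K * Q0\<^sup>2 + CI) * T * exp (K * T)"
  have G: "G \<ge> 0" using c23 K(1) CI_nonneg T by (simp add: G_def)
  define H where "H = m.CW * Cm\<^sup>2 + p.CW * Cp\<^sup>2"
  have H: "H \<ge> 0" using m.CW_pos p.CW_pos by (simp add: H_def)
  \<comment> \<open>\<open>Q0 * (2 * \<eta>) \<le> 1\<close> keeps the solution in the ball;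
    \<open>(G + H) * \<eta> \<le> 1 / 4\<close> together with 1/8 from each linear piece gives the
    contraction factor 1/2.\<close>
  define \<eta> where "\<eta> = 1 / (4 * (Q0 + G + H))"
  have \<eta>: "\<eta> > 0" "\<eta> \<le> 1" "Q0 * (2 * \<eta>) \<le> 1" "(G + H) * \<eta> \<le> 1 / 4"
    using Q0 G H by (auto simp: \<eta>_def field_simps)
  define Q where "Q = Q0 + G + Cm + Cp"
  have Q: "Q \<ge> 1" "Q0 \<le> Q" "G \<le> Q" "Cm \<le> Q" "Cp \<le> Q" using Q0 G Cm Cp by (auto simp: Q_def)
  have step: "(\<forall>t\<in>{0..T}. norm (X t - Wp (yp + cp * t) - Wm (ym + cm * t)) \<le> Q * (q + e)) \<and>
    (\<exists>\<gamma>p \<gamma>m. \<bar>\<gamma>p\<bar> \<le> Q * (q + e) \<and> \<bar>\<gamma>m\<bar> \<le> Q * (q + e) \<and>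
      norm (X T - Wp (yp + cp * T + \<gamma>p) - Wm (ym + cm * T + \<gamma>m)) \<le> 1 / 2 * q + Q * e)"
    if X: "\<And>t. t \<ge> 0 \<Longrightarrow> (X has_vector_derivative Fc (X t)) (at t within {0..})"
      and init: "norm (X 0 - Wp yp - Wm ym) \<le> q" and q_le: "q \<le> \<eta>"
      and e_eq: "e = exp (- b * (yp - ym) / 2)" and e_le: "e \<le> \<eta>" for X yp ym q e
  proof -
    define V where "V = deviation X yp ym"
    have q: "q \<ge> 0" using init norm_ge_zero order_trans by blast
    have e: "e > 0" "e \<le> 1" using e_le \<eta>(2) by (simp add: e_eq, linarith)
    have V_eq: "V t = X t - Wp (yp + cp * t) - Wm (ym + cm * t)" for t
      by (simp add: V_def deviation_def pair_def)
    have V0: "norm (V 0) \<le> q" using init by (simp add: V_eq)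
    have e2: "exp (- b * (yp - ym)) = e * e" unfolding e_eq exp_add[symmetric] by simp
    have ee: "e * e \<le> e" using mult_left_mono[OF e(2), of e] e by simp
    have crude: "norm (V t) \<le> Q0 * (q + e)" if t: "t \<in> {0..T}" for t
    proof -
      have "norm (V t) \<le> (norm (V 0) + CI * (e * e) * t) * exp (K * t)"
        using deviation_growth[OF X, of t yp ym] t unfolding V_def e2 by simp
      also have "\<dots> \<le> ((q + e) + CI * (q + e) * T) * exp (K * T)"
      proof -
        have "norm (V 0) \<le> q + e" using V0 e by simp
        moreover have "CI * (e * e) \<le> CI * (q + e)" using CI_nonneg ee q by (intro mult_left_mono) auto
        then have "CI * (e * e) * t \<le> CI * (q + e) * T"
          by (rule mult_mono) (use t CI_nonneg q e in auto)
        ultimately have "norm (V 0) + CI * (e * e) * t \<le> (q + e) + CI * (q + e) * T" by (rule add_mono)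
        moreover have "0 \<le> (q + e) + CI * (q + e) * T" using q e CI_nonneg T by simp
        ultimately show ?thesis using t K(1) by (intro mult_mono) auto
      qed
      also have "\<dots> = Q0 * (q + e)" by (simp add: Q0_def algebra_simps)
      finally show ?thesis .
    qed
    have qe: "q + e \<le> 2 * \<eta>" using q_le e_le by simp
    have small: "Q0 * (q + e) \<le> 1" using order_trans[OF mult_left_mono[OF qe, of Q0] \<eta>(3)] Q0 by simp
    define \<mu> where "\<mu> = (yp + ym) / 2"
    define S where "S = {j :: int. of_int j \<le> \<mu>}"
    define V1 where "V1 = restrict_seq S (V 0)"
    define V2 where "V2 = restrict_seq (- S) (V 0)"
    have V12: "norm V1 \<le> q" "norm V2 \<le> q"
      using norm_restrict_seq[of S "V 0"] norm_restrict_seq[of "- S" "V 0"] V0 by (auto simp: V1_def V2_def)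
    have wbd1: "wbd (wt b \<mu>) (2 * q) V1"
    proof -
      have "wbd (wt b \<mu>) ((1 + exp 0) * norm V1) V1"
        by (rule wbd_if_support) (use b_pos in \<open>auto simp: V1_def restrict_seq_apply S_def mult_le_0_iff split: if_splits\<close>)
      then show ?thesis by (rule wbd_mono) (use V12 in simp)
    qed
    have wbd2: "wbd (wt (- b) \<mu>) (2 * q) V2"
    proof -
      have "wbd (wt (- b) \<mu>) ((1 + exp 0) * norm V2) V2"
        by (rule wbd_if_support) (use b_pos in \<open>auto simp: V2_def restrict_seq_apply S_def mult_le_0_iff split: if_splits\<close>)
      then show ?thesis by (rule wbd_mono) (use V12 in simp)
    qed
    define \<Psi>m where "\<Psi>m = (\<lambda>r. Wm (ym + cm * r))"
    define \<Psi>p where "\<Psi>p = (\<lambda>r. Wp (yp + cp * r))"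
    have path: "path_in \<Psi>m" "path_in \<Psi>p" unfolding \<Psi>m_def \<Psi>p_def by (rule m.path_W p.path_W)+
    define Y1 where "Y1 = flow \<Psi>m V1"
    define Y2 where "Y2 = flow \<Psi>p V2"
    define Om where "Om = pair yp ym"
    have Om_norm: "norm (Om t) \<le> R" for t using norm_pair[of yp ym t] by (simp add: Om_def)
    have Om_diff: "Om t - \<Psi>m t = \<Psi>p t" "Om t - \<Psi>p t = \<Psi>m t" for t by (simp_all add: Om_def pair_def \<Psi>m_def \<Psi>p_def)
    have err1: "norm (M (Om t) (Y1 t) - M (\<Psi>m t) (Y1 t)) \<le> c2 * q * e" if t: "t \<in> {0..T}" for t
    proof -
      have "wbd (wt b \<mu>) (2 * q * exp (K * t)) (Y1 t)"
        unfolding Y1_def by (rule flow_wbd[OF path(1) _ _ wbd1]) (use t in auto)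
      moreover have "2 * q * exp (K * t) \<le> 2 * q * exp (K * T)" using t K(1) q by (intro mult_left_mono) auto
      ultimately have "wbd (wt (- (- b)) \<mu>) (2 * q * exp (K * T)) (Y1 t)" by (auto intro: wbd_mono)
      moreover have "wbd (wt (- b) (yp + cp * t)) p.CX (Om t - \<Psi>m t)"
        unfolding Om_diff \<Psi>p_def using p.W_wbd by (simp add: signs)
      ultimately have "norm (M (Om t) (Y1 t) - M (\<Psi>m t) (Y1 t)) \<le>
          K * p.CX * (2 * q * exp (K * T)) * exp (- (- b) * (\<mu> - (yp + cp * t)))"
        by (intro M_diff_if_wbd Om_norm path_norm path) auto
      also have "- (- b) * (\<mu> - (yp + cp * t)) = - b * (yp - ym) / 2 + - (b * (cp * t))"
        by (simp add: \<mu>_def field_simps)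
      also have "exp \<dots> \<le> e * exp (b * \<bar>cp\<bar> * T)"
      proof -
        have "- (cp * t) \<le> \<bar>cp\<bar> * T"
          using t abs_ge_minus_self[of "cp * t"] mult_left_mono[of t T "\<bar>cp\<bar>"] by (simp add: abs_mult)
        then have "b * (- (cp * t)) \<le> b * (\<bar>cp\<bar> * T)" using b_pos by (intro mult_left_mono) auto
        then show ?thesis unfolding exp_add e_eq by (intro mult_left_mono) (auto simp: mult.assoc)
      qed
      finally have "norm (M (Om t) (Y1 t) - M (\<Psi>m t) (Y1 t)) \<le>
          K * p.CX * (2 * q * exp (K * T)) * (e * exp (b * \<bar>cp\<bar> * T))"
        using K(1) p.CX_nonneg q by (simp add: mult_left_mono)
      also have "\<dots> = c2 * q * e" by (simp add: c2_def mult_ac)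
      finally show ?thesis .
    qed
    have err2: "norm (M (Om t) (Y2 t) - M (\<Psi>p t) (Y2 t)) \<le> c3 * q * e" if t: "t \<in> {0..T}" for t
    proof -
      have "wbd (wt (- b) \<mu>) (2 * q * exp (K * t)) (Y2 t)"
        unfolding Y2_def by (rule flow_wbd[OF path(2) _ _ wbd2]) (use t in auto)
      moreover have "2 * q * exp (K * t) \<le> 2 * q * exp (K * T)" using t K(1) q by (intro mult_left_mono) auto
      ultimately have "wbd (wt (- b) \<mu>) (2 * q * exp (K * T)) (Y2 t)" by (rule wbd_mono)
      moreover have "wbd (wt b (ym + cm * t)) m.CX (Om t - \<Psi>p t)"
        unfolding Om_diff \<Psi>m_def using m.W_wbd by (simp add: signs)
      ultimately have "norm (M (Om t) (Y2 t) - M (\<Psi>p t) (Y2 t)) \<le>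
          K * m.CX * (2 * q * exp (K * T)) * exp (- b * (\<mu> - (ym + cm * t)))"
        by (intro M_diff_if_wbd Om_norm path_norm path) auto
      also have "- b * (\<mu> - (ym + cm * t)) = - b * (yp - ym) / 2 + b * (cm * t)"
        by (simp add: \<mu>_def field_simps)
      also have "exp \<dots> \<le> e * exp (b * \<bar>cm\<bar> * T)"
      proof -
        have "cm * t \<le> \<bar>cm\<bar> * T"
          using t abs_ge_self[of "cm * t"] mult_left_mono[of t T "\<bar>cm\<bar>"] by (simp add: abs_mult)
        then have "b * (cm * t) \<le> b * (\<bar>cm\<bar> * T)" using b_pos by (intro mult_left_mono) auto
        then show ?thesis unfolding exp_add e_eq by (intro mult_left_mono) (auto simp: mult.assoc)
      qed
      finally have "norm (M (Om t) (Y2 t) - M (\<Psi>p t) (Y2 t)) \<le>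
          K * m.CX * (2 * q * exp (K * T)) * (e * exp (b * \<bar>cm\<bar> * T))"
        using K(1) m.CX_nonneg q by (simp add: mult_left_mono)
      also have "\<dots> = c3 * q * e" by (simp add: c3_def mult_ac)
      finally show ?thesis .
    qed
    \<comment> \<open>What remains after both linear evolutions are removed. Its forcing collects
      the coupling of each piece to the other wave, the Taylor remainder and the interaction of the
      waves, all of order \<open>\<eta> * q + e\<close>.\<close>
    define Z where "Z t = V t - Y1 t - Y2 t" for t
    define f where "f = c2 * q * e + c3 * q * e + K * (Q0 * (q + e))\<^sup>2 + CI * (e * e)"
    have f: "f \<ge> 0" using c23 q e K(1) CI_nonneg by (simp add: f_def)
    have "norm (Z T) \<le> (norm (Z 0) + f * T) * exp (K * T)"
    proof (rule gronwall[OF less_imp_le[OF T(1)] _ f])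
      fix t assume t: "t \<in> {0..T}"
      have dX: "(X has_vector_derivative Fc (X t)) (at t within {0..T})"
        using X[of t] t by (auto intro: has_vector_derivative_within_subset)
      show "(Z has_vector_derivative Fc (X t) - (Fc (\<Psi>p t) + Fc (\<Psi>m t)) - M (\<Psi>m t) (Y1 t) - M (\<Psi>p t) (Y2 t)) (at t within {0..T})"
        unfolding Z_def V_def Y1_def Y2_def \<Psi>p_def \<Psi>m_def
        by (intro has_vector_derivative_diff deviation_deriv dX flow_deriv path[unfolded \<Psi>p_def \<Psi>m_def])
      have Xt: "X t = Om t + V t" by (simp add: V_def deviation_def Om_def)
      have "norm (X t) \<le> norm (Om t) + norm (V t)" unfolding Xt by (rule norm_triangle_ineq)
      then have Xn: "norm (X t) \<le> R" using crude[OF t] small norm_pair[of yp ym t] by (simp add: Om_def)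
      define e1 where "e1 = Fc (X t) - Fc (Om t) - M (Om t) (V t)"
      define e2' where "e2' = Fc (Om t) - Fc (\<Psi>p t) - Fc (\<Psi>m t)"
      define e3 where "e3 = M (Om t) (Y1 t) - M (\<Psi>m t) (Y1 t)"
      define e4 where "e4 = M (Om t) (Y2 t) - M (\<Psi>p t) (Y2 t)"
      have "norm e1 \<le> K * norm (V t) * norm (V t)"
        using Fc_taylor[OF Om_norm Xn, of t] by (simp add: e1_def Xt)
      also have "\<dots> \<le> K * (Q0 * (q + e)) * (Q0 * (q + e))"
        using K(1) crude[OF t] Q0 q e by (intro mult_mono) auto
      finally have n1: "norm e1 \<le> K * (Q0 * (q + e))\<^sup>2" by (simp add: power2_eq_square mult_ac)
      have n2: "norm e2' \<le> CI * (e * e)"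
        unfolding e2'_def Om_def \<Psi>p_def \<Psi>m_def CI_def e2[symmetric] by (rule pair_interaction) (use t in simp)
      have n3: "norm e3 \<le> c2 * q * e" unfolding e3_def by (rule err1[OF t])
      have n4: "norm e4 \<le> c3 * q * e" unfolding e4_def by (rule err2[OF t])
      have "Fc (X t) - (Fc (\<Psi>p t) + Fc (\<Psi>m t)) - M (\<Psi>m t) (Y1 t) - M (\<Psi>p t) (Y2 t) =
          M (Om t) (Z t) + (e3 + e4 + e1 + e2')"
        by (simp add: e1_def e2'_def e3_def e4_def Z_def blinfun.diff_right)
      also have "norm \<dots> \<le> K * norm (Z t) + (c2 * q * e + c3 * q * e + K * (Q0 * (q + e))\<^sup>2 + CI * (e * e))"
        by (intro order_trans[OF norm_triangle_ineq] add_mono norm_M_apply Om_norm n1 n2 n3 n4)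
      finally show "norm (Fc (X t) - (Fc (\<Psi>p t) + Fc (\<Psi>m t)) - M (\<Psi>m t) (Y1 t) - M (\<Psi>p t) (Y2 t)) \<le> K * norm (Z t) + f"
        unfolding f_def .
    qed (use K(1) in simp)
    moreover have "Z 0 = 0"
      using restrict_seq_split[of "V 0" S] path by (simp add: Z_def Y1_def Y2_def V1_def V2_def algebra_simps)
    ultimately have ZT: "norm (Z T) \<le> f * T * exp (K * T)" by simp
    have "f \<le> (c2 + c3 + 4 * K * Q0\<^sup>2 + CI) * (\<eta> * q + e)"
    proof -
      have "q * e \<le> \<eta> * e" using q_le e by (intro mult_right_mono) auto
      also have "\<dots> \<le> 1 * e" using \<eta> e by (intro mult_right_mono) auto
      finally have qe1: "q * e \<le> \<eta> * q + e" using \<eta> q by (simp add: add_increasing)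
      have "(q + e)\<^sup>2 = (q + e) * (q + e)" by (simp add: power2_eq_square)
      also have "\<dots> \<le> 2 * \<eta> * (q + e)" using qe q e by (intro mult_right_mono) auto
      also have "\<dots> \<le> 4 * (\<eta> * q + e)" using \<eta> q e by (simp add: algebra_simps add_increasing2 mult_le_cancel_right1)
      finally have sq: "(q + e)\<^sup>2 \<le> 4 * (\<eta> * q + e)" .
      have ee': "e * e \<le> \<eta> * q + e" using ee \<eta> q by (simp add: add_increasing)
      have "f = c2 * (q * e) + c3 * (q * e) + K * Q0\<^sup>2 * (q + e)\<^sup>2 + CI * (e * e)"
        by (simp add: f_def power_mult_distrib mult_ac)
      also have "\<dots> \<le> c2 * (\<eta> * q + e) + c3 * (\<eta> * q + e) + K * Q0\<^sup>2 * (4 * (\<eta> * q + e)) + CI * (\<eta> * q + e)"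
        using c23 K(1) CI_nonneg by (intro add_mono mult_left_mono qe1 sq ee') auto
      also have "\<dots> = (c2 + c3 + 4 * K * Q0\<^sup>2 + CI) * (\<eta> * q + e)" by (simp add: algebra_simps)
      finally show ?thesis .
    qed
    then have "f * (T * exp (K * T)) \<le> (c2 + c3 + 4 * K * Q0\<^sup>2 + CI) * (\<eta> * q + e) * (T * exp (K * T))"
      using T by (intro mult_right_mono) auto
    also have "\<dots> = G * (\<eta> * q + e)" by (simp add: G_def mult_ac)
    finally have ZT': "norm (Z T) \<le> G * \<eta> * q + G * e" using ZT by (simp add: algebra_simps)
    obtain km where km: "\<bar>km\<bar> \<le> Cm * norm V1" "norm (Y1 T - km *\<^sub>R Wm' (ym + cm * T)) \<le> 1 / 8 * norm V1"
      using Tm[OF T(2), of V1 ym] unfolding Y1_def \<Psi>m_def by blast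
    obtain kp where kp: "\<bar>kp\<bar> \<le> Cp * norm V2" "norm (Y2 T - kp *\<^sub>R Wp' (yp + cp * T)) \<le> 1 / 8 * norm V2"
      using Tp[OF T(3), of V2 yp] unfolding Y2_def \<Psi>p_def by blast
    have km_q: "\<bar>km\<bar> \<le> Cm * q" and kp_q: "\<bar>kp\<bar> \<le> Cp * q"
      using km(1) kp(1) mult_left_mono[OF V12(1) Cm] mult_left_mono[OF V12(2) Cp] by linarith+
    \<comment> \<open>Shifting the phase by \<open>- km\<close> produces
      \<open>km *\<^sub>R Wm'\<close> up to a quadratic error, and \<open>q \<le> \<eta>\<close>
      turns that error into a small multiple of \<open>q\<close>.\<close>
    have taylor_m: "norm (Wm (ym + cm * T + - km) - Wm (ym + cm * T) + (- km) *\<^sub>R Wm' (ym + cm * T)) \<le> m.CW * Cm\<^sup>2 * (\<eta> * q)"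
    proof -
      have "(- km)\<^sup>2 \<le> (Cm * q)\<^sup>2" using km_q by (simp add: abs_le_square_iff[symmetric] Cm q)
      also have "\<dots> \<le> Cm\<^sup>2 * (\<eta> * q)"
        using q q_le by (simp add: power_mult_distrib power2_eq_square[of q] mult_left_mono mult_right_mono)
      finally have "m.CW * (- km)\<^sup>2 \<le> m.CW * (Cm\<^sup>2 * (\<eta> * q))" using m.CW_pos by (intro mult_left_mono) auto
      then show ?thesis using m.W_taylor[of "ym + cm * T" "- km"] by (simp add: mult.assoc)
    qed
    have taylor_p: "norm (Wp (yp + cp * T + - kp) - Wp (yp + cp * T) + (- kp) *\<^sub>R Wp' (yp + cp * T)) \<le> p.CW * Cp\<^sup>2 * (\<eta> * q)"
    proof -
      have "(- kp)\<^sup>2 \<le> (Cp * q)\<^sup>2" using kp_q by (simp add: abs_le_square_iff[symmetric] Cp q)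
      also have "\<dots> \<le> Cp\<^sup>2 * (\<eta> * q)"
        using q q_le by (simp add: power_mult_distrib power2_eq_square[of q] mult_left_mono mult_right_mono)
      finally have "p.CW * (- kp)\<^sup>2 \<le> p.CW * (Cp\<^sup>2 * (\<eta> * q))" using p.CW_pos by (intro mult_left_mono) auto
      then show ?thesis using p.W_taylor[of "yp + cp * T" "- kp"] by (simp add: mult.assoc)
    qed
    define x1 where "x1 = Y1 T - km *\<^sub>R Wm' (ym + cm * T)"
    define x2 where "x2 = Y2 T - kp *\<^sub>R Wp' (yp + cp * T)"
    define x3 where "x3 = Wm (ym + cm * T + - km) - Wm (ym + cm * T) + (- km) *\<^sub>R Wm' (ym + cm * T)"
    define x4 where "x4 = Wp (yp + cp * T + - kp) - Wp (yp + cp * T) + (- kp) *\<^sub>R Wp' (yp + cp * T)"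
    have "X T - Wp (yp + cp * T + - kp) - Wm (ym + cm * T + - km) = (Z T + (x1 + x2)) - (x3 + x4)"
      by (simp add: Z_def V_eq x1_def x2_def x3_def x4_def)
    also have "norm \<dots> \<le> (norm (Z T) + (norm x1 + norm x2)) + (norm x3 + norm x4)"
      by (intro order_trans[OF norm_triangle_ineq4] add_mono order_trans[OF norm_triangle_ineq] order_refl)
    also have "\<dots> \<le> (G * \<eta> * q + G * e + (1 / 8 * q + 1 / 8 * q)) + (m.CW * Cm\<^sup>2 * (\<eta> * q) + p.CW * Cp\<^sup>2 * (\<eta> * q))"
      using ZT' km(2) kp(2) V12 taylor_m taylor_p unfolding x1_def x2_def x3_def x4_def
      by (intro add_mono) linarith+
    also have "\<dots> = ((G + H) * \<eta>) * q + 1 / 4 * q + G * e" by (simp add: H_def algebra_simps)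
    also have "\<dots> \<le> 1 / 4 * q + 1 / 4 * q + Q * e"
      using q e by (intro add_mono mult_right_mono \<eta> Q) auto
    finally have final: "norm (X T - Wp (yp + cp * T + - kp) - Wm (ym + cm * T + - km)) \<le> 1 / 2 * q + Q * e" by simp
    have Qqe: "C * q \<le> Q * (q + e)" "C * (q + e) \<le> Q * (q + e)" if "C \<le> Q" "C \<ge> 0" for C
      using that q e Q by (auto intro!: mult_mono)
    have "\<bar>- kp\<bar> \<le> Q * (q + e)" "\<bar>- km\<bar> \<le> Q * (q + e)"
      using km_q kp_q Qqe(1)[OF Q(4) Cm] Qqe(1)[OF Q(5) Cp] by auto
    moreover have "norm (X t - Wp (yp + cp * t) - Wm (ym + cm * t)) \<le> Q * (q + e)" if "t \<in> {0..T}" for t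
      using crude[OF that] Qqe(2)[OF Q(2)] Q0 unfolding V_eq by linarith
    ultimately show ?thesis using final by blast
  qed
  show ?thesis
  proof (rule exI[of _ T], intro conjI T, rule exI[of _ Q], intro conjI Q, rule exI[of _ \<eta>],
      intro conjI \<eta> allI impI)
    fix X yp ym q
    assume "\<forall>t\<ge>0. (X has_vector_derivative Fc (X t)) (at t within {0..})" "norm (X 0 - Wp yp - Wm ym) \<le> q"
      "q \<le> \<eta>" "exp (- b * (yp - ym) / 2) \<le> \<eta>"
    then show "\<forall>t\<in>{0..T}. norm (X t - Wp (yp + cp * t) - Wm (ym + cm * t)) \<le> Q * (q + exp (- b * (yp - ym) / 2))"
      and "\<exists>\<gamma>p \<gamma>m. \<bar>\<gamma>p\<bar> \<le> Q * (q + exp (- b * (yp - ym) / 2)) \<and> \<bar>\<gamma>m\<bar> \<le> Q * (q + exp (- b * (yp - ym) / 2)) \<and>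
        norm (X T - Wp (yp + cp * T + \<gamma>p) - Wm (ym + cm * T + \<gamma>m)) \<le> 1 / 2 * q + Q * exp (- b * (yp - ym) / 2)"
      using step[of X yp ym q, OF _ _ _ refl] by blast+
  qed
qed

end

section \<open>Convergence\<close>

lemma geometric_increments_limit:
  fixes x :: "nat \<Rightarrow> real"
  assumes inc: "\<And>n. \<bar>x (Suc n) - x n\<bar> \<le> c * \<theta> ^ n" and \<theta>: "0 \<le> \<theta>" "\<theta> < 1" and c: "c \<ge> 0"
  shows "\<exists>l. \<forall>n. \<bar>l - x n\<bar> \<le> c / (1 - \<theta>) * \<theta> ^ n"
proof -
  have "summable (\<lambda>n. c * \<theta> ^ n)" using \<theta> by (intro summable_mult summable_geometric) auto
  then have sum: "summable (\<lambda>n. \<bar>x (Suc n) - x n\<bar>)"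
    by (rule summable_comparison_test') (use inc in auto)
  define l where "l = x 0 + (\<Sum>n. x (Suc n) - x n)"
  have "\<bar>l - x n\<bar> \<le> c / (1 - \<theta>) * \<theta> ^ n" for n
  proof -
    have "(\<Sum>i<n. x (Suc i) - x i) = x n - x 0" by (rule sum_lessThan_telescope)
    then have "l - x n = (\<Sum>i. x (Suc (i + n)) - x (i + n))"
      using suminf_split_initial_segment[OF summable_rabs_cancel[OF sum], of n] by (simp add: l_def)
    also have "\<bar>\<dots>\<bar> \<le> (\<Sum>i. \<bar>x (Suc (i + n)) - x (i + n)\<bar>)"
      using summable_ignore_initial_segment[OF sum, of n] by (intro summable_rabs) simp
    also have "\<dots> \<le> (\<Sum>i. c * \<theta> ^ n * \<theta> ^ i)"
    proof (rule suminf_le)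
      show "\<bar>x (Suc (i + n)) - x (i + n)\<bar> \<le> c * \<theta> ^ n * \<theta> ^ i" for i
        using inc[of "i + n"] by (simp add: power_add mult_ac)
      show "summable (\<lambda>i. \<bar>x (Suc (i + n)) - x (i + n)\<bar>)"
        using summable_ignore_initial_segment[OF sum, of n] by simp
      show "summable (\<lambda>i. c * \<theta> ^ n * \<theta> ^ i)" using \<theta> by (intro summable_mult summable_geometric) auto
    qed
    also have "\<dots> = c / (1 - \<theta>) * \<theta> ^ n"
      using \<theta> by (simp add: suminf_mult suminf_geometric summable_geometric)
    finally show ?thesis .
  qed
  then show ?thesis by blast
qed

lemma translate_bounded_ex:
  assumes "bounded (range \<phi>)"
  shows "\<exists>C. \<forall>y. norm (translate \<phi> y) \<le> C"
proof -
  obtain C where C: "\<And>x. norm (\<phi> x) \<le> C" using assms by (auto simp: bounded_iff)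
  have "norm (translate \<phi> y) \<le> C" for y
    by (rule norm_bound) (simp add: translate_apply[OF assms] C)
  then show ?thesis by blast
qed

lemma (in lattice_eq) solution_unique:
  assumes T: "T \<ge> 0"
    and X: "solves (\<lambda>_ X. L X + nonlinearity g N X) {0..} X" "\<And>t. t \<in> {0..T} \<Longrightarrow> norm (X t) \<le> R"
    and Y: "solves (\<lambda>_ X. L X + nonlinearity g N X) {0..} Y" "\<And>t. t \<in> {0..T} \<Longrightarrow> norm (Y t) \<le> R"
    and init: "X 0 = Y 0"
  shows "X T = Y T"
proof (rule ode_unique[OF T, where F = "\<lambda>_ X. L X + nonlinearity g N X" and K = K])
  fix t assume t: "t \<in> {0..T}"
  show "(X has_vector_derivative L (X t) + nonlinearity g N (X t)) (at t within {0..T})"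
    using X(1) t by (auto simp: solves_def intro: has_vector_derivative_within_subset)
  show "(Y has_vector_derivative L (Y t) + nonlinearity g N (Y t)) (at t within {0..T})"
    using Y(1) t by (auto simp: solves_def intro: has_vector_derivative_within_subset)
  show "norm (L (X t) + nonlinearity g N (X t) - (L (Y t) + nonlinearity g N (Y t))) \<le> K * norm (X t - Y t)"
    using Fc_lipschitz[of "X t" "Y t"] X(2)[OF t] Y(2)[OF t] by (simp add: Fc_eq)
qed (use K(1) init in auto)

context two_waves
begin

lemma pair_stable:
  "\<exists>a>0. \<forall>\<epsilon>>0. \<exists>C>0. \<exists>\<delta>>0. \<exists>\<tau>s>0. \<forall>X \<tau>p \<tau>m.
    (\<forall>t\<ge>0. (X has_vector_derivative Fc (X t)) (at t within {0..})) \<longrightarrow>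
    norm (X 0 - Wp \<tau>p - Wm \<tau>m) \<le> \<delta> \<longrightarrow> \<tau>p - \<tau>m \<ge> \<tau>s \<longrightarrow>
    (\<forall>t\<ge>0. norm (X t) \<le> R) \<and>
    (\<exists>\<gamma>p\<in>{- \<epsilon><..<\<epsilon>}. \<exists>\<gamma>m\<in>{- \<epsilon><..<\<epsilon>}. \<forall>t\<ge>0.
      exp (a * t) * norm (X t - Wp (cp * t + \<tau>p + \<gamma>p) - Wm (cm * t + \<tau>m + \<gamma>m)) \<le> C)"
proof -
  obtain T Q \<eta> where T: "T > 0" and Q: "Q \<ge> 1" and \<eta>: "\<eta> > 0"
    and step: "\<And>X yp ym q. (\<And>t. t \<ge> 0 \<Longrightarrow> (X has_vector_derivative Fc (X t)) (at t within {0..})) \<Longrightarrow>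
    norm (X 0 - Wp yp - Wm ym) \<le> q \<Longrightarrow> q \<le> \<eta> \<Longrightarrow> exp (- b * (yp - ym) / 2) \<le> \<eta> \<Longrightarrow>
    (\<forall>t\<in>{0..T}. norm (X t - Wp (yp + cp * t) - Wm (ym + cm * t)) \<le> Q * (q + exp (- b * (yp - ym) / 2))) \<and>
    (\<exists>\<gamma>p \<gamma>m. \<bar>\<gamma>p\<bar> \<le> Q * (q + exp (- b * (yp - ym) / 2)) \<and> \<bar>\<gamma>m\<bar> \<le> Q * (q + exp (- b * (yp - ym) / 2)) \<and>
      norm (X T - Wp (yp + cp * T + \<gamma>p) - Wm (ym + cm * T + \<gamma>m)) \<le> 1 / 2 * q + Q * exp (- b * (yp - ym) / 2))"
    using step_ex by blast
  \<comment> \<open>A step halves the deviation and, by the choice of \<open>E\<close>, adds at most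
    a quarter of the current bound: hence 3/4. The other entry is the factor by which the separation
    term shrinks in time \<open>T\<close>.\<close>
  define \<theta> where "\<theta> = max (3 / 4) (exp (- b * (cp - cm) * T / 2))"
  have "exp (- b * (cp - cm) * T / 2) < 1" using b_pos speeds T by simp
  then have \<theta>: "\<theta> \<ge> 3 / 4" "\<theta> < 1" "exp (- b * (cp - cm) * T / 2) \<le> \<theta>" by (auto simp: \<theta>_def)
  define a where "a = - ln \<theta> / T"
  have "ln \<theta> < 0" using \<theta> by (intro ln_less_zero) auto
  then have a: "a > 0" using T by (simp add: a_def divide_neg_pos)
  show ?thesis
  proof (rule exI[of _ a], intro conjI a allI impI)
    fix \<epsilon> :: real assume \<epsilon>: "\<epsilon> > 0"
    \<comment> \<open>Makes the sum \<open>G\<close> of all phase shifts at most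
      \<open>min 1 \<epsilon> / 4\<close>; the division by \<open>4 * Q\<close> in \<open>E\<close>
      limits the inhomogeneity \<open>Q * E\<close> to a quarter of \<open>D\<close>.\<close>
    define D where "D = min \<eta> ((1 - \<theta>) * min 1 \<epsilon> / (8 * Q))"
    have D: "D > 0" "D \<le> \<eta>" using \<eta> \<theta> Q \<epsilon> by (auto simp: D_def)
    define E where "E = D / (4 * Q)"
    have E: "E > 0" "E \<le> D" "4 * (Q * E) = D" using D Q by (auto simp: E_def field_simps)
    define c where "c = Q * (D + E)"
    define G where "G = c / (1 - \<theta>)"
    have c: "c > 0" using D E Q by (simp add: c_def)
    have G: "G > 0" "G \<le> min 1 \<epsilon> / 4"
    proof -
      have "D \<le> (1 - \<theta>) * min 1 \<epsilon> / (8 * Q)" by (simp add: D_def)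
      then have "D * (8 * Q) \<le> (1 - \<theta>) * min 1 \<epsilon>" using Q by (simp add: pos_le_divide_eq)
      moreover have "c \<le> Q * (2 * D)" unfolding c_def using E Q by (intro mult_left_mono) auto
      ultimately have "c \<le> min 1 \<epsilon> / 4 * (1 - \<theta>)" by (simp add: algebra_simps)
      moreover have "1 - \<theta> > 0" using \<theta> by simp
      ultimately show "G \<le> min 1 \<epsilon> / 4" unfolding G_def by (simp only: pos_divide_le_eq)
      show "G > 0" using c \<theta> by (simp add: G_def)
    qed
    have c_le: "c \<le> G" using c \<theta> by (simp add: G_def pos_le_divide_eq mult_le_cancel_left2)
    \<comment> \<open>The added 1 is a reserve for the phase shifts, at most 1/4 for each wave in
      total, so the separation never falls below \<open>\<tau>s - 1\<close>.\<close>
    define \<tau>s where "\<tau>s = 1 + max 0 (- 2 * ln E / b)"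
    have \<tau>s: "\<tau>s > 0" "exp (- b * (\<tau>s - 1) / 2) \<le> E"
    proof -
      show "\<tau>s > 0" by (simp add: \<tau>s_def add_pos_nonneg)
      have "- 2 * ln E / b \<le> \<tau>s - 1" by (simp add: \<tau>s_def)
      then have "- 2 * ln E \<le> (\<tau>s - 1) * b" by (simp only: pos_divide_le_eq[OF b_pos])
      then have "- b * (\<tau>s - 1) / 2 \<le> ln E" by (simp add: field_simps)
      then have "exp (- b * (\<tau>s - 1) / 2) \<le> exp (ln E)" by simp
      then show "exp (- b * (\<tau>s - 1) / 2) \<le> E" using E by simp
    qed
    \<comment> \<open>The division by \<theta> covers the times inside a step, where
      \<open>exp (a * t)\<close> is bounded only by the inverse of
      \<open>\<theta> ^ Suc n\<close>.\<close>
    define C where "C = (c + (p.CW + m.CW) * G) / \<theta>"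
    have C: "C > 0" using c G \<theta> p.CW_pos m.CW_pos by (simp add: C_def add_pos_pos)
    have main: "(\<forall>t\<ge>0. norm (X t) \<le> R) \<and>
        (\<exists>\<gamma>p\<in>{- \<epsilon><..<\<epsilon>}. \<exists>\<gamma>m\<in>{- \<epsilon><..<\<epsilon>}. \<forall>t\<ge>0.
          exp (a * t) * norm (X t - Wp (cp * t + \<tau>p + \<gamma>p) - Wm (cm * t + \<tau>m + \<gamma>m)) \<le> C)"
      if X: "\<And>t. t \<ge> 0 \<Longrightarrow> (X has_vector_derivative Fc (X t)) (at t within {0..})"
        and init: "norm (X 0 - Wp \<tau>p - Wm \<tau>m) \<le> D" and sep: "\<tau>p - \<tau>m \<ge> \<tau>s" for X \<tau>p \<tau>m
    proof -
      define err where "err t = (\<lambda>(\<Gamma>p, \<Gamma>m). norm (X t - Wp (cp * t + \<tau>p + \<Gamma>p) - Wm (cm * t + \<tau>m + \<Gamma>m)))" for t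
      \<comment> \<open>\<open>G * (1 - \<theta> ^ n)\<close> is the sum of the first
        \<open>n\<close> bounds \<open>c * \<theta> ^ i\<close> on the phase increments.\<close>
      define near where "near n = (\<lambda>(\<Gamma>p, \<Gamma>m). err (real n * T) (\<Gamma>p, \<Gamma>m) \<le> D * \<theta> ^ n \<and>
        \<bar>\<Gamma>p\<bar> \<le> G * (1 - \<theta> ^ n) \<and> \<bar>\<Gamma>m\<bar> \<le> G * (1 - \<theta> ^ n))" for n
      define next_to where "next_to n = (\<lambda>(\<Gamma>p, \<Gamma>m) (\<Gamma>p', \<Gamma>m'). \<bar>\<Gamma>p' - \<Gamma>p\<bar> \<le> c * \<theta> ^ n \<and> \<bar>\<Gamma>m' - \<Gamma>m\<bar> \<le> c * \<theta> ^ n \<and>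
        (\<forall>t\<in>{0..T}. err (real n * T + t) (\<Gamma>p, \<Gamma>m) \<le> c * \<theta> ^ n))" for n
      have "\<exists>f. \<forall>n. near n (f n) \<and> next_to n (f n) (f (Suc n))"
      proof (rule dependent_nat_choice)
        show "\<exists>x. near 0 x" using init by (intro exI[of _ "(0, 0)"]) (simp add: near_def err_def)
        fix x n assume near: "near n x"
        obtain \<Gamma>p \<Gamma>m where x: "x = (\<Gamma>p, \<Gamma>m)" by (cases x)
        define s where "s = real n * T"
        have s: "s \<ge> 0" using T by (simp add: s_def)
        have \<theta>n: "0 < \<theta> ^ n" "\<theta> ^ n \<le> 1" using \<theta> by (auto simp: power_le_one)
        define yp where "yp = cp * s + \<tau>p + \<Gamma>p"
        define ym where "ym = cm * s + \<tau>m + \<Gamma>m"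
        have err_n: "norm (X s - Wp yp - Wm ym) \<le> D * \<theta> ^ n" and \<Gamma>: "\<bar>\<Gamma>p\<bar> \<le> G * (1 - \<theta> ^ n)" "\<bar>\<Gamma>m\<bar> \<le> G * (1 - \<theta> ^ n)"
          using near by (auto simp: near_def x err_def s_def yp_def ym_def)
        have "G * (1 - \<theta> ^ n) \<le> (1 / 4) * 1" using G \<theta>n by (intro mult_mono) auto
        then have "yp - ym \<ge> (\<tau>s - 1) + (cp - cm) * s"
          using \<Gamma> sep unfolding yp_def ym_def by (simp add: left_diff_distrib)
        then have "b * (yp - ym) \<ge> b * ((\<tau>s - 1) + (cp - cm) * s)" using b_pos by (intro mult_left_mono) auto
        then have "- b * (yp - ym) / 2 \<le> - (b * ((\<tau>s - 1) + (cp - cm) * s)) / 2" by simp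
        also have "\<dots> = - b * (\<tau>s - 1) / 2 + real n * (- b * (cp - cm) * T / 2)"
          by (simp add: s_def field_simps)
        finally have "exp (- b * (yp - ym) / 2) \<le> exp (- b * (\<tau>s - 1) / 2 + real n * (- b * (cp - cm) * T / 2))"
          by (simp only: exp_le_cancel_iff)
        also have "\<dots> = exp (- b * (\<tau>s - 1) / 2) * exp (- b * (cp - cm) * T / 2) ^ n"
          unfolding exp_add exp_of_nat_mult ..
        also have "\<dots> \<le> E * \<theta> ^ n" using E by (intro mult_mono \<tau>s power_mono \<theta>) auto
        finally have e: "exp (- b * (yp - ym) / 2) \<le> E * \<theta> ^ n" .
        have X': "((\<lambda>t. X (s + t)) has_vector_derivative Fc (X (s + t))) (at t within {0..})" if "t \<ge> 0" for t
        proof -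
          have d: "((\<lambda>t. s + t) has_vector_derivative 1) (at t within {0..})" by (auto intro!: derivative_eq_intros)
          have "(X has_vector_derivative Fc (X (s + t))) (at (s + t) within (\<lambda>t. s + t) ` {0..})"
            using X[of "s + t"] that s by (auto intro: has_vector_derivative_within_subset)
          from vector_diff_chain_within[OF d this] show ?thesis by (simp add: o_def)
        qed
        have "D * \<theta> ^ n \<le> D * 1" using D \<theta>n by (intro mult_left_mono) auto
        then have q_le: "D * \<theta> ^ n \<le> \<eta>" using D by linarith
        have "E * \<theta> ^ n \<le> E * 1" using E \<theta>n by (intro mult_left_mono) auto
        then have e_le: "exp (- b * (yp - ym) / 2) \<le> \<eta>" using e E D by linarith
        have Qe: "Q * (D * \<theta> ^ n + exp (- b * (yp - ym) / 2)) \<le> c * \<theta> ^ n"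
        proof -
          have "Q * (D * \<theta> ^ n + exp (- b * (yp - ym) / 2)) \<le> Q * (D * \<theta> ^ n + E * \<theta> ^ n)"
            using Q e by (intro mult_left_mono) auto
          also have "\<dots> = c * \<theta> ^ n" by (simp add: c_def algebra_simps)
          finally show ?thesis .
        qed
        have in_X: "norm (X (s + 0) - Wp yp - Wm ym) \<le> D * \<theta> ^ n" using err_n by simp
        note st = step[of "\<lambda>t. X (s + t)", OF X' in_X q_le e_le]
        then obtain \<gamma>p \<gamma>m where \<gamma>: "\<bar>\<gamma>p\<bar> \<le> c * \<theta> ^ n" "\<bar>\<gamma>m\<bar> \<le> c * \<theta> ^ n"
          and fin: "norm (X (s + T) - Wp (yp + cp * T + \<gamma>p) - Wm (ym + cm * T + \<gamma>m)) \<le>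
            1 / 2 * (D * \<theta> ^ n) + Q * exp (- b * (yp - ym) / 2)"
          using Qe by (meson order_trans)
        have during: "err (s + t) (\<Gamma>p, \<Gamma>m) \<le> c * \<theta> ^ n" if "t \<in> {0..T}" for t
        proof -
          have "norm (X (s + t) - Wp (yp + cp * t) - Wm (ym + cm * t)) \<le> c * \<theta> ^ n"
            using st that Qe order_trans by blast
          then show ?thesis by (simp add: err_def yp_def ym_def algebra_simps)
        qed
        have "Q * exp (- b * (yp - ym) / 2) \<le> Q * (E * \<theta> ^ n)" using Q e by (intro mult_left_mono) auto
        also have "\<dots> = 1 / 4 * D * \<theta> ^ n" using E(3) by (simp add: mult.assoc[symmetric])
        finally have "1 / 2 * (D * \<theta> ^ n) + Q * exp (- b * (yp - ym) / 2) \<le> 3 / 4 * (D * \<theta> ^ n)" by simp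
        also have "\<dots> \<le> \<theta> * (D * \<theta> ^ n)" using \<theta> D \<theta>n by (intro mult_right_mono) auto
        finally have fin': "norm (X (s + T) - Wp (yp + cp * T + \<gamma>p) - Wm (ym + cm * T + \<gamma>m)) \<le> D * \<theta> ^ Suc n"
          using fin by (simp add: mult_ac)
        have sT: "real (Suc n) * T = s + T" by (simp add: s_def algebra_simps)
        have G_suc: "G * (1 - \<theta> ^ n) + c * \<theta> ^ n = G * (1 - \<theta> ^ Suc n)"
        proof -
          have "c = G * (1 - \<theta>)" using \<theta> by (simp add: G_def)
          then have "G * (1 - \<theta> ^ n) + c * \<theta> ^ n = G * (1 - \<theta> ^ n) + G * (1 - \<theta>) * \<theta> ^ n" by simp
          then show ?thesis by (simp add: algebra_simps)
        qed
        have "near (Suc n) (\<Gamma>p + \<gamma>p, \<Gamma>m + \<gamma>m)"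
          unfolding near_def err_def prod.case sT
        proof (intro conjI)
          show "norm (X (s + T) - Wp (cp * (s + T) + \<tau>p + (\<Gamma>p + \<gamma>p)) - Wm (cm * (s + T) + \<tau>m + (\<Gamma>m + \<gamma>m))) \<le> D * \<theta> ^ Suc n"
            using fin' by (simp add: yp_def ym_def algebra_simps)
          show "\<bar>\<Gamma>p + \<gamma>p\<bar> \<le> G * (1 - \<theta> ^ Suc n)" "\<bar>\<Gamma>m + \<gamma>m\<bar> \<le> G * (1 - \<theta> ^ Suc n)"
            using \<Gamma> \<gamma> unfolding G_suc[symmetric] by linarith+
        qed
        moreover have "next_to n x (\<Gamma>p + \<gamma>p, \<Gamma>m + \<gamma>m)"
          using \<gamma> during by (simp add: next_to_def x s_def)
        ultimately show "\<exists>y. near (Suc n) y \<and> next_to n x y" by blast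
      qed
      then obtain f where f: "\<And>n. near n (f n)" "\<And>n. next_to n (f n) (f (Suc n))" by blast
      define fp where "fp n = fst (f n)" for n
      define fm where "fm n = snd (f n)" for n
      have f_eq: "f n = (fp n, fm n)" for n by (simp add: fp_def fm_def)
      have inc: "\<bar>fp (Suc n) - fp n\<bar> \<le> c * \<theta> ^ n" "\<bar>fm (Suc n) - fm n\<bar> \<le> c * \<theta> ^ n"
        and during: "t \<in> {0..T} \<Longrightarrow> err (real n * T + t) (fp n, fm n) \<le> c * \<theta> ^ n" for n t
        using f(2)[of n] by (auto simp: next_to_def f_eq)
      have "near 0 (fp 0, fm 0)" using f(1)[of 0] by (simp add: f_eq)
      then have f0: "fp 0 = 0" "fm 0 = 0" by (auto simp: near_def)
      have \<theta>0: "0 \<le> \<theta>" "0 \<le> c" using \<theta> c by auto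
      obtain \<gamma>p where \<gamma>p: "\<And>n. \<bar>\<gamma>p - fp n\<bar> \<le> G * \<theta> ^ n"
        using geometric_increments_limit[of fp c \<theta>, OF inc(1) \<theta>0(1) \<theta>(2) \<theta>0(2)] unfolding G_def by blast
      obtain \<gamma>m where \<gamma>m: "\<And>n. \<bar>\<gamma>m - fm n\<bar> \<le> G * \<theta> ^ n"
        using geometric_increments_limit[of fm c \<theta>, OF inc(2) \<theta>0(1) \<theta>(2) \<theta>0(2)] unfolding G_def by blast
      have "\<bar>\<gamma>p\<bar> < \<epsilon>" "\<bar>\<gamma>m\<bar> < \<epsilon>" using \<gamma>p[of 0] \<gamma>m[of 0] f0 G \<epsilon> by auto
      moreover have time: "norm (X t) \<le> R \<and>
          exp (a * t) * norm (X t - Wp (cp * t + \<tau>p + \<gamma>p) - Wm (cm * t + \<tau>m + \<gamma>m)) \<le> C" if t: "t \<ge> 0" for t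
      proof -
        define n where "n = nat \<lfloor>t / T\<rfloor>"
        define r where "r = t - real n * T"
        have "real n \<le> t / T" "t / T < real n + 1" using t T unfolding n_def by (simp_all add: floor_less_iff)
        then have n: "real n * T \<le> t" "t < (real n + 1) * T" using T by (auto simp: field_simps)
        then have r: "r \<in> {0..T}" by (auto simp: r_def algebra_simps)
        have t_eq: "t = real n * T + r" by (simp add: r_def)
        have \<theta>n: "0 < \<theta> ^ n" "\<theta> ^ n \<le> 1" using \<theta> by (auto simp: power_le_one)
        have e1: "norm (X t - Wp (cp * t + \<tau>p + fp n) - Wm (cm * t + \<tau>m + fm n)) \<le> c * \<theta> ^ n"
          using during[OF r, of n] unfolding t_eq[symmetric] by (simp add: err_def)
        have "norm (X t) \<le> R"
        proof -
          have "c * \<theta> ^ n \<le> G * 1" using c_le \<theta>n G by (intro mult_mono) auto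
          then have "norm (X t - Wp (cp * t + \<tau>p + fp n) - Wm (cm * t + \<tau>m + fm n)) \<le> 1" using e1 G by linarith
          moreover have "norm (X t) \<le> norm (X t - Wp (cp * t + \<tau>p + fp n) - Wm (cm * t + \<tau>m + fm n)) +
              norm (Wp (cp * t + \<tau>p + fp n) + Wm (cm * t + \<tau>m + fm n))"
            using norm_triangle_sub[of "X t" "Wp (cp * t + \<tau>p + fp n) + Wm (cm * t + \<tau>m + fm n)"]
            by (simp add: diff_diff_eq add.commute)
          ultimately show ?thesis using room[of "cp * t + \<tau>p + fp n" "cm * t + \<tau>m + fm n"] by linarith
        qed
        moreover have "exp (a * t) * norm (X t - Wp (cp * t + \<tau>p + \<gamma>p) - Wm (cm * t + \<tau>m + \<gamma>m)) \<le> C"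
        proof -
          have e2: "norm (Wp (cp * t + \<tau>p + fp n) - Wp (cp * t + \<tau>p + \<gamma>p)) \<le> p.CW * (G * \<theta> ^ n)"
            by (rule order_trans[OF p.W_lipschitz mult_left_mono])
              (use \<gamma>p[of n] p.CW_pos in \<open>auto simp: abs_minus_commute\<close>)
          have e3: "norm (Wm (cm * t + \<tau>m + fm n) - Wm (cm * t + \<tau>m + \<gamma>m)) \<le> m.CW * (G * \<theta> ^ n)"
            by (rule order_trans[OF m.W_lipschitz mult_left_mono])
              (use \<gamma>m[of n] m.CW_pos in \<open>auto simp: abs_minus_commute\<close>)
          have "X t - Wp (cp * t + \<tau>p + \<gamma>p) - Wm (cm * t + \<tau>m + \<gamma>m) =
              (X t - Wp (cp * t + \<tau>p + fp n) - Wm (cm * t + \<tau>m + fm n)) +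
              ((Wp (cp * t + \<tau>p + fp n) - Wp (cp * t + \<tau>p + \<gamma>p)) + (Wm (cm * t + \<tau>m + fm n) - Wm (cm * t + \<tau>m + \<gamma>m)))"
            by simp
          also have "norm \<dots> \<le> c * \<theta> ^ n + (p.CW * (G * \<theta> ^ n) + m.CW * (G * \<theta> ^ n))"
            by (intro order_trans[OF norm_triangle_ineq] add_mono e1 e2 e3)
          also have "\<dots> = (c + (p.CW + m.CW) * G) * \<theta> ^ n" by (simp add: algebra_simps)
          also have "\<dots> = C * \<theta> ^ Suc n" using \<theta> by (simp add: C_def)
          finally have le: "norm (X t - Wp (cp * t + \<tau>p + \<gamma>p) - Wm (cm * t + \<tau>m + \<gamma>m)) \<le> C * \<theta> ^ Suc n" .
          have "a * t \<le> a * ((real n + 1) * T)" using n a by (intro mult_left_mono) auto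
          also have "\<dots> = - (real (Suc n) * ln \<theta>)" using T by (simp add: a_def field_simps)
          finally have "exp (a * t) \<le> exp (- (real (Suc n) * ln \<theta>))" by simp
          also have "\<dots> = inverse (\<theta> ^ Suc n)"
          proof -
            have "exp (real (Suc n) * ln \<theta>) = \<theta> ^ Suc n"
              unfolding exp_of_nat_mult using \<theta> by simp
            then show ?thesis by (simp only: exp_minus)
          qed
          finally have "exp (a * t) * norm (X t - Wp (cp * t + \<tau>p + \<gamma>p) - Wm (cm * t + \<tau>m + \<gamma>m)) \<le> inverse (\<theta> ^ Suc n) * (C * \<theta> ^ Suc n)"
            using le \<theta> by (intro mult_mono) auto
          also have "\<dots> = C" using \<theta> by (simp add: field_simps)
          finally show ?thesis .
        qed
        ultimately show ?thesis ..
      qed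
      ultimately show ?thesis by (intro conjI bexI[of _ \<gamma>p] bexI[of _ \<gamma>m]) auto
    qed
    show "\<exists>C>0. \<exists>\<delta>>0. \<exists>\<tau>s>0. \<forall>X \<tau>p \<tau>m.
      (\<forall>t\<ge>0. (X has_vector_derivative Fc (X t)) (at t within {0..})) \<longrightarrow>
      norm (X 0 - Wp \<tau>p - Wm \<tau>m) \<le> \<delta> \<longrightarrow> \<tau>p - \<tau>m \<ge> \<tau>s \<longrightarrow>
      (\<forall>t\<ge>0. norm (X t) \<le> R) \<and>
      (\<exists>\<gamma>p\<in>{- \<epsilon><..<\<epsilon>}. \<exists>\<gamma>m\<in>{- \<epsilon><..<\<epsilon>}. \<forall>t\<ge>0.
        exp (a * t) * norm (X t - Wp (cp * t + \<tau>p + \<gamma>p) - Wm (cm * t + \<tau>m + \<gamma>m)) \<le> C)"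
      by (rule exI[of _ C], rule conjI[OF C], rule exI[of _ D], rule conjI[OF D(1)],
          rule exI[of _ \<tau>s], rule conjI[OF \<tau>s(1)], intro allI impI, rule main) auto
  qed
qed

end

theorem theorem1p2:
  fixes L :: "'n::finite bseq \<Rightarrow>\<^sub>L 'n bseq"
    and N :: "'m::finite \<Rightarrow> 'n bseq \<Rightarrow>\<^sub>L 'n bseq"
    and g :: "real ^ 'n ^ 'm \<Rightarrow> real ^ 'n"
    and G :: "'n bseq \<Rightarrow> 'n bseq"
    and \<phi>m \<phi>p \<phi>m' \<phi>p' :: "real \<Rightarrow> real ^ 'n"
    and \<alpha>m \<omega>m \<alpha>p \<omega>p :: "real ^ 'n"
    and b cm cp :: real
  assumes b_pos: "b > 0"
    and L_const: "\<And>v. L (const_bcontfun v) = 0"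
    and L_shift: "shift_invariant L"
    and L_weighted: "\<And>\<beta>. \<beta> \<in> {- b..b} \<Longrightarrow> bounded_on_wspace \<beta> L"
    and G_def: "G = nonlinearity g N"
    and g_C11: "C11_loc g"
    and g_0: "g 0 = 0"
    and N_shift: "\<And>i. shift_invariant (N i)"
    and N_weighted: "\<And>i \<beta>. \<beta> \<in> {- b..b} \<Longrightarrow> bounded_on_wspace \<beta> (N i)"
    and wave_m: "traveling_wave (\<lambda>X. L X + G X) \<phi>m cm \<alpha>m \<omega>m"
    and wave_p: "traveling_wave (\<lambda>X. L X + G X) \<phi>p cp \<alpha>p \<omega>p"
    and speeds: "cm < cp" "cm \<noteq> 0" "cp \<noteq> 0"
    and limits: "\<omega>m = \<alpha>p" "\<alpha>p = 0"
    and \<phi>m_weighted: "sampled_in_wspace \<phi>m b"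
    and \<phi>p_weighted: "sampled_in_wspace \<phi>p (- b)"
    and \<phi>m_deriv: "\<And>x. (\<phi>m has_vector_derivative \<phi>m' x) (at x)"
    and \<phi>p_deriv: "\<And>x. (\<phi>p has_vector_derivative \<phi>p' x) (at x)"
    and \<phi>m'_weighted: "sampled_in_wspace \<phi>m' b"
    and \<phi>p'_weighted: "sampled_in_wspace \<phi>p' (- b)"
    and simple_m: "simple_eigenvalue b (period_map L G \<phi>m cm) 1 (translate \<phi>m' 0)"
    and simple_p: "simple_eigenvalue (- b) (period_map L G \<phi>p cp) 1 (translate \<phi>p' 0)"
    and spectrum_m: "spectrum b (period_map L G \<phi>m cm) - {1} \<subseteq> ball 0 1"
    and spectrum_p: "spectrum (- b) (period_map L G \<phi>p cp) - {1} \<subseteq> ball 0 1"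
  shows "\<exists>a > 0. \<forall>\<epsilon> > 0. \<exists>C > 0. \<exists>\<delta>0 > 0. \<exists>\<tau>s > 0.
    \<forall>Xinit \<tau>p \<tau>m \<delta>.
      norm (Xinit - translate \<phi>p \<tau>p - translate \<phi>m \<tau>m) \<le> \<delta> \<and> \<delta> < \<delta>0 \<and> \<tau>p - \<tau>m \<ge> \<tau>s \<longrightarrow>
      (\<exists>\<gamma>p \<in> {- \<epsilon><..<\<epsilon>}. \<exists>\<gamma>m \<in> {- \<epsilon><..<\<epsilon>}.
        (\<exists>X. solves (\<lambda>_ X. L X + G X) {0..} X \<and> X 0 = Xinit) \<and>
        (\<forall>X. solves (\<lambda>_ X. L X + G X) {0..} X \<and> X 0 = Xinit \<longrightarrow>
          (\<forall>t \<ge> 0. exp (a * t) *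
              norm (X t - translate \<phi>p (cp * t + \<tau>p + \<gamma>p) - translate \<phi>m (cm * t + \<tau>m + \<gamma>m))
            \<le> C * (exp (- a * \<tau>s) + sqrt \<delta>))))"
proof -
  obtain g' :: "real ^ 'n ^ 'm \<Rightarrow> ((real ^ 'n ^ 'm) \<Rightarrow>\<^sub>L (real ^ 'n))"
    where g': "\<And>x. (g has_derivative blinfun_apply (g' x)) (at x)" "\<And>x. \<exists>r>0. \<exists>K. K-lipschitz_on (ball x r) g'"
    using g_C11 unfolding C11_loc_def by blast
  have lattice: "lattice_eq L N g g' b r" if "r > 0" for r
    by unfold_locales (fact b_pos that L_shift L_weighted N_shift N_weighted g' g_0)+
  obtain Rm where Rm: "\<And>y. norm (translate \<phi>m y) \<le> Rm"
    using translate_bounded_ex[OF traveling_wave_bounded[OF wave_m]] by blast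
  obtain Rp where Rp: "\<And>y. norm (translate \<phi>p y) \<le> Rp"
    using translate_bounded_ex[OF traveling_wave_bounded[OF wave_p]] by blast
  define R where "R = Rm + Rp + 1"
  have nonneg: "0 \<le> Rm" "0 \<le> Rp"
    using order_trans[OF norm_ge_zero Rm[of 0]] order_trans[OF norm_ge_zero Rp[of 0]] by simp_all
  then have R: "R > 0" by (simp add: R_def)
  interpret lattice_eq L N g g' b R by (rule lattice[OF R])
  interpret two_waves L N g g' b R \<phi>m \<phi>m' cm \<alpha>m \<omega>m \<phi>p \<phi>p' cp \<alpha>p \<omega>p
  proof unfold_locales
    show "norm (translate \<phi>m y) < R" "norm (translate \<phi>p y) < R" for y
      using Rm[of y] Rp[of y] nonneg by (auto simp: R_def)
    show "norm (translate \<phi>p y + translate \<phi>m z) + 1 \<le> R" for y z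
      using norm_triangle_ineq[of "translate \<phi>p y" "translate \<phi>m z"] Rp[of y] Rm[of z] by (simp add: R_def)
  qed (use wave_m wave_p speeds \<phi>m_weighted \<phi>p_weighted \<phi>m_deriv \<phi>p_deriv simple_m simple_p spectrum_m spectrum_p
      in \<open>simp_all add: G_def\<close>)
  obtain a where a: "a > 0" and stable: "\<forall>\<epsilon>>0. \<exists>C>0. \<exists>\<delta>>0. \<exists>\<tau>s>0. \<forall>X \<tau>p \<tau>m.
    (\<forall>t\<ge>0. (X has_vector_derivative Fc (X t)) (at t within {0..})) \<longrightarrow>
    norm (X 0 - Wp \<tau>p - Wm \<tau>m) \<le> \<delta> \<longrightarrow> \<tau>p - \<tau>m \<ge> \<tau>s \<longrightarrow>
    (\<forall>t\<ge>0. norm (X t) \<le> R) \<and>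
    (\<exists>\<gamma>p\<in>{- \<epsilon><..<\<epsilon>}. \<exists>\<gamma>m\<in>{- \<epsilon><..<\<epsilon>}. \<forall>t\<ge>0.
      exp (a * t) * norm (X t - Wp (cp * t + \<tau>p + \<gamma>p) - Wm (cm * t + \<tau>m + \<gamma>m)) \<le> C)"
    using pair_stable by (elim exE conjE) (rule that)
  show ?thesis
  proof (rule exI[of _ a], intro conjI a allI impI)
    fix \<epsilon> :: real assume "\<epsilon> > 0"
    from stable[THEN spec, THEN mp, OF this] obtain C \<delta>0 \<tau>s where C: "C > 0" and \<delta>0: "\<delta>0 > 0" and \<tau>s: "\<tau>s > 0"
      and main: "\<forall>X \<tau>p \<tau>m. (\<forall>t\<ge>0. (X has_vector_derivative Fc (X t)) (at t within {0..})) \<longrightarrow>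
        norm (X 0 - Wp \<tau>p - Wm \<tau>m) \<le> \<delta>0 \<longrightarrow> \<tau>p - \<tau>m \<ge> \<tau>s \<longrightarrow>
        (\<forall>t\<ge>0. norm (X t) \<le> R) \<and>
        (\<exists>\<gamma>p\<in>{- \<epsilon><..<\<epsilon>}. \<exists>\<gamma>m\<in>{- \<epsilon><..<\<epsilon>}. \<forall>t\<ge>0.
          exp (a * t) * norm (X t - Wp (cp * t + \<tau>p + \<gamma>p) - Wm (cm * t + \<tau>m + \<gamma>m)) \<le> C)"
      by (elim exE conjE) (rule that)
    have goal: "\<exists>\<gamma>p \<in> {- \<epsilon><..<\<epsilon>}. \<exists>\<gamma>m \<in> {- \<epsilon><..<\<epsilon>}.
        (\<exists>X. solves (\<lambda>_ X. L X + G X) {0..} X \<and> X 0 = Xinit) \<and>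
        (\<forall>X. solves (\<lambda>_ X. L X + G X) {0..} X \<and> X 0 = Xinit \<longrightarrow>
          (\<forall>t \<ge> 0. exp (a * t) *
              norm (X t - translate \<phi>p (cp * t + \<tau>p + \<gamma>p) - translate \<phi>m (cm * t + \<tau>m + \<gamma>m))
            \<le> C * exp (a * \<tau>s) * (exp (- a * \<tau>s) + sqrt \<delta>)))"
      if init: "norm (Xinit - translate \<phi>p \<tau>p - translate \<phi>m \<tau>m) \<le> \<delta> \<and> \<delta> < \<delta>0 \<and> \<tau>p - \<tau>m \<ge> \<tau>s"
      for Xinit \<tau>p \<tau>m \<delta>
    proof -
      have \<delta>: "\<delta> \<ge> 0" using init norm_ge_zero order_trans by blast
      \<comment> \<open>The truncated equation is solvable for all data; since this solution stays
        in the ball of radius \<open>R\<close>, it solves the original equation.\<close>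
      obtain X where X: "\<And>t. (X has_vector_derivative Fc (X t)) (at t)" "X 0 = Xinit"
        using Fc_solution_ex by blast
      have X': "\<forall>t\<ge>0. (X has_vector_derivative Fc (X t)) (at t within {0..})"
        using X(1) by (auto intro: has_vector_derivative_at_within)
      have "norm (X 0 - Wp \<tau>p - Wm \<tau>m) \<le> \<delta>0" "\<tau>p - \<tau>m \<ge> \<tau>s" using init X(2) by auto
      from main[THEN spec, THEN spec, THEN spec, THEN mp, OF X', THEN mp, OF this(1), THEN mp, OF this(2)]
      obtain \<gamma>p \<gamma>m where XR: "\<And>t. t \<ge> 0 \<Longrightarrow> norm (X t) \<le> R"
        and \<gamma>: "\<gamma>p \<in> {- \<epsilon><..<\<epsilon>}" "\<gamma>m \<in> {- \<epsilon><..<\<epsilon>}"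
        and bnd: "\<And>t. t \<ge> 0 \<Longrightarrow> exp (a * t) * norm (X t - Wp (cp * t + \<tau>p + \<gamma>p) - Wm (cm * t + \<tau>m + \<gamma>m)) \<le> C"
        by blast
      have solX: "solves (\<lambda>_ X. L X + G X) {0..} X"
        using X' XR by (auto simp: solves_def G_def Fc_eq)
      have unique: "Y t = X t" if Y: "solves (\<lambda>_ X. L X + G X) {0..} Y" "Y 0 = Xinit" and t: "t \<ge> 0" for Y t
      proof -
        have "continuous_on {0..t} Y"
          using Y(1) by (auto simp: solves_def continuous_on_eq_continuous_within
              intro!: has_vector_derivative_continuous[OF has_vector_derivative_within_subset])
        then have "bounded (Y ` {0..t})" by (intro compact_imp_bounded compact_continuous_image) auto
        then obtain r where r: "r > 0" "\<And>u. u \<in> {0..t} \<Longrightarrow> norm (Y u) \<le> r" by (auto simp: bounded_pos)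
        \<comment> \<open>Another solution might leave the ball of radius \<open>R\<close>. On a
          compact time interval it is bounded by some \<open>r\<close>, and the locale at radius
          \<open>R + r\<close> supplies a Lipschitz constant valid for both solutions.\<close>
        interpret big: lattice_eq L N g g' b "R + r" by (rule lattice) (use R r in simp)
        show ?thesis
        proof (rule big.solution_unique[OF t])
          show "norm (X u) \<le> R + r" if "u \<in> {0..t}" for u using XR[of u] that r(1) by simp
          show "norm (Y u) \<le> R + r" if "u \<in> {0..t}" for u using r(2)[OF that] R by simp
        qed (use Y solX X(2) in \<open>simp_all add: G_def\<close>)
      qed
      \<comment> \<open>As \<delta> is nonnegative, so is its root, and the first summand alone
        restores \<open>C\<close>.\<close>
      have "C \<le> C * exp (a * \<tau>s) * (exp (- a * \<tau>s) + sqrt \<delta>)"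
      proof -
        have "C = C * exp (a * \<tau>s) * exp (- a * \<tau>s)" by (simp add: exp_minus)
        also have "\<dots> \<le> C * exp (a * \<tau>s) * (exp (- a * \<tau>s) + sqrt \<delta>)"
          using C \<delta> by (intro mult_left_mono) auto
        finally show ?thesis .
      qed
      then have "exp (a * t) * norm (Y t - Wp (cp * t + \<tau>p + \<gamma>p) - Wm (cm * t + \<tau>m + \<gamma>m)) \<le>
          C * exp (a * \<tau>s) * (exp (- a * \<tau>s) + sqrt \<delta>)"
        if "solves (\<lambda>_ X. L X + G X) {0..} Y" "Y 0 = Xinit" "t \<ge> 0" for Y t
        unfolding unique[OF that] using bnd[OF that(3)] by (rule order_trans[rotated])
      then show ?thesis using \<gamma> solX X(2) by (intro bexI[of _ \<gamma>p] bexI[of _ \<gamma>m] conjI) auto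
    qed
    show "\<exists>C>0. \<exists>\<delta>0>0. \<exists>\<tau>s>0. \<forall>Xinit \<tau>p \<tau>m \<delta>.
      norm (Xinit - translate \<phi>p \<tau>p - translate \<phi>m \<tau>m) \<le> \<delta> \<and> \<delta> < \<delta>0 \<and> \<tau>p - \<tau>m \<ge> \<tau>s \<longrightarrow>
      (\<exists>\<gamma>p \<in> {- \<epsilon><..<\<epsilon>}. \<exists>\<gamma>m \<in> {- \<epsilon><..<\<epsilon>}.
        (\<exists>X. solves (\<lambda>_ X. L X + G X) {0..} X \<and> X 0 = Xinit) \<and>
        (\<forall>X. solves (\<lambda>_ X. L X + G X) {0..} X \<and> X 0 = Xinit \<longrightarrow>
          (\<forall>t \<ge> 0. exp (a * t) *
              norm (X t - translate \<phi>p (cp * t + \<tau>p + \<gamma>p) - translate \<phi>m (cm * t + \<tau>m + \<gamma>m))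
            \<le> C * (exp (- a * \<tau>s) + sqrt \<delta>))))"
      by (rule exI[of _ "C * exp (a * \<tau>s)"], intro conjI exI[of _ \<delta>0] exI[of _ \<tau>s] allI impI goal)
        (use C \<delta>0 \<tau>s in auto)
  qed
qed

end
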